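(* Let $\{x\mapsto G(\lambda,x)\}_{\lambda\in I}$ be a minorant family, with extremal minorants $L(\lambda,z)$, and let $\nu$ be a non-negative Borel measure on $I$ satisfying $$\int_I\int_{-\infty}^{\infty}\{G(\lambda,x)-L(\lambda,x)\}\,dx\,d\nu(\lambda)<\infty.$$ Let $g:\mathbb{R}\to\mathbb{R}$ be a function defining a tempered distribution that is continuous on $\mathbb{R}\setminus\{0\}$, differentiable on $\mathbb{R}\setminus\{0\}$, and such that $$\widehat{g}(\varphi)=\int_{-\infty}^{\infty}\Bigl\{\int_I\widehat{G}(\lambda,t)\,d\nu(\lambda)\Bigr\}\varphi(t)\,dt$$ for all Schwartz functions $\varphi$ supported on $[-1,1]^c$. Then there exists a unique extremal minorant $l(z)$ of exponential type $2\pi$ for $g(x)$. The function $l(x)$ interpolates the values of $g(x)$ at $\mathbb{Z}+\frac12$ and satisfies $$\int_{-\infty}^{\infty}\{g(x)-l(x)\}\,dx=\int_I\int_{-\infty}^{\infty}\{G(\lambda,x)-L(\lambda,x)\}\,dx\,d\nu(\lambda).$$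
   Context: An entire function $F$ is of exponential type (at most) $2\pi$ if for every $\epsilon>0$ there is $C>0$ with $|F(z)|\le Ce^{(2\pi+\epsilon)|z|}$ for all $z\in\mathbb{C}$. An extremal minorant of exponential type $2\pi$ for $f:\mathbb{R}\to\mathbb{R}$ is an entire function $F$ of exponential type at most $2\pi$, real valued on $\mathbb{R}$, with $F(x)\le f(x)$ for all real $x$, that minimizes $\int_{-\infty}^\infty|F(x)-f(x)|\,dx$ among all such functions. Fourier transform: $\widehat{\varphi}(y)=\int_{-\infty}^\infty\varphi(x)e^{-2\pi i xy}\,dx$. A function $g$ defines a tempered distribution by $g(\varphi)=\int_{-\infty}^\infty g(x)\varphi(x)\,dx$ for Schwartz $\varphi$, and $\widehat{g}(\varphi)=g(\widehat\varphi)$. Write $[-1,1]^c=(-\infty,-1)\cup(1,\infty)$. Let $I\subset\mathbb{R}$ be an interval. A family of real valued even functions $x\mapsto G(\lambda,x)$, $\lambda\in I$, is a minorant family if for each $\lambda\in I$: (i) $x\mapsto G(\lambda,x)$ is continuous on $\mathbb{R}$ and differentiable on $\mathbb{R}\setminus\{0\}$; (ii) there are constants $C=C(\lambda)>0$, $\epsilon=\epsilon(\lambda)>0$ with $|G(\lambda,x)|\le C(1+|x|)^{-1-\epsilon}$ and $|\widehat{G}(\lambda,t)|\le C(1+|t|)^{-1-\epsilon}$ for all $x,t\in\mathbb{R}$, where $\widehat G(\lambda,\cdot)$ is the Fourier transform in $x$; (iii) $t\mapsto\widehat{G}(\lambda,t)$ is non-negative and radially non-increasing; (iv) there is a unique extremal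 minorant $z\mapsto L(\lambda,z)$ of exponential type $2\pi$ for $G(\lambda,\cdot)$ that interpolates the values of $G(\lambda,x)$ at $\mathbb{Z}+\frac12$.
   Formalization: As g(0) is unconstrained the claim can fail (ν=0, g=0 off 0, g(0)=-1). So l is shown to be the unique extremal minorant with F≤g imposed off 0, and on all of R if liminf g(x) at 0 is ≤ g(0). Measurability of λ↦G(λ,x) for each x, tacit in the ν-integrals, is assumed. *)

theory Defs
  imports "HOL-Complex_Analysis.Complex_Analysis"
begin

definition exponential_type :: "real \<Rightarrow> (complex \<Rightarrow> complex) \<Rightarrow> bool" where
  "exponential_type \<tau> F \<longleftrightarrow>
     (\<forall>\<epsilon>>0. \<exists>C>0. \<forall>z. norm (F z) \<le> C * exp ((\<tau> + \<epsilon>) * norm z))"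

(* The set X is where the inequality is imposed.  X = UNIV is the usual notion of a
   minorant on the real line; X = - {0} is meant for functions f that are only controlled
   away from the origin (such as -ln |x|), whose value f 0 carries no information. *)
definition minorant_on :: "real set \<Rightarrow> (real \<Rightarrow> real) \<Rightarrow> (complex \<Rightarrow> complex) \<Rightarrow> bool" where
  "minorant_on X f F \<longleftrightarrow>
     F holomorphic_on UNIV \<and> exponential_type (2 * pi) F \<and>
     (\<forall>x::real. F (of_real x) \<in> \<real>) \<and>
     (\<forall>x\<in>X. Re (F (of_real x)) \<le> f x)"

(* The distance is an extended non-negative integral, so that competitors F for which
   F - f is not integrable have infinite distance to f. *)
definition L1_distance :: "(complex \<Rightarrow> complex) \<Rightarrow> (real \<Rightarrow> real) \<Rightarrow> ennreal" where
  "L1_distance F f = (\<integral>\<^sup>+x. ennreal \<bar>Re (F (of_real x)) - f x\<bar> \<partial>lborel)"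

definition extremal_minorant_on :: "real set \<Rightarrow> (real \<Rightarrow> real) \<Rightarrow> (complex \<Rightarrow> complex) \<Rightarrow> bool" where
  "extremal_minorant_on X f F \<longleftrightarrow>
     minorant_on X f F \<and> (\<forall>H. minorant_on X f H \<longrightarrow> L1_distance F f \<le> L1_distance H f)"

abbreviation extremal_minorant :: "(real \<Rightarrow> real) \<Rightarrow> (complex \<Rightarrow> complex) \<Rightarrow> bool" where
  "extremal_minorant \<equiv> extremal_minorant_on UNIV"

definition interpolates_at_half_integers :: "(real \<Rightarrow> real) \<Rightarrow> (complex \<Rightarrow> complex) \<Rightarrow> bool" where
  "interpolates_at_half_integers f F \<longleftrightarrow>
     (\<forall>n::int. F (of_real (of_int n + 1/2)) = of_real (f (of_int n + 1/2)))"

definition fourier :: "(real \<Rightarrow> complex) \<Rightarrow> real \<Rightarrow> complex" where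
  "fourier \<phi> y = (\<integral>x. \<phi> x * exp (- 2 * of_real pi * \<i> * of_real x * of_real y) \<partial>lborel)"

definition nth_derivative :: "nat \<Rightarrow> (real \<Rightarrow> complex) \<Rightarrow> real \<Rightarrow> complex" where
  "nth_derivative n = (\<lambda>\<phi> x. vector_derivative \<phi> (at x)) ^^ n"

definition schwartz :: "(real \<Rightarrow> complex) \<Rightarrow> bool" where
  "schwartz \<phi> \<longleftrightarrow>
     (\<forall>n x. nth_derivative n \<phi> differentiable (at x)) \<and>
     (\<forall>m n. bounded (range (\<lambda>x. of_real (x ^ m) * nth_derivative n \<phi> x)))"

definition schwartz_seminorm :: "nat \<Rightarrow> nat \<Rightarrow> (real \<Rightarrow> complex) \<Rightarrow> real" where
  "schwartz_seminorm m n \<phi> = (SUP x. \<bar>x\<bar> ^ m * norm (nth_derivative n \<phi> x))"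

definition distribution_of :: "(real \<Rightarrow> real) \<Rightarrow> (real \<Rightarrow> complex) \<Rightarrow> complex" where
  "distribution_of g \<phi> = (\<integral>x. of_real (g x) * \<phi> x \<partial>lborel)"

(* Continuity of the functional on the Schwartz space is expressed by the usual bound
   through finitely many seminorms; linearity follows from integrability. *)
definition defines_tempered_distribution :: "(real \<Rightarrow> real) \<Rightarrow> bool" where
  "defines_tempered_distribution g \<longleftrightarrow>
     (\<forall>\<phi>. schwartz \<phi> \<longrightarrow> integrable lborel (\<lambda>x. of_real (g x) * \<phi> x)) \<and>
     (\<exists>C N. \<forall>\<phi>. schwartz \<phi> \<longrightarrow>
        norm (distribution_of g \<phi>) \<le> C * (\<Sum>m\<le>N. \<Sum>n\<le>N. schwartz_seminorm m n \<phi>))"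

definition fourier_distribution :: "((real \<Rightarrow> complex) \<Rightarrow> complex) \<Rightarrow> (real \<Rightarrow> complex) \<Rightarrow> complex" where
  "fourier_distribution T \<phi> = T (fourier \<phi>)"

definition support :: "(real \<Rightarrow> complex) \<Rightarrow> real set" where
  "support \<phi> = closure {t. \<phi> t \<noteq> 0}"

abbreviation Ghat :: "(real \<Rightarrow> real \<Rightarrow> real) \<Rightarrow> real \<Rightarrow> real \<Rightarrow> complex" where
  "Ghat G s \<equiv> fourier (\<lambda>x. of_real (G s x))"

definition minorant_family :: "real set \<Rightarrow> (real \<Rightarrow> real \<Rightarrow> real) \<Rightarrow> bool" where
  "minorant_family I G \<longleftrightarrow> (\<forall>s\<in>I.
     (\<forall>x. G s (- x) = G s x) \<and>
     continuous_on UNIV (G s) \<and> G s differentiable_on (- {0}) \<and>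
     (\<exists>C>0. \<exists>\<epsilon>>0.
        (\<forall>x. \<bar>G s x\<bar> \<le> C * (1 + \<bar>x\<bar>) powr (- 1 - \<epsilon>)) \<and>
        (\<forall>t. norm (Ghat G s t) \<le> C * (1 + \<bar>t\<bar>) powr (- 1 - \<epsilon>))) \<and>
     (\<forall>t. Ghat G s t \<in> \<real>\<^sub>\<ge>\<^sub>0) \<and>
     (\<forall>t u. \<bar>t\<bar> \<le> \<bar>u\<bar> \<longrightarrow> Re (Ghat G s u) \<le> Re (Ghat G s t)) \<and>
     (\<exists>!F. extremal_minorant (G s) F \<and> interpolates_at_half_integers (G s) F))"

end

theory Submission
  imports Defs "HOL-Probability.Probability"
begin

text \<open>
For each parameter \<open>s\<close> put \<open>K\<^sub>s = G\<^sub>s - L\<^sub>s \<ge> 0\<close>. An integrable entire function of exponential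
type \<open>2\<pi>\<close> has a Fourier transform that vanishes outside \<open>(-1, 1)\<close> (\<open>paley_wiener_L1\<close>), so the
transforms of \<open>K\<^sub>s\<close> and \<open>G\<^sub>s\<close> agree outside \<open>(-1, 1)\<close>. The average \<open>k = \<integral> K\<^sub>s d\<nu>(s)\<close> is therefore a
non-negative integrable function which has the same Fourier transform as \<open>g\<close> off \<open>[-1, 1]\<close>. The
difference \<open>g - k\<close> is a tempered distribution with spectrum in \<open>[-1, 1]\<close>, hence almost everywhere
equal to an entire function \<open>l\<close> of exponential type \<open>2\<pi>\<close> (\<open>paley_wiener_schwartz\<close>). By continuity
\<open>l \<le> g\<close> off the origin, and the integral of \<open>g - l\<close> is that of \<open>k\<close>.

Everything else happens at the half-integers, through Fejer means. If \<open>D\<close> is integrable and of type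
\<open>2\<pi>\<close>, its transform \<open>\<Phi>\<close> is continuous and supported in \<open>[-1, 1]\<close>, and the numbers \<open>D(n + 1/2)\<close>
and \<open>D'(n + 1/2)\<close> are, up to constants, Fourier coefficients of the periodisations of \<open>e\<^bsup>\<pi>it\<^esup> \<Phi>(t)\<close> and
\<open>t e\<^bsup>\<pi>it\<^esup> \<Phi>(t)\<close>. Only two translates overlap, so values and slopes at the half-integers determine
\<open>\<Phi>\<close>, by an explicit limit (\<open>recover_twisted\<close>); and since \<open>\<Phi>(\<plusminus>1) = 0\<close>, the Fejer means of the
values alone converge to \<open>\<Phi>(0) = \<integral> D\<close> (\<open>sample_mean_limit\<close>). This has three uses.

\<^item> Optimality and uniqueness (\<open>interpolating_minorant_optimal\<close>). Let \<open>F\<close> be another minorant and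
  \<open>D = F - l\<close>. As \<open>l\<close> interpolates \<open>g\<close>, \<open>D \<le> 0\<close> at every half-integer, so \<open>\<integral> D \<le> 0\<close>. In case of
  equality \<open>D\<close> vanishes at every half-integer, both \<open>F\<close> and \<open>l\<close> touch \<open>g\<close> there from below, and \<open>D\<close> has
  double zeros, which forces \<open>D = 0\<close>.

\<^item> Measurability (\<open>minorant_measurable\<close>). The integration over \<open>s\<close> makes sense because
  \<open>L\<^sub>s\<close> is recovered from the values and slopes of \<open>G\<^sub>s\<close> at the half-integers.

\<^item> Interpolation. The function \<open>k\<close> is only known up to null sets, so \<open>K\<^sub>s(n + 1/2) = 0\<close> says nothing
  directly about \<open>g - l\<close>. Let \<open>\<sigma>\<^sub>N(f)\<close> be the integral of \<open>f\<close> against the periodic Fejer kernel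
  centred at \<open>1/2\<close>. Poisson summation gives \<open>\<sigma>\<^sub>N(K\<^sub>s) \<rightarrow> \<Sum> K\<^sub>s(n + 1/2) = 0\<close>
  (\<open>fejer_integral_tendsto_0\<close>), and \<open>0 \<le> \<sigma>\<^sub>N(K\<^sub>s) \<le> \<integral> K\<^sub>s\<close> (\<open>fejer_integral_le\<close>): the coefficients
  at \<open>n \<noteq> 0\<close> are those of \<open>G\<^sub>s\<close>, and because they are non-negative and non-increasing, they contribute
  an alternating sum of non-positive value. Dominated convergence yields \<open>\<sigma>\<^sub>N(g - l) \<rightarrow> 0\<close>, which for a
  non-negative function continuous at the half-integers means that it vanishes there
  (\<open>fejer_lower_bound\<close>).

The measure \<open>\<nu>\<close> may fail to be sigma-finite. All integration over the parameter is done with the finite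
measure \<open>\<mu>\<close> of density \<open>\<integral> K\<^sub>s\<close> and the normalised functions \<open>K\<^sub>s / \<integral> K\<^sub>s\<close>; where \<open>\<integral> K\<^sub>s = 0\<close>, the
function \<open>K\<^sub>s\<close> is identically zero.
\<close>

section \<open>Fourier transforms of integrable functions\<close>

definition e2pi :: "real \<Rightarrow> complex" where "e2pi x = cis (2 * pi * x)"

lemma e2pi_0 [simp]: "e2pi 0 = 1" by (simp add: e2pi_def)
lemma e2pi_add: "e2pi (x + y) = e2pi x * e2pi y" by (simp add: e2pi_def cis_mult algebra_simps)
lemma norm_e2pi [simp]: "norm (e2pi x) = 1" by (simp add: e2pi_def)
lemma e2pi_minus: "e2pi (- x) = cnj (e2pi x)" by (simp add: e2pi_def cis_cnj)
lemma e2pi_int [simp]: "e2pi (of_int n) = 1"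
  unfolding e2pi_def using cis_multiple_2pi[of "of_int n"] by simp
lemma e2pi_half [simp]: "e2pi (1/2) = -1" by (simp add: e2pi_def)
lemma e2pi_exp: "e2pi x = exp (2 * of_real pi * \<i> * of_real x)"
  by (simp add: e2pi_def cis_conv_exp mult_ac)
lemma continuous_on_e2pi [continuous_intros]:
  "continuous_on A f \<Longrightarrow> continuous_on A (\<lambda>x. e2pi (f x))"
  unfolding e2pi_def by (intro continuous_intros)
lemma measurable_e2pi [measurable]: "e2pi \<in> borel_measurable borel"
  by (intro borel_measurable_continuous_onI continuous_intros)
lemma tendsto_e2pi [tendsto_intros]: "(f \<longlongrightarrow> a) F \<Longrightarrow> ((\<lambda>x. e2pi (f x)) \<longlongrightarrow> e2pi a) F"
  unfolding e2pi_def by (intro tendsto_intros)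

lemma fourier_e2pi: "fourier f y = (\<integral>x. f x * e2pi (- (x * y)) \<partial>lborel)"
  by (simp add: fourier_def e2pi_exp mult_ac)

lemma continuous_on_real_restriction:
  assumes "F holomorphic_on UNIV"
  shows "continuous_on A (\<lambda>x::real. F (of_real x))"
  by (rule continuous_on_compose2[OF holomorphic_on_imp_continuous_on[OF assms]]) (auto intro!: continuous_intros)

lemma real_restriction_has_derivative:
  assumes "F holomorphic_on UNIV"
  shows "((\<lambda>y. F (of_real y)) has_vector_derivative deriv F (of_real x)) (at x)"
  by (rule has_vector_derivative_real_field) (rule holomorphic_derivI[OF assms open_UNIV UNIV_I])

lemma integrable_mult_bounded:
  fixes f h :: "'a \<Rightarrow> complex"
  assumes "integrable M f" "h \<in> borel_measurable M" "\<And>x. norm (h x) \<le> B"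
  shows "integrable M (\<lambda>x. f x * h x)"
proof (rule Bochner_Integration.integrable_bound)
  show "integrable M (\<lambda>x. B * norm (f x))" using assms(1) by simp
  show "(\<lambda>x. f x * h x) \<in> borel_measurable M" using assms(1,2) by measurable
  have "0 \<le> B" using assms(3)[of undefined] norm_ge_zero order_trans by blast
  then show "AE x in M. norm (f x * h x) \<le> norm (B * norm (f x))"
    by (intro AE_I2) (simp add: norm_mult mult.commute[of B] mult_left_mono assms(3))
qed

lemma integrable_mult_e2pi:
  assumes "integrable lborel f"
  shows "integrable lborel (\<lambda>x. f x * e2pi (c * x + d))"
  by (rule integrable_mult_bounded[OF assms, where B=1]) auto

lemma norm_fourier_le: "norm (fourier f t) \<le> (\<integral>x. norm (f x) \<partial>lborel)"
  unfolding fourier_e2pi by (rule order_trans[OF integral_norm_bound]) (simp add: norm_mult)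

lemma continuous_on_fourier:
  assumes "integrable lborel f"
  shows "continuous_on A (fourier f)"
proof -
  have "isCont (fourier f) t" for t
  proof (unfold continuous_at_sequentially, intro allI impI)
    fix u assume u: "u \<longlonglongrightarrow> t"
    show "(fourier f \<circ> u) \<longlonglongrightarrow> fourier f t"
      unfolding fourier_e2pi o_def
      by (rule integral_dominated_convergence[where w="\<lambda>x. norm (f x)"])
         (use assms u in \<open>auto intro!: tendsto_intros simp: norm_mult\<close>)
  qed
  then show ?thesis by (simp add: continuous_at_imp_continuous_on)
qed

lemma measurable_fourier [measurable]: "integrable lborel f \<Longrightarrow> fourier f \<in> borel_measurable borel"
  by (intro borel_measurable_continuous_onI continuous_on_fourier)

text \<open>
The multiplication formula \<open>\<integral> f\<^sup>\<and> h = \<integral> f h\<^sup>\<and>\<close>, by Fubini. It is the only exchange of integrals that the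
inversion theorem needs.
\<close>
lemma fourier_swap:
  assumes f: "integrable lborel f" and h: "integrable lborel h"
  shows "(\<integral>t. fourier f t * h t \<partial>lborel) = (\<integral>x. f x * fourier h x \<partial>lborel)"
proof -
  have [measurable]: "f \<in> borel_measurable borel" "h \<in> borel_measurable borel"
    using f h by auto
  have int: "integrable (lborel \<Otimes>\<^sub>M lborel) (\<lambda>(x,t). f x * e2pi (- (x * t)) * h t)"
  proof (rule integrableI_bounded)
    have "(\<integral>\<^sup>+ z. ennreal (norm (case z of (x,t) \<Rightarrow> f x * e2pi (- (x * t)) * h t)) \<partial>(lborel \<Otimes>\<^sub>M lborel))
        = (\<integral>\<^sup>+ x. \<integral>\<^sup>+ t. ennreal (norm (f x)) * ennreal (norm (h t)) \<partial>lborel \<partial>lborel)"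
      by (subst lborel.nn_integral_fst[symmetric])
         (simp_all add: norm_mult ennreal_mult)
    also have "\<dots> = (\<integral>\<^sup>+ x. norm (f x) \<partial>lborel) * (\<integral>\<^sup>+ t. norm (h t) \<partial>lborel)"
      by (simp add: nn_integral_cmult nn_integral_multc)
    also have "\<dots> < \<infinity>"
      using f h by (simp add: integrable_iff_bounded ennreal_mult_less_top)
    finally show "(\<integral>\<^sup>+ z. ennreal (norm (case z of (x,t) \<Rightarrow> f x * e2pi (- (x * t)) * h t)) \<partial>(lborel \<Otimes>\<^sub>M lborel)) < \<infinity>" .
  qed simp
  have "(\<integral>t. fourier f t * h t \<partial>lborel) = (\<integral>t. \<integral>x. f x * e2pi (- (x * t)) * h t \<partial>lborel \<partial>lborel)"
    unfolding fourier_e2pi by simp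
  also have "\<dots> = (\<integral>x. \<integral>t. f x * e2pi (- (x * t)) * h t \<partial>lborel \<partial>lborel)"
    by (rule lborel_pair.Fubini_integral[OF int])
  also have "\<dots> = (\<integral>x. f x * fourier h x \<partial>lborel)"
    unfolding fourier_e2pi 
    by (simp add: mult.assoc mult_ac)
  finally show ?thesis .
qed

definition gauss :: "real \<Rightarrow> real" where "gauss t = exp (- (t\<^sup>2) / 2)"

lemma gauss_integrable: "integrable lborel gauss"
proof -
  have "integrable lborel (\<lambda>x. sqrt (2 * pi) * std_normal_density x)"
    by (intro integrable_mult_right integrable_normal_density) auto
  also have "(\<lambda>x. sqrt (2 * pi) * std_normal_density x) = gauss"
    by (auto simp: std_normal_density_def gauss_def)
  finally show ?thesis .
qed

lemma fourier_gauss: "fourier (\<lambda>x. of_real (gauss x)) t = of_real (sqrt (2*pi) * gauss (2 * pi * t))"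
proof -
  have "char std_normal_distribution (- 2 * pi * t) = (\<integral>x. std_normal_density x *\<^sub>R e2pi (- (x * t)) \<partial>lborel)"
    unfolding char_def by (subst integral_density) (auto simp: e2pi_exp mult_ac)
  then have "(\<integral>x. std_normal_density x *\<^sub>R e2pi (- (x * t)) \<partial>lborel) = of_real (gauss (2 * pi * t))"
    by (simp add: char_std_normal_distribution gauss_def)
  moreover have "fourier (\<lambda>x. of_real (gauss x)) t = sqrt (2 * pi) * (\<integral>x. std_normal_density x *\<^sub>R e2pi (- (x * t)) \<partial>lborel)"
    unfolding fourier_e2pi by (subst integral_mult_right_zero[symmetric]) 
      (auto simp: std_normal_density_def gauss_def scaleR_conv_of_real)
  ultimately show ?thesis by simp
qed

section \<open>Fourier inversion\<close>

text \<open>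
On a bounded window the positive and negative parts of \<open>h\<close> are densities of finite measures that agree
on all rays, hence of equal measures.
\<close>
lemma AE_zero_if_interval_integrals_zero:
  fixes h :: "real \<Rightarrow> real"
  assumes int: "\<And>a b. set_integrable lborel {a..b} h"
    and zero: "\<And>a b. a < b \<Longrightarrow> (LINT x:{a..b}|lborel. h x) = 0"
  shows "AE x in lborel. h x = 0"
proof -
  have *: "AE x in lborel. x \<in> {- real R..real R} \<longrightarrow> h x = 0" for R :: nat
  proof -
    define k where "k = (\<lambda>x. indicator {- real R..real R} x *\<^sub>R h x)"
    define p where "p = (\<lambda>x. max 0 (k x))"
    define n where "n = (\<lambda>x. max 0 (- k x))"
    have ik: "integrable lborel k" using int[of "- real R" "real R"] by (simp add: k_def set_integrable_def)
    have ip: "integrable lborel p" and "in": "integrable lborel n"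
      using ik by (auto simp: p_def n_def intro!: integrable_max)
    have [measurable]: "p \<in> borel_measurable borel" "n \<in> borel_measurable borel" using ip "in" by auto
    have em: "emeasure (density lborel (\<lambda>x. ennreal (q x))) {x<..} = ennreal (\<integral>y. indicator {x<..} y *\<^sub>R q y \<partial>lborel)"
      if q: "integrable lborel q" "\<And>x. 0 \<le> q x" for q :: "real \<Rightarrow> real" and x
    proof -
      have [measurable]: "q \<in> borel_measurable borel" using q by auto
      have "emeasure (density lborel (\<lambda>x. ennreal (q x))) {x<..} = (\<integral>\<^sup>+y. ennreal (indicator {x<..} y *\<^sub>R q y) \<partial>lborel)"
        by (subst emeasure_density) (auto intro!: nn_integral_cong split: split_indicator)
      also have "\<dots> = ennreal (\<integral>y. indicator {x<..} y *\<^sub>R q y \<partial>lborel)"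
        by (rule nn_integral_eq_integral) (use q integrable_mult_indicator[of "{x<..}" lborel q] in auto)
      finally show ?thesis .
    qed
    have "(\<integral>y. indicator {x<..} y *\<^sub>R p y \<partial>lborel) = (\<integral>y. indicator {x<..} y *\<^sub>R n y \<partial>lborel)" for x
    proof -
      have i1: "integrable lborel (\<lambda>y. indicator {x<..} y *\<^sub>R p y)"
        and i2: "integrable lborel (\<lambda>y. indicator {x<..} y *\<^sub>R n y)"
        by (intro integrable_mult_indicator ip "in"; simp)+
      have "(\<integral>y. indicator {x<..} y *\<^sub>R p y \<partial>lborel) - (\<integral>y. indicator {x<..} y *\<^sub>R n y \<partial>lborel)
          = (\<integral>y. indicator {x<..} y *\<^sub>R p y - indicator {x<..} y *\<^sub>R n y \<partial>lborel)"
        by (rule Bochner_Integration.integral_diff[OF i1 i2, symmetric])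
      also have "\<dots> = (\<integral>y. indicator {x<..} y *\<^sub>R k y \<partial>lborel)"
        by (intro Bochner_Integration.integral_cong) (auto simp: p_def n_def max_def split: split_indicator)
      also have "\<dots> = (LINT y:{max x (- real R)..real R}|lborel. h y)"
        unfolding set_lebesgue_integral_def
        by (rule integral_cong_AE)
           (use ik int[of "max x (- real R)" "real R"] in \<open>auto simp: set_integrable_def k_def split: split_indicator
             intro: AE_mp[OF AE_lborel_singleton[of x]]\<close>)
      also have "\<dots> = 0"
      proof (cases "max x (- real R) < real R")
        case True then show ?thesis by (rule zero)
      next
        case False
        have "AE y in lborel. y \<noteq> real R" by (rule AE_lborel_singleton)
        then show ?thesis unfolding set_lebesgue_integral_def
          by (intro integral_eq_zero_AE) (use False in \<open>auto split: split_indicator elim!: eventually_mono\<close>)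
      qed
      finally show ?thesis by simp
    qed
    then have "density lborel (\<lambda>x. ennreal (p x)) = density lborel (\<lambda>x. ennreal (n x))"
      using em[OF ip] em[OF "in"] by (intro measure_eqI_lessThan) (simp_all add: p_def n_def)
    then have "AE x in lborel. ennreal (p x) = ennreal (n x)"
      by (intro sigma_finite_measure.density_unique[OF sigma_finite_lborel]) auto
    then show ?thesis
      by eventually_elim (auto simp: p_def n_def k_def max_def split: if_splits)
  qed
  then have "AE x in lborel. \<forall>R. x \<in> {- real R..real R} \<longrightarrow> h x = 0"
    using * by (intro AE_all_countable[THEN iffD2] allI)
  then show ?thesis
  proof eventually_elim
    case (elim x)
    obtain R :: nat where "\<bar>x\<bar> \<le> real R" using real_arch_simple by blast
    then show ?case using elim by (auto simp: abs_le_iff)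
  qed
qed

lemma fourier_gauss_scaled:
  assumes "0 < \<epsilon>"
  shows "fourier (\<lambda>t. of_real (gauss (\<epsilon> * t)) * e2pi (- (t * y))) x
     = of_real (sqrt (2*pi) / \<epsilon> * gauss (2 * pi * (x + y) / \<epsilon>))"
proof -
  have "fourier (\<lambda>t. of_real (gauss (\<epsilon> * t)) * e2pi (- (t * y))) x
      = (\<integral>t. of_real (gauss (\<epsilon> * t)) * e2pi (- (t * (x + y))) \<partial>lborel)"
    unfolding fourier_e2pi
    by (intro Bochner_Integration.integral_cong refl, unfold mult.assoc e2pi_add[symmetric])
       (auto intro!: arg_cong[where f=e2pi] simp: algebra_simps)
  also have "\<dots> = (1/\<epsilon>) *\<^sub>R (\<integral>t. of_real (gauss t) * e2pi (- (t * ((x + y)/\<epsilon>))) \<partial>lborel)"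
    by (subst lborel_integral_real_affine[where c="1/\<epsilon>" and t=0]) (use assms in auto)
  also have "\<dots> = (1/\<epsilon>) *\<^sub>R fourier (\<lambda>x. of_real (gauss x)) ((x+y)/\<epsilon>)" by (simp add: fourier_e2pi)
  finally show ?thesis by (simp add: fourier_gauss scaleR_conv_of_real)
qed

text \<open>
The integral is the probability that \<open>y + \<epsilon>Z/2\<pi>\<close> lies in \<open>[a, b]\<close> for a standard normal variable \<open>Z\<close>.
\<close>
lemma gauss_average_limit:
  fixes a b y :: real
  defines "A \<equiv> (\<lambda>\<epsilon>. (\<integral>x. indicator {a..b} x * (sqrt (2*pi) / \<epsilon> * gauss (2 * pi * (y - x) / \<epsilon>)) \<partial>lborel))"
  shows "0 < \<epsilon> \<Longrightarrow> \<bar>A \<epsilon>\<bar> \<le> 1"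
    and "y \<noteq> a \<Longrightarrow> y \<noteq> b \<Longrightarrow> (\<lambda>n. A (1 / Suc n)) \<longlonglongrightarrow> indicator {a..b} y"
proof -
  have A: "A \<epsilon> = (\<integral>z. indicator {a..b} (y - \<epsilon> / (2*pi) * z) * std_normal_density z \<partial>lborel)" if "0 < \<epsilon>" for \<epsilon>
    unfolding A_def
    by (subst lborel_integral_real_affine[where c="- \<epsilon> / (2 * pi)" and t=y])
       (use that in \<open>auto simp: std_normal_density_def gauss_def integral_mult_right_zero[symmetric] field_simps real_sqrt_mult
          simp del: integral_mult_right_zero integral_divide_zero intro!: Bochner_Integration.integral_cong\<close>)
  have i: "integrable lborel std_normal_density" by (intro integrable_normal_density) simp
  show "\<bar>A \<epsilon>\<bar> \<le> 1" if "0 < \<epsilon>"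
  proof -
    have "norm (A \<epsilon>) \<le> (\<integral>z. std_normal_density z \<partial>lborel)"
      unfolding A[OF that]
      by (rule Bochner_Integration.integral_norm_bound_integral)
         (use i in \<open>auto intro!: integrable_real_mult_indicator Bochner_Integration.integrable_bound[OF i] split: split_indicator\<close>)
    then show ?thesis by simp
  qed
  show "(\<lambda>n. A (1 / Suc n)) \<longlonglongrightarrow> indicator {a..b} y" if "y \<noteq> a" "y \<noteq> b"
  proof -
    have "(\<lambda>n. (\<integral>z. indicator {a..b} (y - (1 / Suc n) / (2*pi) * z) * std_normal_density z \<partial>lborel))
       \<longlonglongrightarrow> (\<integral>z. indicator {a..b} y * std_normal_density z \<partial>lborel)"
    proof (rule integral_dominated_convergence[where w="std_normal_density"])
      show "AE z in lborel. (\<lambda>n. indicator {a..b} (y - 1 / real (Suc n) / (2*pi) * z) * std_normal_density z)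
         \<longlonglongrightarrow> indicat_real {a..b} y * std_normal_density z"
      proof (intro AE_I2 tendsto_mult_right)
        fix z
        have lim: "(\<lambda>n. y - 1 / real (Suc n) / (2*pi) * z) \<longlonglongrightarrow> y - 0 / (2*pi) * z"
          by (intro tendsto_intros LIMSEQ_Suc[OF lim_1_over_n]) auto
        have "\<forall>\<^sub>F w in nhds y. indicat_real {a..b} w = indicat_real {a..b} y"
        proof (cases "a < y \<and> y < b")
          case True
          then have "\<forall>\<^sub>F w in nhds y. w \<in> {a<..<b}" by (intro eventually_nhds_in_open) auto
          then show ?thesis by eventually_elim (use True in auto)
        next
          case False
          then have "\<forall>\<^sub>F w in nhds y. w \<in> - {a..b}" using that by (intro eventually_nhds_in_open) auto
          then show ?thesis by eventually_elim (use False that in auto)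
        qed
        then have "\<forall>\<^sub>F n in sequentially. indicat_real {a..b} (y - 1 / real (Suc n) / (2*pi) * z) = indicat_real {a..b} y"
          by (rule eventually_compose_filterlim) (use lim in simp)
        then show "(\<lambda>n. indicat_real {a..b} (y - 1 / real (Suc n) / (2*pi) * z)) \<longlonglongrightarrow> indicat_real {a..b} y"
          by (rule tendsto_eventually)
      qed
    qed (use i in \<open>auto split: split_indicator\<close>)
    then show ?thesis by (simp add: A)
  qed
qed

text \<open>
Both sides are tested against the indicator of an interval. Inserting a Gaussian factor and moving
transforms across with \<open>fourier_swap\<close> gives on one side the integral of the inverse transform, and on
the other the integral of \<open>f\<close> against Gaussian averages of the indicator.
\<close>
theorem fourier_inversion:
  assumes f: "integrable lborel f" and F: "integrable lborel (fourier f)"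
  shows "AE x in lborel. f x = fourier (fourier f) (- x)"
proof -
  define V where "V = (\<lambda>x. fourier (fourier f) (- x))"
  have contV: "continuous_on UNIV V"
    unfolding V_def by (rule continuous_on_compose2[OF continuous_on_fourier[OF F]]) (auto intro!: continuous_intros)
  have [measurable]: "f \<in> borel_measurable borel" "fourier f \<in> borel_measurable borel" using f F by auto
  have intV: "set_integrable lborel {a..b} V" for a b
    unfolding set_integrable_def by (rule borel_integrable_compact) (auto intro: continuous_on_subset[OF contV])
  have intf: "set_integrable lborel {a..b} f" for a b
    unfolding set_integrable_def using f by (intro integrable_mult_indicator) auto
  have eq: "(LINT x:{a..b}|lborel. V x) = (LINT x:{a..b}|lborel. f x)" for a b
  proof -
    \<comment> \<open>The reflection turns the inverse transform on the left into a forward one.\<close>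
    define J where "J = (\<lambda>x. complex_of_real (indicator {a..b} (- x)))"
    have "integrable lborel (\<lambda>x. complex_of_real (indicator {- b..- a} x))"
      using emeasure_compact_finite[of "{-b..-a}"] by (intro integrable_of_real integrable_real_indicator) auto
    also have "(\<lambda>x. complex_of_real (indicator {- b..- a} x)) = J"
      by (auto simp: J_def split: split_indicator)
    finally have iJ: "integrable lborel J" .
    have g\<epsilon>: "integrable lborel (\<lambda>t. complex_of_real (gauss (\<epsilon> * t)))" if "0 < \<epsilon>" for \<epsilon>
      using lborel_integrable_real_affine[OF gauss_integrable, of \<epsilon> 0] that by (intro integrable_of_real) auto
    have [measurable]: "J \<in> borel_measurable borel" "gauss \<in> borel_measurable borel"
      using iJ gauss_integrable by auto
    have [measurable]: "fourier J \<in> borel_measurable borel" using iJ by simp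
    have "(LINT x:{a..b}|lborel. V x) = (\<integral>x. fourier (fourier f) x * J x \<partial>lborel)"
      unfolding set_lebesgue_integral_def V_def
      by (subst lborel_integral_real_affine[where c="-1" and t=0])
         (auto simp: J_def scaleR_conv_of_real mult.commute)
    also have "\<dots> = (\<integral>t. fourier f t * fourier J t \<partial>lborel)" by (rule fourier_swap[OF F iJ])
    finally have 1: "(LINT x:{a..b}|lborel. V x) = (\<integral>t. fourier f t * fourier J t \<partial>lborel)" .
    have lim1: "(\<lambda>n. \<integral>t. fourier f t * (fourier J t * of_real (gauss (1 / Suc n * t))) \<partial>lborel)
        \<longlonglongrightarrow> (\<integral>t. fourier f t * (fourier J t * of_real (gauss (0 * t))) \<partial>lborel)"
    proof (rule integral_dominated_convergence[where w="\<lambda>t. norm (fourier f t) * (\<integral>x. norm (J x) \<partial>lborel)"])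
      show "AE t in lborel. (\<lambda>n. fourier f t * (fourier J t * of_real (gauss (1 / real (Suc n) * t))))
          \<longlonglongrightarrow> fourier f t * (fourier J t * of_real (gauss (0 * t)))"
        unfolding gauss_def by (intro AE_I2 tendsto_intros LIMSEQ_Suc[OF lim_1_over_n]) auto
      show "AE t in lborel. norm (fourier f t * (fourier J t * of_real (gauss (1 / real (Suc n) * t))))
         \<le> norm (fourier f t) * (\<integral>x. norm (J x) \<partial>lborel)" for n
      proof (intro AE_I2)
        fix t
        have "norm (fourier J t) * \<bar>gauss (1 / real (Suc n) * t)\<bar> \<le> (\<integral>x. norm (J x) \<partial>lborel) * 1"
          by (intro mult_mono norm_fourier_le) (auto simp: gauss_def)
        then show "norm (fourier f t * (fourier J t * of_real (gauss (1 / real (Suc n) * t))))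
         \<le> norm (fourier f t) * (\<integral>x. norm (J x) \<partial>lborel)"
          by (simp add: norm_mult mult_left_mono)
      qed
    qed (use F in auto)
    define A where "A = (\<lambda>\<epsilon> y. (\<integral>x. indicator {a..b} x * (sqrt (2*pi) / \<epsilon> * gauss (2 * pi * (y - x) / \<epsilon>)) \<partial>lborel))"
    have 2: "(\<integral>t. fourier f t * (fourier J t * of_real (gauss (\<epsilon> * t))) \<partial>lborel)
        = (\<integral>y. f y * of_real (A \<epsilon> y) \<partial>lborel)" if "0 < \<epsilon>" for \<epsilon>
    proof -
      have i2: "integrable lborel (\<lambda>t. fourier J t * of_real (gauss (\<epsilon> * t)))"
        using integrable_mult_bounded[OF g\<epsilon>[OF that], of "fourier J" "\<integral>x. norm (J x) \<partial>lborel"]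
        by (simp add: mult.commute norm_fourier_le)
      have "fourier (\<lambda>t. fourier J t * of_real (gauss (\<epsilon> * t))) y = of_real (A \<epsilon> y)" for y
      proof -
        have "fourier (\<lambda>t. fourier J t * of_real (gauss (\<epsilon> * t))) y
            = (\<integral>t. fourier J t * (of_real (gauss (\<epsilon> * t)) * e2pi (- (t * y))) \<partial>lborel)"
          by (simp add: fourier_e2pi mult.assoc)
        also have "\<dots> = (\<integral>x. J x * of_real (sqrt (2*pi) / \<epsilon> * gauss (2 * pi * (x + y) / \<epsilon>)) \<partial>lborel)"
        proof (subst fourier_swap[OF iJ])
          show "integrable lborel (\<lambda>t. complex_of_real (gauss (\<epsilon> * t)) * e2pi (- (t * y)))"
            using integrable_mult_e2pi[OF g\<epsilon>[OF that], of "-y" 0] by (simp add: mult.commute)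
        qed (simp only: fourier_gauss_scaled[OF that])
        also have "\<dots> = of_real (\<integral>x. indicator {a..b} (- x) * (sqrt (2*pi) / \<epsilon> * gauss (2 * pi * (x + y) / \<epsilon>)) \<partial>lborel)"
          by (subst integral_complex_of_real[symmetric]) (simp add: J_def)
        also have "(\<integral>x. indicator {a..b} (- x) * (sqrt (2*pi) / \<epsilon> * gauss (2 * pi * (x + y) / \<epsilon>)) \<partial>lborel) = A \<epsilon> y"
          unfolding A_def by (subst lborel_integral_real_affine[where c="-1" and t=0]) auto
        finally show ?thesis .
      qed
      then show ?thesis by (subst fourier_swap[OF f i2]) simp
    qed
    have lim2: "(\<lambda>n. \<integral>y. f y * of_real (A (1 / Suc n) y) \<partial>lborel) \<longlonglongrightarrow> (\<integral>y. f y * of_real (indicator {a..b} y) \<partial>lborel)"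
    proof (rule integral_dominated_convergence[where w="\<lambda>y. norm (f y)"])
      have [measurable]: "(\<lambda>y. A \<epsilon> y) \<in> borel_measurable borel" for \<epsilon> unfolding A_def by measurable
      show "(\<lambda>y. f y * of_real (A (1 / Suc n) y)) \<in> borel_measurable lborel" for n by measurable
      have "AE y in lborel. y \<noteq> a" "AE y in lborel. y \<noteq> b" by (simp_all add: AE_lborel_singleton)
      then show "AE y in lborel. (\<lambda>n. f y * of_real (A (1 / Suc n) y)) \<longlonglongrightarrow> f y * of_real (indicator {a..b} y)"
        unfolding A_def by eventually_elim (intro tendsto_intros gauss_average_limit(2))
      show "AE y in lborel. norm (f y * of_real (A (1 / Suc n) y)) \<le> norm (f y)" for n
        using gauss_average_limit(1)[of "1 / Suc n" a b] unfolding A_def norm_mult norm_of_real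
        by (intro AE_I2 mult_left_le) auto
    qed (use f in auto)
    have "(LINT x:{a..b}|lborel. V x) = (\<integral>y. f y * of_real (indicator {a..b} y) \<partial>lborel)"
    proof -
      have pos: "0 < 1 / real (Suc n)" for n by simp
      show ?thesis
        using LIMSEQ_unique[OF lim1[unfolded 2[OF pos]] lim2] by (simp add: 1 gauss_def)
    qed
    then show ?thesis by (simp add: set_lebesgue_integral_def scaleR_conv_of_real mult.commute)
  qed
  have d: "set_integrable lborel {a..b} (\<lambda>x. f x - V x)" for a b by (rule set_integral_diff(1)[OF intf intV])
  have z: "(LINT x:{a..b}|lborel. f x - V x) = 0" for a b by (simp add: set_integral_diff(2)[OF intf intV] eq)
  have "AE x in lborel. Re (f x - V x) = 0"
  proof (rule AE_zero_if_interval_integrals_zero)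
    show "set_integrable lborel {a..b} (\<lambda>x. Re (f x - V x))" for a b
      using integrable_Re[OF d[unfolded set_integrable_def]] by (simp add: set_integrable_def)
    show "(LINT x:{a..b}|lborel. Re (f x - V x)) = 0" for a b
      using integral_Re[OF d[unfolded set_integrable_def], of a b] z[of a b] by (simp add: set_lebesgue_integral_def)
  qed
  moreover have "AE x in lborel. Im (f x - V x) = 0"
  proof (rule AE_zero_if_interval_integrals_zero)
    show "set_integrable lborel {a..b} (\<lambda>x. Im (f x - V x))" for a b
      using integrable_Im[OF d[unfolded set_integrable_def]] by (simp add: set_integrable_def)
    show "(LINT x:{a..b}|lborel. Im (f x - V x)) = 0" for a b
      using integral_Im[OF d[unfolded set_integrable_def], of a b] z[of a b] by (simp add: set_lebesgue_integral_def)
  qed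
  ultimately show ?thesis unfolding V_def by eventually_elim (simp add: complex_eq_iff)
qed

section \<open>Spectrum of integrable functions of exponential type\<close>

text \<open>
By Cauchy's estimate a bound on \<open>h x\<close> near \<open>w\<^sub>0\<close> bounds its difference quotients too, so dominated
convergence applies to them.
\<close>
lemma holomorphic_on_parameter_integral:
  fixes h :: "'a \<Rightarrow> complex \<Rightarrow> complex"
  assumes S: "open S"
    and hol: "\<And>x. x \<in> space M \<Longrightarrow> h x holomorphic_on S"
    and meas: "\<And>w. w \<in> S \<Longrightarrow> (\<lambda>x. h x w) \<in> borel_measurable M"
    and int: "integrable M b"
    and bd: "\<And>x w. x \<in> space M \<Longrightarrow> w \<in> S \<Longrightarrow> norm (h x w) \<le> b x"
  shows "(\<lambda>w. \<integral>x. h x w \<partial>M) holomorphic_on S"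
proof (subst holomorphic_on_open[OF S], intro ballI)
  fix w0 assume w0: "w0 \<in> S"
  obtain r where r: "0 < r" "cball w0 r \<subseteq> S" using S w0 open_contains_cball by blast
  define q where "q = (\<lambda>x w. (h x w - h x w0) / (w - w0))"
  define D where "D = (\<lambda>x. deriv (h x) w0)"
  have q_lim: "((\<lambda>w. q x w) \<longlongrightarrow> D x) (at w0)" if "x \<in> space M" for x
    using holomorphic_derivI[OF hol[OF that] S w0] by (simp add: has_field_derivative_iff q_def D_def)
  have q_bd: "norm (q x w) \<le> 2 * b x / r" if x: "x \<in> space M" and w: "w \<in> ball w0 (r/2)" "w \<noteq> w0" for x w
  proof -
    have "norm (h x w - h x w0) \<le> 2 * b x / r * norm (w - w0)"
    proof (rule field_differentiable_bound[where S="ball w0 (r/2)" and f'="deriv (h x)"])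
      fix z assume z: "z \<in> ball w0 (r/2)"
      have sub: "cball z (r/2) \<subseteq> S"
      proof -
        have "cball z (r/2) \<subseteq> cball w0 r"
          using z by (intro cball_subset_cball_iff[THEN iffD2]) (auto simp: dist_commute)
        then show ?thesis using r by blast
      qed
      have zS: "z \<in> S" using sub r(1) by (metis centre_in_cball half_gt_zero less_eq_real_def subsetD)
      show "(h x has_field_derivative deriv (h x) z) (at z within ball w0 (r/2))"
        using holomorphic_derivI[OF hol[OF x] S zS] by (rule has_field_derivative_at_within)
      have "norm ((deriv ^^ 1) (h x) z) \<le> fact 1 * b x / (r/2) ^ 1"
      proof (rule Cauchy_inequality)
        show "h x holomorphic_on ball z (r/2)"
          by (rule holomorphic_on_subset[OF hol[OF x]]) (use sub ball_subset_cball in blast)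
        show "continuous_on (cball z (r/2)) (h x)"
          by (rule holomorphic_on_imp_continuous_on[OF holomorphic_on_subset[OF hol[OF x] sub]])
        show "norm (h x y) \<le> b x" if "norm (z - y) = r/2" for y
          using that sub by (intro bd x) (auto simp: dist_norm)
      qed (use r in auto)
      then show "norm (deriv (h x) z) \<le> 2 * b x / r" by (simp add: mult.commute)
    qed (use w r in auto)
    then show ?thesis using w by (simp add: q_def norm_divide divide_le_eq)
  qed
  have "((\<lambda>w. \<integral>x. q x w \<partial>M) \<longlongrightarrow> (\<integral>x. D x \<partial>M)) (at w0)"
    unfolding tendsto_at_iff_sequentially
  proof (intro allI impI)
    fix X assume X: "\<forall>i. X i \<in> UNIV - {w0}" "X \<longlonglongrightarrow> w0"
    have "\<forall>\<^sub>F n in sequentially. X n \<in> ball w0 (r/2)"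
      using X(2) r(1) by (intro topological_tendstoD[OF X(2)]) auto
    then obtain N where N: "\<And>n. n \<ge> N \<Longrightarrow> X n \<in> ball w0 (r/2)" by (auto simp: eventually_sequentially)
    have N': "X (n + N) \<in> ball w0 (r/2)" for n using N by simp
    have inS: "X (n + N) \<in> S" for n using N'[of n] r by (auto simp: subset_iff)
    have mq: "(\<lambda>x. q x (X (n + N))) \<in> borel_measurable M" for n
      unfolding q_def using meas[OF inS[of n]] meas[OF w0] by measurable
    have lim: "(\<lambda>n. q x (X (n + N))) \<longlonglongrightarrow> D x" if "x \<in> space M" for x
    proof (rule LIMSEQ_ignore_initial_segment)
      show "(\<lambda>n. q x (X n)) \<longlonglongrightarrow> D x"
        using q_lim[OF that] X by (simp add: tendsto_at_iff_sequentially o_def)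
    qed
    have "(\<lambda>n. \<integral>x. q x (X (n + N)) \<partial>M) \<longlonglongrightarrow> (\<integral>x. D x \<partial>M)"
    proof (rule integral_dominated_convergence[where w="\<lambda>x. 2 * b x / r"])
      show "D \<in> borel_measurable M"
        by (rule borel_measurable_LIMSEQ_metric[where f="\<lambda>n x. q x (X (n + N))"]) (use mq lim in auto)
    qed (use mq lim int q_bd N' X in auto)
    then show "((\<lambda>w. \<integral>x. q x w \<partial>M) \<circ> X) \<longlonglongrightarrow> (\<integral>x. D x \<partial>M)"
      unfolding o_def by (rule LIMSEQ_offset)
  qed
  moreover have "\<forall>\<^sub>F w in at w0. (\<integral>x. q x w \<partial>M) = ((\<integral>x. h x w \<partial>M) - (\<integral>x. h x w0 \<partial>M)) / (w - w0)"
  proof -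
    have "\<forall>\<^sub>F w in at w0. w \<in> S" using S w0 by (rule eventually_at_in_open')
    then show ?thesis
    proof eventually_elim
      case (elim w)
      have i: "integrable M (\<lambda>x. h x v)" if "v \<in> S" for v
      proof (rule Bochner_Integration.integrable_bound[OF int meas[OF that]], intro AE_I2)
        show "norm (h x v) \<le> norm (b x)" if "x \<in> space M" for x
          using bd[OF that \<open>v \<in> S\<close>] by simp
      qed
      show ?case
        unfolding q_def Bochner_Integration.integral_diff[OF i[OF elim] i[OF w0], symmetric]
        by (rule integral_divide_zero)
    qed
  qed
  ultimately have "((\<lambda>w. ((\<integral>x. h x w \<partial>M) - (\<integral>x. h x w0 \<partial>M)) / (w - w0)) \<longlongrightarrow> (\<integral>x. D x \<partial>M)) (at w0)"
    by (rule Lim_transform_eventually)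
  then show "\<exists>f'. ((\<lambda>w. \<integral>x. h x w \<partial>M) has_field_derivative f') (at w0)"
    by (auto simp: has_field_derivative_iff)
qed

lemma power_exp_half_line:
  assumes "0 < a"
  shows "integrable lborel (\<lambda>x::real. indicator {0..} x * (x ^ n * exp (- a * x)))"
    and "(\<integral>x. indicator {0..} x * ((x::real) ^ n * exp (- a * x)) \<partial>lborel) = fact n / a ^ Suc n"
proof -
  have "has_bochner_integral lborel (\<lambda>x. indicator {0..} x *\<^sub>R (exp (-x) * x ^ n)) (fact n :: real)"
    using has_bochner_integral_I0i_power_exp_m'[of n] by (simp add: mult_ac)
  then have 1: "has_bochner_integral lborel (\<lambda>x. indicator {0..} (0 + a * x) *\<^sub>R (exp (-(0 + a*x)) * (0 + a*x) ^ n)) (fact n /\<^sub>R \<bar>a\<bar>)"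
    using assms by (intro lborel_has_bochner_integral_real_affine_iff[THEN iffD1]) auto
  have 2: "(\<lambda>x. (1 / a ^ n) * (indicator {0..} (0 + a * x) *\<^sub>R (exp (-(0 + a*x)) * (0 + a*x) ^ n)))
      = (\<lambda>x::real. indicator {0..} x * (x ^ n * exp (- a * x)))"
    using assms by (auto simp: fun_eq_iff power_mult_distrib zero_le_mult_iff split: split_indicator)
  have "has_bochner_integral lborel (\<lambda>x::real. indicator {0..} x * (x ^ n * exp (- a * x))) ((1 / a ^ n) * (fact n /\<^sub>R \<bar>a\<bar>))"
    unfolding 2[symmetric] by (intro has_bochner_integral_mult_right 1)
  then show "integrable lborel (\<lambda>x::real. indicator {0..} x * (x ^ n * exp (- a * x)))"
    and "(\<integral>x. indicator {0..} x * ((x::real) ^ n * exp (- a * x)) \<partial>lborel) = fact n / a ^ Suc n"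
    using assms by (auto simp: has_bochner_integral_iff field_simps)
qed

text \<open>
Cauchy's estimate on the circle of radius \<open>q x\<close> with \<open>q > 1\<close>, that is, on a radius adapted to the
argument: the price is a slightly larger exponential, the gain is the geometric factor \<open>\<rho>\<^sup>n\<close>, which
makes the Taylor series integrable term by term against \<open>exp (- a x)\<close>.
\<close>
lemma exponential_type_coeff_bound:
  assumes F: "F holomorphic_on UNIV" "exponential_type \<tau> F" and a: "\<tau> < a" and \<tau>: "0 \<le> \<tau>"
  obtains C \<rho> b where "0 \<le> C" "0 < \<rho>" "\<rho> < 1" "b < a"
    "\<And>n x. 0 \<le> x \<Longrightarrow> norm ((deriv ^^ n) F 0) / fact n * x ^ n \<le> C * \<rho> ^ n * exp (b * x)"
proof -
  define \<sigma> where "\<sigma> = (\<tau> + a) / 2"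
  have \<sigma>: "\<tau> < \<sigma>" "\<sigma> < a" "0 < \<sigma>" using a \<tau> by (auto simp: \<sigma>_def)
  \<comment> \<open>Any number strictly between \<open>1\<close> and \<open>a / \<sigma>\<close> would do.\<close>
  define q where "q = (1 + a / \<sigma>) / 2"
  have q: "1 < q" "\<sigma> * q < a" using \<sigma> by (auto simp: q_def field_simps)
  obtain C where C: "0 < C" "\<And>z. norm (F z) \<le> C * exp (\<sigma> * norm z)"
    using F(2) \<sigma>(1) unfolding exponential_type_def by (metis add_diff_cancel_left' diff_gt_0_iff_gt add.commute diff_add_cancel)
  show ?thesis
  proof (rule that[of C "1/q" "\<sigma> * q"])
    fix n and x :: real assume x: "0 \<le> x"
    show "norm ((deriv ^^ n) F 0) / fact n * x ^ n \<le> C * (1/q) ^ n * exp (\<sigma> * q * x)"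
    proof (cases "x = 0")
      case True
      show ?thesis
      proof (cases n)
        case 0 then show ?thesis using C(2)[of 0] True by simp
      next
        case (Suc m) then show ?thesis using True C(1) q by simp
      qed
    next
      case False
      then have x: "0 < x" using x by simp
      have "norm ((deriv ^^ n) F 0) \<le> fact n * (C * exp (\<sigma> * (q * x))) / (q * x) ^ n"
      proof (rule Cauchy_inequality)
        show "norm (F y) \<le> C * exp (\<sigma> * (q * x))" if "norm (0 - y) = q * x" for y
          using C(2)[of y] that by simp
        show "F holomorphic_on ball 0 (q * x)" using F(1) by (rule holomorphic_on_subset) simp
        show "continuous_on (cball 0 (q * x)) F"
          using F(1) holomorphic_on_subset by (intro holomorphic_on_imp_continuous_on) blast
      qed (use q x in auto)
      then show ?thesis using x q by (simp add: field_simps power_mult_distrib)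
    qed
  qed (use C q in auto)
qed

text \<open>
The Borel (Laplace) transform of the Taylor series of \<open>F\<close> at the origin, which converges for \<open>\<bar>w\<bar> > \<tau>\<close>
when \<open>F\<close> has exponential type \<open>\<tau>\<close>.
\<close>
definition borel_transform :: "(complex \<Rightarrow> complex) \<Rightarrow> complex \<Rightarrow> complex" where
  "borel_transform F w = (\<Sum>n. (deriv ^^ n) F 0 / w ^ Suc n)"

abbreviation half_line_transform :: "(complex \<Rightarrow> complex) \<Rightarrow> complex \<Rightarrow> complex" where
  "half_line_transform F w \<equiv> \<integral>x. indicator {0..} x *\<^sub>R (F (of_real x) * exp (- w * of_real x)) \<partial>lborel"

text \<open>
Term by term integration of the Taylor series against \<open>exp (- a x)\<close>. The geometric bound of
\<open>exponential_type_coeff_bound\<close> makes the integrals of the absolute values summable, which also gives the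
convergence of the Borel transform.
\<close>
lemma borel_transform_real:
  assumes F: "F holomorphic_on UNIV" "exponential_type \<tau> F" and a: "\<tau> < a" and \<tau>: "0 \<le> \<tau>"
  shows "summable (\<lambda>n. norm ((deriv ^^ n) F 0) / a ^ Suc n)"
    and "half_line_transform F (of_real a) = borel_transform F (of_real a)"
proof -
  obtain C \<rho> b where C: "0 \<le> C" "0 < \<rho>" "\<rho> < 1" "b < a"
    and bd: "\<And>n x. 0 \<le> x \<Longrightarrow> norm ((deriv ^^ n) F 0) / fact n * x ^ n \<le> C * \<rho> ^ n * exp (b * x)"
    using exponential_type_coeff_bound[OF F a \<tau>] by metis
  have a0: "0 < a" using a \<tau> by simp
  define c where "c = (\<lambda>n. (deriv ^^ n) F 0 / fact n)"
  define t where "t = (\<lambda>n (x::real). indicator {0..} x *\<^sub>R (c n * of_real x ^ n * of_real (exp (- a * x))))"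
  have t: "has_bochner_integral lborel (t n) ((deriv ^^ n) F 0 / of_real a ^ Suc n)" for n
  proof -
    have "has_bochner_integral lborel (\<lambda>x. c n * complex_of_real (indicator {0..} x * (x ^ n * exp (- a * x))))
       (c n * complex_of_real (fact n / a ^ Suc n))"
      using power_exp_half_line[OF a0, of n]
      by (intro has_bochner_integral_mult_right has_bochner_integral_of_real) (auto simp: has_bochner_integral_iff)
    then show ?thesis by (simp add: t_def c_def scaleR_conv_of_real mult_ac)
  qed
  have nt: "norm (t n x) = norm (c n) * (indicator {0..} x * (x ^ n * exp (- a * x)))" for n x
    by (simp add: t_def norm_mult norm_power split: split_indicator)
  have int_nt: "(\<integral>x. norm (t n x) \<partial>lborel) = norm ((deriv ^^ n) F 0) / a ^ Suc n" for n
    unfolding nt using power_exp_half_line(2)[OF a0, of n] by (simp add: c_def norm_divide)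
  have nt_bd: "norm (t n x) \<le> C * \<rho> ^ n * (indicator {0..} x * (x ^ 0 * exp (- (a - b) * x)))" for n x
  proof (cases "0 \<le> x")
    case True
    have "norm (t n x) = (norm ((deriv ^^ n) F 0) / fact n * x ^ n) * exp (- a * x)"
      using True by (simp add: nt c_def norm_divide)
    also have "\<dots> \<le> C * \<rho> ^ n * exp (b * x) * exp (- a * x)"
      by (intro mult_right_mono bd True) auto
    also have "\<dots> = C * \<rho> ^ n * exp (- (a - b) * x)"
      by (simp add: mult.assoc flip: exp_add) (simp add: algebra_simps)
    finally show ?thesis using True by simp
  qed (auto simp: t_def)
  have le: "(\<integral>x. norm (t n x) \<partial>lborel) \<le> C * \<rho> ^ n * (1 / (a - b))" for n
  proof -
    have "(\<integral>x. norm (t n x) \<partial>lborel) \<le> (\<integral>x. C * \<rho> ^ n * (indicator {0..} x * (x ^ 0 * exp (- (a - b) * x))) \<partial>lborel)"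
      using t[of n] power_exp_half_line(1)[of "a - b" 0] C nt_bd
      by (intro integral_mono) (auto simp: has_bochner_integral_iff)
    also have "\<dots> = C * \<rho> ^ n * (1 / (a - b))"
      using power_exp_half_line(2)[of "a - b" 0] C by simp
    finally show ?thesis .
  qed
  have sum: "summable (\<lambda>n. (\<integral>x. norm (t n x) \<partial>lborel))"
  proof (rule summable_comparison_test[OF _ summable_mult2[OF summable_mult[OF summable_geometric]]])
    show "\<exists>N. \<forall>n\<ge>N. norm (\<integral>x. norm (t n x) \<partial>lborel) \<le> C * \<rho> ^ n * (1 / (a - b))"
      using le by auto
  qed (use C in auto)
  then show "summable (\<lambda>n. norm ((deriv ^^ n) F 0) / a ^ Suc n)" by (simp add: int_nt)
  have AEsum: "AE x in lborel. summable (\<lambda>n. norm (t n x))"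
  proof (rule AE_I2)
    fix x
    show "summable (\<lambda>n. norm (t n x))"
      by (rule summable_comparison_test[OF _ summable_mult2[OF summable_mult[OF summable_geometric]]])
         (use nt_bd[of _ x] C in \<open>auto\<close>)
  qed
  have sums: "(\<lambda>n. t n x) sums (indicator {0..} x *\<^sub>R (F (of_real x) * exp (- of_real a * of_real x)))" for x
  proof -
    have "(\<lambda>n. (deriv ^^ n) F 0 / fact n * (of_real x - 0) ^ n) sums F (of_real x)"
      by (rule holomorphic_power_series[where r="\<bar>x\<bar> + 1"]) (use F(1) holomorphic_on_subset in auto)
    from sums_scaleR_right[OF sums_mult2[OF this, of "of_real (exp (- a * x))"], of "indicator {0..} x"]
    show ?thesis by (simp add: t_def c_def exp_of_real[symmetric])
  qed
  have "(\<integral>x. (\<Sum>n. t n x) \<partial>lborel) = (\<Sum>n. \<integral>x. t n x \<partial>lborel)"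
    by (rule integral_suminf) (use t AEsum sum in \<open>auto simp: has_bochner_integral_iff\<close>)
  then show "half_line_transform F (of_real a) = borel_transform F (of_real a)"
    using t sums by (simp add: has_bochner_integral_iff borel_transform_def sums_iff)
qed

lemma borel_transform_holomorphic:
  assumes F: "F holomorphic_on UNIV" "exponential_type \<tau> F" and \<tau>: "0 < \<tau>"
  shows "borel_transform F holomorphic_on {w. \<tau> < norm w}"
proof -
  define d where "d = (\<lambda>n. (deriv ^^ n) F 0)"
  define P where "P = (\<lambda>u. \<Sum>n. d n * u ^ n)"
  have "(\<lambda>n. d n * (u - 0) ^ n) sums P u" if u: "u \<in> ball 0 (1 / \<tau>)" for u
  proof (cases "u = 0")
    case True then show ?thesis
      unfolding P_def by (auto intro!: summable_sums summable_finite[of "{0}"])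
  next
    case False
    have "\<tau> < 1 / norm u" using u \<tau> False by (simp add: field_simps)
    from borel_transform_real(1)[OF F this] \<tau>
    have "summable (\<lambda>n. (1 / norm u) * (norm (d n) / (1 / norm u) ^ Suc n))"
      unfolding d_def by (intro summable_mult) auto
    then have "summable (\<lambda>n. norm (d n * u ^ n))"
      using False by (simp add: norm_mult norm_power power_one_over field_simps)
    then show ?thesis unfolding P_def using summable_sums summable_norm_cancel by force
  qed
  then have "P holomorphic_on ball 0 (1/\<tau>)" by (rule power_series_holomorphic)
  then have "(\<lambda>w. P (1 / w)) holomorphic_on {w. \<tau> < norm w}"
    by (intro holomorphic_on_compose_gen[where f="\<lambda>w. 1 / w" and g=P and t="ball 0 (1/\<tau>)", unfolded o_def])
       (use \<tau> in \<open>auto intro!: holomorphic_intros simp: norm_divide divide_simps\<close>)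
  then have "(\<lambda>w. (1 / w) * P (1 / w)) holomorphic_on {w. \<tau> < norm w}"
    using \<tau> by (auto intro!: holomorphic_intros)
  moreover have eq: "borel_transform F w = (1 / w) * P (1 / w)" if "w \<in> {w. \<tau> < norm w}" for w
  proof -
    have w0: "w \<noteq> 0" using that \<tau> by auto
    have "\<tau> < norm w" using that by simp
    from borel_transform_real(1)[OF F this] \<tau>
    have "summable (\<lambda>n. norm (d n / w ^ Suc n))" by (simp add: d_def norm_divide norm_power norm_mult)
    then have "summable (\<lambda>n. w * (d n / w ^ Suc n))" by (intro summable_mult) (rule summable_norm_cancel)
    then have s: "summable (\<lambda>n. d n * (1/w) ^ n)" using w0 by (simp add: power_one_over field_simps)
    show ?thesis
      unfolding borel_transform_def P_def suminf_mult[OF s, symmetric]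
      by (simp add: power_one_over field_simps d_def)
  qed
  ultimately show ?thesis by (subst holomorphic_cong[OF refl eq])
qed

text \<open>
The Laplace integral over the half-line is holomorphic in the right half-plane and continuous up to its
boundary because \<open>F\<close> is integrable, and it agrees with the Borel transform on the real ray beyond
\<open>\<tau>\<close>. The two are compared on a half-plane \<open>p Re w + q Im w > \<tau>\<close> intersected with \<open>Re w > 0\<close>. This set
is convex and stays outside the disc of radius \<open>\<tau>\<close>; it contains large positive reals as
\<open>p > 0\<close>, and it reaches \<open>\<i>b\<close> because \<open>q b > \<tau>\<close>.
\<close>
lemma half_line_transform_boundary:
  assumes F: "F holomorphic_on UNIV" "exponential_type \<tau> F" and \<tau>: "0 < \<tau>"
    and int: "integrable lborel (\<lambda>x. F (of_real x))" and b: "\<tau> < \<bar>b\<bar>"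
  shows "half_line_transform F (\<i> * of_real b)
    = borel_transform F (\<i> * of_real b)"
proof -
  define \<Phi> where "\<Phi> = half_line_transform F"
  have contF: "continuous_on UNIV (\<lambda>x::real. F (of_real x))"
    by (rule continuous_on_real_restriction[OF F(1)])
  have [measurable]: "(\<lambda>x::real. F (of_real x)) \<in> borel_measurable borel"
    by (rule borel_measurable_continuous_onI[OF contF])
  have meas: "(\<lambda>x::real. indicator {0..} x *\<^sub>R (F (of_real x) * exp (- w * of_real x))) \<in> borel_measurable lborel" for w
    by measurable
  have bound: "norm (indicator {0..} x *\<^sub>R (F (of_real x) * exp (- w * of_real x))) \<le> norm (F (of_real x))"
    if "0 \<le> Re w" for x and w :: complex
  proof (cases "0 \<le> x")
    case True
    then have "norm (exp (- w * of_real x)) \<le> 1" using that by simp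
    then show ?thesis using True by (simp add: norm_mult mult_left_le)
  qed auto
  have hol\<Phi>: "\<Phi> holomorphic_on {w. 0 < Re w}"
    unfolding \<Phi>_def
  proof (rule holomorphic_on_parameter_integral[where b="\<lambda>x. norm (F (of_real x))"])
    show "open {w. 0 < Re w}" by (simp add: open_halfspace_Re_gt)
    show "norm (indicat_real {0..} x *\<^sub>R (F (of_real x) * exp (- w * of_real x))) \<le> norm (F (of_real x))"
      if "w \<in> {w. 0 < Re w}" for x w by (rule bound) (use that in simp)
  qed (use meas int in \<open>auto intro!: holomorphic_intros\<close>)
  have holB: "borel_transform F holomorphic_on {w. \<tau> < norm w}"
    by (rule borel_transform_holomorphic[OF F \<tau>])
  define s where "s = (\<tau> / \<bar>b\<bar> + 1) / 2"
  have b0: "b \<noteq> 0" using b \<tau> by auto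
  have s: "\<tau> / \<bar>b\<bar> < s" "s < 1" using b b0 by (auto simp: s_def field_simps)
  have s0: "0 < s" using s(1) \<tau> b0 by (smt (verit) divide_pos_pos zero_less_abs_iff)
  define q where "q = sgn b * s"
  define p where "p = sqrt (1 - s\<^sup>2)"
  have s2: "s\<^sup>2 < 1" using s s0 by (simp add: abs_square_less_1)
  then have p: "0 < p" by (simp add: p_def)
  have "p\<^sup>2 = 1 - s\<^sup>2" using s2 by (simp add: p_def)
  moreover have "q\<^sup>2 = s\<^sup>2" using b0 by (auto simp: q_def sgn_if)
  ultimately have pq: "p\<^sup>2 + q\<^sup>2 = 1" by simp
  have "q * b = s * \<bar>b\<bar>" by (auto simp: q_def sgn_if)
  moreover have "\<tau> < s * \<bar>b\<bar>" using s(1) b0 by (simp add: pos_divide_less_eq)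
  ultimately have qb: "\<tau> < q * b" by simp
  define S where "S = {w. 0 < Re w \<and> \<tau> < p * Re w + q * Im w}"
  have S_eq: "S = {w. 0 < Re w} \<inter> {w. (Complex p q) \<bullet> w > \<tau>}"
    by (auto simp: S_def inner_complex_def)
  have "open S" "convex S" unfolding S_eq
    by (auto intro!: open_Int convex_Int open_halfspace_Re_gt open_halfspace_gt convex_halfspace_Re_gt convex_halfspace_gt)
  have S_norm: "\<tau> < norm w" if "w \<in> S" for w
  proof -
    have "(Complex p q) \<bullet> w \<le> norm (Complex p q) * norm w" by (rule norm_cauchy_schwarz)
    then show ?thesis using that pq by (simp add: S_eq cmod_def)
  qed
  have agree: "\<Phi> w - borel_transform F w = 0" if w: "w \<in> S" for w
  proof (rule analytic_continuation[where S=S and U="complex_of_real ` {\<tau> / p + \<tau><..}" and \<xi>="of_real (\<tau>/p + \<tau> + 1)"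
      and f="\<lambda>w. \<Phi> w - borel_transform F w"])
    show "(\<lambda>w. \<Phi> w - borel_transform F w) holomorphic_on S"
      using S_norm by (intro holomorphic_intros holomorphic_on_subset[OF hol\<Phi>] holomorphic_on_subset[OF holB])
        (auto simp: S_def)
    have sub: "of_real a \<in> S" if "\<tau>/p + \<tau> < a" for a
    proof -
      have "0 < \<tau> / p" using \<tau> p by simp
      then have "\<tau>/p < a" "0 < a" using that \<tau> by linarith+
      then show ?thesis using p by (simp add: S_def pos_divide_less_eq mult.commute)
    qed
    show "complex_of_real ` {\<tau> / p + \<tau><..} \<subseteq> S" using sub by auto
    show "complex_of_real (\<tau> / p + \<tau> + 1) \<in> S" by (rule sub) simp
    show "complex_of_real (\<tau> / p + \<tau> + 1) islimpt complex_of_real ` {\<tau> / p + \<tau><..}"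
    proof (rule islimpt_sequential[THEN iffD2], intro exI conjI allI)
      show "(\<lambda>n. complex_of_real (\<tau> / p + \<tau> + 1 + 1 / real (Suc n))) \<longlonglongrightarrow> complex_of_real (\<tau> / p + \<tau> + 1)"
        using tendsto_add[OF tendsto_const[of "\<tau> / p + \<tau> + 1"] LIMSEQ_Suc[OF lim_1_over_n]]
        by (intro tendsto_of_real) simp
      fix n
      have "\<tau> / p + \<tau> + 1 + 1 / real (Suc n) \<in> {\<tau> / p + \<tau><..}" by (simp add: add_pos_pos)
      moreover have "\<tau> / p + \<tau> + 1 + 1 / real (Suc n) \<noteq> \<tau> / p + \<tau> + 1" by simp
      ultimately show "complex_of_real (\<tau> / p + \<tau> + 1 + 1 / real (Suc n)) \<in> complex_of_real ` {\<tau> / p + \<tau><..} - {complex_of_real (\<tau> / p + \<tau> + 1)}"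
        unfolding of_real_eq_iff Diff_iff singleton_iff by blast
    qed
    show "\<Phi> z - borel_transform F z = 0" if z: "z \<in> complex_of_real ` {\<tau> / p + \<tau><..}" for z
    proof -
      obtain a where a: "z = of_real a" "\<tau> / p + \<tau> < a" using z by auto
      have "0 < \<tau> / p" using \<tau> p by simp
      then have "\<tau> < a" using a by linarith
      then show ?thesis using borel_transform_real(2)[OF F, of a] \<tau> by (simp add: \<Phi>_def a)
    qed
  qed (use w \<open>open S\<close> \<open>convex S\<close> convex_connected in auto)
  define u where "u = (\<lambda>n. complex_of_real (1 / real (Suc n)) + \<i> * of_real b)"
  have ulim: "u \<longlonglongrightarrow> complex_of_real 0 + \<i> * of_real b"
    unfolding u_def by (intro tendsto_intros LIMSEQ_Suc[OF lim_1_over_n])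
  have uS: "u n \<in> S" for n
    using qb p by (simp add: u_def S_def add_strict_increasing2)
  have 1: "(\<lambda>n. \<Phi> (u n)) \<longlonglongrightarrow> \<Phi> (\<i> * of_real b)"
    unfolding \<Phi>_def
  proof (rule integral_dominated_convergence[where w="\<lambda>x. norm (F (of_real x))"])
    show "AE x in lborel. (\<lambda>n. indicat_real {0..} x *\<^sub>R (F (of_real x) * exp (- u n * of_real x)))
       \<longlonglongrightarrow> indicat_real {0..} x *\<^sub>R (F (of_real x) * exp (- (\<i> * of_real b) * of_real x))"
      using ulim by (intro AE_I2 tendsto_intros) simp
    show "AE x in lborel. norm (indicat_real {0..} x *\<^sub>R (F (of_real x) * exp (- u n * of_real x))) \<le> norm (F (of_real x))" for n
      by (intro AE_I2 bound) (simp add: u_def)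
  qed (use meas int in simp_all)
  have 2: "(\<lambda>n. borel_transform F (u n)) \<longlonglongrightarrow> borel_transform F (\<i> * of_real b)"
  proof -
    have "open {w::complex. \<tau> < norm w}" by (intro open_Collect_less continuous_intros)
    then have "isCont (borel_transform F) (\<i> * of_real b)"
      using holomorphic_on_imp_continuous_on[OF holB] b by (simp add: continuous_on_eq_continuous_at norm_mult)
    then show ?thesis using ulim by (simp add: isCont_tendsto_compose)
  qed
  have "(\<lambda>n. \<Phi> (u n)) = (\<lambda>n. borel_transform F (u n))" using agree uS by auto
  then have "\<Phi> (\<i> * of_real b) = borel_transform F (\<i> * of_real b)"
    using 1 2 LIMSEQ_unique by metis
  then show ?thesis by (simp add: \<Phi>_def)
qed

text \<open>
The Fourier integral at \<open>t\<close> is the sum of two half-line integrals. With \<open>w = 2\<pi>\<i>t\<close>, the one over the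
positive axis is the Borel transform of \<open>F\<close> at \<open>w\<close>, and the one over the negative axis is that of
\<open>z \<mapsto> F(-z)\<close> at \<open>-w\<close>; these cancel.
\<close>
theorem paley_wiener_L1:
  assumes F: "F holomorphic_on UNIV" "exponential_type \<tau> F" and \<tau>: "0 < \<tau>"
    and int: "integrable lborel (\<lambda>x. F (of_real x))" and t: "\<tau> < 2 * pi * \<bar>t\<bar>"
  shows "fourier (\<lambda>x. F (of_real x)) t = 0"
proof -
  define b where "b = 2 * pi * t"
  have b: "\<tau> < \<bar>b\<bar>" "\<tau> < \<bar>- b\<bar>" using t by (auto simp: b_def abs_mult)
  define R where "R = (\<lambda>z. F (-1 * z))"
  have R: "R holomorphic_on UNIV" "exponential_type \<tau> R"
  proof -
    show "R holomorphic_on UNIV" unfolding R_def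
      by (rule holomorphic_on_compose_gen[OF _ F(1), unfolded o_def]) (auto intro!: holomorphic_intros)
    show "exponential_type \<tau> R" unfolding R_def exponential_type_def
    proof (intro allI impI)
      fix e :: real assume "0 < e"
      then obtain C where C: "C > 0" "\<And>z. norm (F z) \<le> C * exp ((\<tau> + e) * norm z)"
        using F(2) unfolding exponential_type_def by blast
      have "norm (F (-1 * z)) \<le> C * exp ((\<tau> + e) * norm z)" for z using C(2)[of "-1 * z"] by simp
      then show "\<exists>C>0. \<forall>z. norm (F (-1 * z)) \<le> C * exp ((\<tau> + e) * norm z)" using C(1) by blast
    qed
  qed
  have intR: "integrable lborel (\<lambda>x. R (of_real x))"
    using lborel_integrable_real_affine[OF int, of "-1" 0] by (simp add: R_def)
  have Rb: "borel_transform R (- w) = - borel_transform F w" if "\<tau> < norm w" for w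
  proof -
    have "summable (\<lambda>n. norm ((deriv ^^ n) F 0 / w ^ Suc n))"
      using borel_transform_real(1)[OF F that] \<tau> by (simp add: norm_divide norm_power norm_mult)
    then have sm: "summable (\<lambda>n. (deriv ^^ n) F 0 / w ^ Suc n)" by (rule summable_norm_cancel)
    have "w \<noteq> 0" using that \<tau> by auto
    have "(deriv ^^ n) R 0 / (- w) ^ Suc n = - ((deriv ^^ n) F 0 / w ^ Suc n)" for n
    proof -
      have "(deriv ^^ n) R 0 = (-1) ^ n * (deriv ^^ n) F (-1 * 0)"
        unfolding R_def by (rule higher_deriv_compose_linear[OF F(1), where S=UNIV]) auto
      moreover have "(- w) ^ Suc n = (-1) ^ Suc n * w ^ Suc n" by (simp only: power_mult_distrib[symmetric]) simp
      ultimately show ?thesis using \<open>w \<noteq> 0\<close> by (simp add: field_simps)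
    qed
    then show ?thesis unfolding borel_transform_def suminf_minus[OF sm, symmetric] by presburger
  qed
  have i: "integrable lborel (\<lambda>x. F (of_real x) * exp (- (\<i> * of_real b) * of_real x))"
    using integrable_mult_e2pi[OF int, of "- t" 0] by (simp add: e2pi_exp b_def mult_ac)
  have "fourier (\<lambda>x. F (of_real x)) t = (\<integral>x. F (of_real x) * exp (- (\<i> * of_real b) * of_real x) \<partial>lborel)"
    by (simp add: fourier_def b_def mult_ac)
  also have "\<dots> = (\<integral>x. indicator {0..} x *\<^sub>R (F (of_real x) * exp (- (\<i> * of_real b) * of_real x)) + 
      indicator {..0} x *\<^sub>R (F (of_real x) * exp (- (\<i> * of_real b) * of_real x)) \<partial>lborel)"
    by (rule integral_cong_AE)
       (use i borel_measurable_integrable[OF i] in \<open>auto split: split_indicator intro: AE_mp[OF AE_lborel_singleton[of 0]]\<close>)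
  also have "\<dots> = half_line_transform F (\<i> * of_real b) +
      (\<integral>x. indicator {..0} x *\<^sub>R (F (of_real x) * exp (- (\<i> * of_real b) * of_real x)) \<partial>lborel)"
    by (intro Bochner_Integration.integral_add integrable_mult_indicator i) auto
  also have "(\<integral>x. indicator {..0} x *\<^sub>R (F (of_real x) * exp (- (\<i> * of_real b) * of_real x)) \<partial>lborel)
    = half_line_transform R (\<i> * of_real (- b))"
    by (subst lborel_integral_real_affine[where c="-1" and t=0])
       (auto simp: R_def intro!: Bochner_Integration.integral_cong split: split_indicator)
  also have "half_line_transform F (\<i> * of_real b) +
      half_line_transform R (\<i> * of_real (- b))
    = borel_transform F (\<i> * of_real b) + borel_transform R (- (\<i> * of_real b))"
    unfolding half_line_transform_boundary[OF F \<tau> int b(1)] half_line_transform_boundary[OF R \<tau> intR b(2)]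
    by simp
  also have "\<dots> = 0"
    using b(1) by (subst Rb) (auto simp: norm_mult)
  finally show ?thesis .
qed

section \<open>The Fejer kernel on the line\<close>

definition fejer_kernel :: "nat \<Rightarrow> real \<Rightarrow> real" where
  "fejer_kernel N u = (norm (\<Sum>j<N. e2pi (real j * u)))\<^sup>2 / real N"

text \<open>
The double sum is the form in which positivity of the kernel is visible. Grouping the terms by
\<open>n = j - k\<close> gives the usual weights \<open>1 - \<bar>n\<bar>/N\<close>, see \<open>fejer_mean_weights\<close>.
\<close>
definition fejer_mean :: "nat \<Rightarrow> (int \<Rightarrow> complex) \<Rightarrow> complex" where
  "fejer_mean N c = (\<Sum>j<N. \<Sum>k<N. c (int j - int k)) / of_nat N"

lemma fejer_kernel_nonneg: "0 \<le> fejer_kernel N u" by (simp add: fejer_kernel_def)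

lemma fejer_kernel_measurable [measurable]: "fejer_kernel N \<in> borel_measurable borel"
  unfolding fejer_kernel_def by measurable

lemma fejer_kernel_le: "fejer_kernel N u \<le> real N"
proof -
  have "norm (\<Sum>j<N. e2pi (real j * u)) \<le> real N"
    by (rule order_trans[OF norm_sum]) simp
  then have "(norm (\<Sum>j<N. e2pi (real j * u)))\<^sup>2 \<le> (real N)\<^sup>2" by (intro power_mono) auto
  then show ?thesis by (cases "N = 0") (auto simp: fejer_kernel_def power2_eq_square divide_le_eq)
qed

lemma fejer_kernel_periodic: "fejer_kernel N (of_int m + u) = fejer_kernel N u"
proof -
  have "e2pi (real j * (of_int m + u)) = e2pi (real j * u)" for j
  proof -
    have "real j * (of_int m + u) = of_int (int j * m) + real j * u" by (simp add: algebra_simps)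
    then show ?thesis by (simp only: e2pi_add e2pi_int) simp
  qed
  then show ?thesis by (simp add: fejer_kernel_def)
qed

lemma fejer_kernel_expand:
  "complex_of_real (fejer_kernel N u) = fejer_mean N (\<lambda>n. e2pi (- (u * of_int n)))"
proof -
  have "complex_of_real ((norm (\<Sum>j<N. e2pi (real j * u)))\<^sup>2)
      = (\<Sum>j<N. cnj (e2pi (real j * u))) * (\<Sum>k<N. e2pi (real k * u))"
    unfolding complex_norm_square cnj_sum by (rule mult.commute)
  also have "\<dots> = (\<Sum>j<N. \<Sum>k<N. e2pi (- (u * of_int (int j - int k))))"
    unfolding sum_product
    by (intro sum.cong refl) (simp add: e2pi_minus[symmetric] e2pi_add[symmetric] algebra_simps)
  finally show ?thesis by (simp add: fejer_kernel_def fejer_mean_def)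
qed

text \<open>
For integrable \<open>f\<close> on the line the Fejer means of the transform at the integers are an integral against
the periodic Fejer kernel, without periodising \<open>f\<close>.
\<close>
lemma fejer_mean_fourier:
  assumes f: "integrable lborel f"
  shows "fejer_mean N (\<lambda>n. fourier f (of_int n) * e2pi (of_int n * x))
       = (\<integral>y. f y * of_real (fejer_kernel N (y - x)) \<partial>lborel)"
proof -
  have i: "integrable lborel (\<lambda>y. f y * e2pi (- ((y - x) * of_int n)))" for n
    using integrable_mult_e2pi[OF f, of "- of_int n" "x * of_int n"] by (simp add: algebra_simps)
  have c: "fourier f (of_int n) * e2pi (of_int n * x) = (\<integral>y. f y * e2pi (- ((y - x) * of_int n)) \<partial>lborel)" for n
  proof -
    have "fourier f (of_int n) * e2pi (of_int n * x) = (\<integral>y. f y * e2pi (- (y * of_int n)) * e2pi (of_int n * x) \<partial>lborel)"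
      unfolding fourier_e2pi by simp
    also have "\<dots> = (\<integral>y. f y * e2pi (- ((y - x) * of_int n)) \<partial>lborel)"
      by (intro Bochner_Integration.integral_cong refl, unfold mult.assoc e2pi_add[symmetric]) (simp add: algebra_simps)
    finally show ?thesis .
  qed
  have "fejer_mean N (\<lambda>n. fourier f (of_int n) * e2pi (of_int n * x))
      = (\<integral>y. (\<Sum>j<N. \<Sum>k<N. f y * e2pi (- ((y - x) * of_int (int j - int k)))) / of_nat N \<partial>lborel)"
    unfolding fejer_mean_def c by (simp add: Bochner_Integration.integral_sum i integrable_sum del: of_int_diff)
  also have "\<dots> = (\<integral>y. f y * of_real (fejer_kernel N (y - x)) \<partial>lborel)"
    unfolding fejer_kernel_expand fejer_mean_def by (simp add: sum_distrib_left)
  finally show ?thesis .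
qed

text \<open>
The kernel is \<open>\<bar>1 - z\<^sup>N\<bar>\<^sup>2 / (N \<bar>1 - z\<bar>\<^sup>2)\<close> with \<open>z = e2pi u\<close>, and \<open>\<bar>1 - z\<bar> = 2 \<bar>sin (\<pi> u)\<bar>\<close> is
bounded below away from the integers.
\<close>
lemma fejer_kernel_away:
  assumes "0 < \<delta>" "\<delta> \<le> 1/2"
  obtains B where "0 \<le> B" "\<And>N u. \<delta> \<le> \<bar>u\<bar> \<Longrightarrow> \<bar>u\<bar> \<le> 1/2 \<Longrightarrow> fejer_kernel N u \<le> B / real N"
proof -
  define s where "s = sin (pi * \<delta>)"
  have s: "0 < s" unfolding s_def using assms by (intro sin_gt_zero) auto
  show ?thesis
  proof (rule that[of "(1 / s)\<^sup>2"])
    fix N u assume u: "\<delta> \<le> \<bar>u\<bar>" "\<bar>u\<bar> \<le> 1/2"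
    have "s \<le> sin (pi * \<bar>u\<bar>)"
    proof -
      have "pi * \<delta> \<le> pi * \<bar>u\<bar>" "pi * \<bar>u\<bar> \<le> pi * (1/2)" "0 \<le> pi * \<delta>"
        using u assms by (intro mult_left_mono mult_nonneg_nonneg; simp)+
      then show ?thesis unfolding s_def using pi_gt_zero by (intro sin_monotone_2pi_le) linarith+
    qed
    also have "\<dots> \<le> \<bar>sin (pi * u)\<bar>" by (cases "0 \<le> u") auto
    finally have s_le: "s \<le> \<bar>sin (pi * u)\<bar>" .
    have e: "norm (1 - e2pi u) = 2 * \<bar>sin (pi * u)\<bar>"
    proof -
      have "(norm (1 - e2pi u))\<^sup>2 = (1 - cos (2 * (pi * u)))\<^sup>2 + (sin (2 * (pi * u)))\<^sup>2"
        by (simp add: e2pi_def cmod_power2 mult.assoc)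
      also have "\<dots> = 2 - 2 * cos (2 * (pi * u))"
        using sin_cos_squared_add[of "2 * (pi * u)"] by (simp add: power2_eq_square algebra_simps)
      also have "\<dots> = (2 * sin (pi * u))\<^sup>2"
        unfolding cos_double_sin by (simp add: power2_eq_square)
      finally have "norm (1 - e2pi u) = \<bar>2 * sin (pi * u)\<bar>"
        using real_sqrt_abs[of "norm (1 - e2pi u)"] real_sqrt_abs[of "2 * sin (pi * u)"] by simp
      then show ?thesis by (simp add: abs_mult)
    qed
    have ne: "e2pi u \<noteq> 1" using e s s_le by auto
    have ej: "e2pi (real j * u) = e2pi u ^ j" for j
      by (induction j) (auto simp: algebra_simps e2pi_add)
    have "norm (\<Sum>j<N. e2pi (real j * u)) = norm (1 - e2pi u ^ N) / norm (1 - e2pi u)"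
      using ne by (simp add: ej sum_gp_strict norm_divide)
    also have "\<dots> \<le> 2 / (2 * s)"
    proof (rule frac_le)
      show "norm (1 - e2pi u ^ N) \<le> 2"
        by (rule order_trans[OF norm_triangle_ineq4]) (simp add: norm_power)
    qed (use s s_le e in auto)
    finally have "(norm (\<Sum>j<N. e2pi (real j * u)))\<^sup>2 \<le> (1 / s)\<^sup>2" by (intro power_mono) auto
    then show "fejer_kernel N u \<le> (1 / s)\<^sup>2 / real N"
      unfolding fejer_kernel_def by (intro divide_right_mono) auto
  qed auto
qed

abbreviation unit_cell :: "real set" where "unit_cell \<equiv> {-1/2..<1/2}"

lemma integrable_unit_indicator: "integrable lborel (\<lambda>u. complex_of_real (indicator unit_cell u))"
  by (intro integrable_of_real integrable_real_indicator) auto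

lemma fourier_unit_indicator:
  "fourier (\<lambda>u. complex_of_real (indicator unit_cell u)) (of_int n) = (if n = 0 then 1 else 0)"
proof (cases "n = 0")
  case True
  then show ?thesis unfolding fourier_e2pi by (simp add: measure_def)
next
  case False
  define A where "A = (\<lambda>u. e2pi (- (u * of_int n)) / (- (2 * of_real pi * \<i> * of_int n)))"
  have d: "(A has_vector_derivative e2pi (- (u * of_int n))) (at u within S)" for u S
  proof -
    have "((\<lambda>z. exp (- (2 * of_real pi * \<i> * of_int n) * z) / (- (2 * of_real pi * \<i> * of_int n)))
        has_field_derivative exp (- (2 * of_real pi * \<i> * of_int n) * of_real u)) (at (of_real u))"
      using False by (auto intro!: derivative_eq_intros)
    from has_vector_derivative_real_field[OF this, of S] show ?thesis
      by (simp add: A_def e2pi_exp mult_ac)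
  qed
  have "(LBINT u:{-1/2..1/2}. e2pi (- (u * of_int n))) = A (1/2) - A (-1/2)"
    unfolding set_lebesgue_integral_def
    by (rule integral_FTC_atLeastAtMost) (auto intro: d intro!: continuous_intros)
  also have "\<dots> = 0"
  proof -
    have "e2pi (- (-1/2 * of_int n)) = e2pi (of_int n + - (1/2 * of_int n))" by (rule arg_cong[where f=e2pi]) simp
    also have "\<dots> = e2pi (- (1/2 * of_int n))" by (simp only: e2pi_add e2pi_int) simp
    finally show ?thesis by (simp add: A_def)
  qed
  finally have 0: "(LBINT u:{-1/2..1/2}. e2pi (- (u * of_int n))) = 0" .
  have "fourier (\<lambda>u. complex_of_real (indicator unit_cell u)) (of_int n) = (LBINT u:{-1/2..1/2}. e2pi (- (u * of_int n)))"
    unfolding fourier_e2pi set_lebesgue_integral_def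
  proof (rule integral_cong_AE)
    show "AE u in lborel. complex_of_real (indicator unit_cell u) * e2pi (- (u * of_int n)) = indicator {-1/2..1/2} u *\<^sub>R e2pi (- (u * of_int n))"
      using AE_lborel_singleton[of "1/2"] by eventually_elim (auto split: split_indicator)
  qed measurable
  then show ?thesis using 0 False by simp
qed

lemma fejer_kernel_unit_integral:
  assumes "0 < N"
  shows "(\<integral>u. indicator unit_cell u * fejer_kernel N u \<partial>lborel) = 1"
proof -
  have "complex_of_real (\<integral>u. indicator unit_cell u * fejer_kernel N u \<partial>lborel)
      = (\<integral>u. complex_of_real (indicator unit_cell u) * of_real (fejer_kernel N (u - 0)) \<partial>lborel)"
    by (subst integral_complex_of_real[symmetric]) simp
  also have "\<dots> = fejer_mean N (\<lambda>n. fourier (\<lambda>u. complex_of_real (indicator unit_cell u)) (of_int n) * e2pi (of_int n * 0))"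
    by (rule fejer_mean_fourier[OF integrable_unit_indicator, symmetric])
  also have "\<dots> = 1"
    unfolding fourier_unit_indicator fejer_mean_def using assms by simp
  finally show ?thesis by (simp only: of_real_eq_1_iff)
qed

lemma unit_integrable:
  fixes P :: "real \<Rightarrow> 'b :: {banach, second_countable_topology}"
  assumes "P \<in> borel_measurable borel" "\<And>u. u \<in> unit_cell \<Longrightarrow> norm (P u) \<le> B"
  shows "integrable lborel (\<lambda>u. indicator unit_cell u *\<^sub>R P u)"
proof (rule Bochner_Integration.integrable_bound)
  show "integrable lborel (\<lambda>u. indicator unit_cell u * B)"
    by (intro integrable_mult_left integrable_real_indicator) auto
  show "AE u in lborel. norm (indicator unit_cell u *\<^sub>R P u) \<le> norm (indicator unit_cell u * B)"
    using assms(2) by (intro AE_I2) (auto split: split_indicator intro: order_trans[OF _ abs_ge_self])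
qed (use assms(1) in measurable)

lemma fejer_approximate_identity:
  fixes P :: "real \<Rightarrow> complex"
  assumes meas [measurable]: "P \<in> borel_measurable borel"
    and bd: "\<And>u. u \<in> unit_cell \<Longrightarrow> norm (P u) \<le> B" and cont: "isCont P 0"
  shows "(\<lambda>N. \<integral>u. indicator unit_cell u *\<^sub>R (P u * of_real (fejer_kernel N u)) \<partial>lborel) \<longlonglongrightarrow> P 0"
proof (rule LIMSEQ_I)
  fix r :: real assume r: "0 < r"
  have B0: "0 \<le> B" using bd[of 0] by (auto intro: order_trans[OF norm_ge_zero])
  obtain d0 where d0: "0 < d0" "\<And>u. \<bar>u\<bar> < d0 \<Longrightarrow> norm (P u - P 0) < r/2"
    using cont r unfolding continuous_at_eps_delta dist_norm by (metis diff_zero half_gt_zero real_norm_def)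
  define d where "d = min d0 (1/2)"
  have d: "0 < d" "d \<le> 1/2" "\<And>u. \<bar>u\<bar> < d \<Longrightarrow> norm (P u - P 0) < r/2" using d0 by (auto simp: d_def)
  obtain A where A: "0 \<le> A" "\<And>N u. d \<le> \<bar>u\<bar> \<Longrightarrow> \<bar>u\<bar> \<le> 1/2 \<Longrightarrow> fejer_kernel N u \<le> A / real N"
    using fejer_kernel_away[OF d(1,2)] by metis
  obtain n0 where n0: "2 * B * A / (r / 2) < real n0" using reals_Archimedean2 by blast
  show "\<exists>no. \<forall>n\<ge>no. norm ((\<integral>u. indicator unit_cell u *\<^sub>R (P u * of_real (fejer_kernel n u)) \<partial>lborel) - P 0) < r"
  proof (intro exI[of _ "Suc n0"] allI impI)
    fix n assume "Suc n0 \<le> n"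
    then have n: "0 < n" "2 * B * A / (r/2) < real n" using n0 by auto
    have iK: "integrable lborel (\<lambda>u. indicator unit_cell u *\<^sub>R fejer_kernel n u)"
      by (rule unit_integrable[where B="real n"]) (auto simp: fejer_kernel_nonneg fejer_kernel_le)
    have iPK: "integrable lborel (\<lambda>u. indicator unit_cell u *\<^sub>R (P u * of_real (fejer_kernel n u)))"
      using bd fejer_kernel_le[of n] fejer_kernel_nonneg[of n] B0
      by (intro unit_integrable[where B="B * real n"]) (auto simp: norm_mult intro!: mult_mono)
    have iK': "integrable lborel (\<lambda>u. P 0 * of_real (indicator unit_cell u *\<^sub>R fejer_kernel n u))"
      using iK by (intro integrable_mult_right integrable_of_real)
    define c where "c = 2 * B * A / real n"
    have c0: "0 \<le> c" using B0 A by (simp add: c_def)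
    have c_eq: "c = 2 * B * (A / real n)" by (simp add: c_def)
    have "(\<integral>u. indicator unit_cell u *\<^sub>R (P u * of_real (fejer_kernel n u)) \<partial>lborel) - P 0
      = (\<integral>u. indicator unit_cell u *\<^sub>R (P u * of_real (fejer_kernel n u)) \<partial>lborel)
        - (\<integral>u. P 0 * of_real (indicator unit_cell u *\<^sub>R fejer_kernel n u) \<partial>lborel)"
      using fejer_kernel_unit_integral[OF n(1)]
      by (simp add: integral_complex_of_real del: of_real_mult)
    also have "\<dots> = (\<integral>u. indicator unit_cell u *\<^sub>R ((P u - P 0) * of_real (fejer_kernel n u)) \<partial>lborel)"
      by (subst Bochner_Integration.integral_diff[OF iPK iK', symmetric])
         (auto intro!: Bochner_Integration.integral_cong simp: scaleR_conv_of_real algebra_simps)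
    finally have eq: "(\<integral>u. indicator unit_cell u *\<^sub>R (P u * of_real (fejer_kernel n u)) \<partial>lborel) - P 0 = (\<integral>u. indicator unit_cell u *\<^sub>R ((P u - P 0) * of_real (fejer_kernel n u)) \<partial>lborel)" .
    have "norm (\<integral>u. indicator unit_cell u *\<^sub>R ((P u - P 0) * of_real (fejer_kernel n u)) \<partial>lborel) \<le> (\<integral>u. r/2 * (indicator unit_cell u *\<^sub>R fejer_kernel n u) + indicator unit_cell u *\<^sub>R (c) \<partial>lborel)"
    proof (rule Bochner_Integration.integral_norm_bound_integral)
      show "integrable lborel (\<lambda>u. indicator unit_cell u *\<^sub>R ((P u - P 0) * complex_of_real (fejer_kernel n u)))"
        using Bochner_Integration.integrable_diff[OF iPK iK'] by (simp add: scaleR_conv_of_real algebra_simps)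
      show "integrable lborel (\<lambda>u. r/2 * (indicator unit_cell u *\<^sub>R fejer_kernel n u) + indicator unit_cell u *\<^sub>R (c))"
        by (intro Bochner_Integration.integrable_add integrable_mult_right iK unit_integrable[where B="\<bar>c\<bar>"]) simp_all
      fix u
      show "norm (indicator unit_cell u *\<^sub>R ((P u - P 0) * complex_of_real (fejer_kernel n u)))
         \<le> r/2 * (indicator unit_cell u *\<^sub>R fejer_kernel n u) + indicator unit_cell u *\<^sub>R (c)"
      proof (cases "u \<in> unit_cell")
        case True
        show ?thesis
        proof (cases "\<bar>u\<bar> < d")
          case near: True
          have "norm (P u - P 0) * fejer_kernel n u \<le> r/2 * fejer_kernel n u"
            using d(3)[OF near] by (intro mult_right_mono fejer_kernel_nonneg) simp
          moreover have "0 \<le> c" by (rule c0)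
          ultimately show ?thesis using True fejer_kernel_nonneg[of n u] by (simp add: norm_mult)
        next
          case False
          have "norm (P u - P 0) \<le> 2 * B"
            using norm_triangle_ineq4[of "P u" "P 0"] bd[OF True] bd[of 0] by simp
          then have "norm (P u - P 0) * fejer_kernel n u \<le> c" unfolding c_eq
            using False True B0 by (intro mult_mono A fejer_kernel_nonneg) auto
          moreover have "0 \<le> r/2 * fejer_kernel n u" using r by (intro mult_nonneg_nonneg fejer_kernel_nonneg) simp
          ultimately show ?thesis using True fejer_kernel_nonneg[of n u] by (simp add: norm_mult)
        qed
      qed auto
    qed
    also have "\<dots> = r/2 + c"
    proof -
      have i2: "integrable lborel (\<lambda>u. indicator unit_cell u *\<^sub>R (c))"
        by (rule unit_integrable[where B="\<bar>c\<bar>"]) simp_all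
      have v: "(\<integral>u. indicator unit_cell u *\<^sub>R (c) \<partial>lborel) = c"
        by simp
      show ?thesis
        unfolding Bochner_Integration.integral_add[OF integrable_mult_right[OF iK] i2] v
        using fejer_kernel_unit_integral[OF n(1)] by simp
    qed
    also have "\<dots> < r"
      using n r by (simp add: c_def field_simps)
    finally show "norm ((\<integral>u. indicator unit_cell u *\<^sub>R (P u * of_real (fejer_kernel n u)) \<partial>lborel) - P 0) < r"
      unfolding eq .
  qed
qed

text \<open>
The line is cut into unit intervals centred at the points of \<open>x + \<int>\<close>. The integers are enumerated by
\<open>int_decode\<close>, so that the theorems on series over the natural numbers apply.
\<close>
lemma unit_interval_decomposition:
  fixes f :: "real \<Rightarrow> complex"
  assumes meas [measurable]: "f \<in> borel_measurable borel"
    and bd: "\<And>m u. u \<in> unit_cell \<Longrightarrow> norm (f (x + (of_int m + u))) \<le> \<beta> m"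
    and sum: "summable (\<lambda>n. \<beta> (int_decode n))"
  shows "integrable lborel f"
    and "(\<integral>y. f y \<partial>lborel) = (\<Sum>n. \<integral>u. indicator unit_cell u *\<^sub>R f (x + (of_int (int_decode n) + u)) \<partial>lborel)"
proof -
  define A where "A = (\<lambda>n. {x + of_int (int_decode n) - 1/2..<x + of_int (int_decode n) + 1/2})"
  have floor: "y \<in> {x + of_int m - 1/2..<x + of_int m + 1/2} \<longleftrightarrow> m = \<lfloor>y - x + 1/2\<rfloor>" for y :: real and m
    unfolding eq_commute[of m] floor_eq_iff by auto
  have A_iff: "y \<in> A n \<longleftrightarrow> n = int_encode \<lfloor>y - x + 1/2\<rfloor>" for y n
    unfolding A_def floor by (metis int_decode_inverse int_encode_inverse)
  define p where "p = (\<lambda>n y. indicator (A n) y *\<^sub>R f y)"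
  define q where "q = (\<lambda>n u. indicator unit_cell u *\<^sub>R f (x + (of_int (int_decode n) + u)))"
  have qp: "q n u = p n ((x + of_int (int_decode n)) + 1 * u)" for n u
    by (auto simp: q_def p_def A_def add.assoc split: split_indicator)
  have qp': "q n = (\<lambda>u. p n (x + of_int (int_decode n) + u))" for n
    by (auto simp: qp)
  have iq: "integrable lborel (q n)" for n
    unfolding q_def by (rule unit_integrable[where B="\<beta> (int_decode n)"]) (use bd in auto)
  have nq: "norm (q n u) \<le> indicator unit_cell u * \<beta> (int_decode n)" for n u
    using bd[of u "int_decode n"] by (auto simp: q_def split: split_indicator)
  have ip: "integrable lborel (p n)" for n
    using iq[of n] unfolding qp[abs_def] by (subst (asm) lborel_integrable_real_affine_iff) auto
  have intp: "(\<integral>y. p n y \<partial>lborel) = (\<integral>u. q n u \<partial>lborel)" for n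
    by (subst lborel_integral_real_affine[where c=1 and t="x + of_int (int_decode n)"]) (auto simp: qp')
  have intnp: "(\<integral>y. norm (p n y) \<partial>lborel) \<le> \<beta> (int_decode n)" for n
  proof -
    have "(\<integral>y. norm (p n y) \<partial>lborel) = (\<integral>u. norm (q n u) \<partial>lborel)"
      by (subst lborel_integral_real_affine[where c=1 and t="x + of_int (int_decode n)"]) (auto simp: qp')
    also have "\<dots> \<le> (\<integral>u. indicator unit_cell u * \<beta> (int_decode n) \<partial>lborel)"
      using nq iq[of n] by (intro integral_mono) (auto intro!: integrable_mult_left)
    finally show ?thesis by (simp add: measure_def)
  qed
  have single: "p n y = 0" if "n \<noteq> int_encode \<lfloor>y - x + 1/2\<rfloor>" for n y
    using that A_iff by (auto simp: p_def)
  have sums: "(\<lambda>n. p n y) sums f y" for y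
    using sums_finite[of "{int_encode \<lfloor>y - x + 1/2\<rfloor>}" "\<lambda>n. p n y"] single A_iff
    by (auto simp: p_def)
  have AE: "AE y in lborel. summable (\<lambda>n. norm (p n y))"
    using single by (intro AE_I2 summable_finite[of "{int_encode \<lfloor>y - x + 1/2\<rfloor>}" for y]) auto
  have S: "summable (\<lambda>n. \<integral>y. norm (p n y) \<partial>lborel)"
    by (rule summable_comparison_test[OF _ sum]) (use intnp in auto)
  have "integrable lborel (\<lambda>y. \<Sum>n. p n y)" by (rule integrable_suminf[OF ip AE S])
  then show "integrable lborel f" using sums by (simp add: sums_iff)
  have "(\<integral>y. (\<Sum>n. p n y) \<partial>lborel) = (\<Sum>n. \<integral>y. p n y \<partial>lborel)" by (rule integral_suminf[OF ip AE S])
  then show "(\<integral>y. f y \<partial>lborel) = (\<Sum>n. \<integral>u. indicator unit_cell u *\<^sub>R f (x + (of_int (int_decode n) + u)) \<partial>lborel)"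
    using sums by (simp add: sums_iff intp q_def)
qed

section \<open>Poisson summation and Fejer means\<close>

text \<open>
Poisson summation in Fejer form: on each unit interval the kernel is an approximate identity at the
centre, and the summable bounds \<open>\<beta>\<close> allow the limit to be taken term by term.
\<close>
lemma fejer_poisson:
  fixes f :: "real \<Rightarrow> complex"
  assumes cont: "continuous_on UNIV f"
    and bd: "\<And>m u. u \<in> unit_cell \<Longrightarrow> norm (f (x + (of_int m + u))) \<le> \<beta> m"
    and sum: "summable (\<lambda>n. \<beta> (int_decode n))"
  shows "integrable lborel f"
    and "(\<lambda>N. fejer_mean N (\<lambda>n. fourier f (of_int n) * e2pi (of_int n * x))) \<longlonglongrightarrow> (\<Sum>n. f (x + of_int (int_decode n)))"
proof -
  have [measurable]: "f \<in> borel_measurable borel" by (rule borel_measurable_continuous_onI[OF cont])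
  show int: "integrable lborel f" by (rule unit_interval_decomposition(1)[OF _ bd sum]) auto
  have \<beta>0: "0 \<le> \<beta> m" for m
    using bd[of 0 m] by (auto intro: order_trans[OF norm_ge_zero])
  define q where "q = (\<lambda>n N. \<integral>u. indicator unit_cell u *\<^sub>R (f (x + (of_int (int_decode n) + u)) * of_real (fejer_kernel N u)) \<partial>lborel)"
  have eq: "fejer_mean N (\<lambda>n. fourier f (of_int n) * e2pi (of_int n * x)) = (\<Sum>n. q n N)" for N
  proof -
    have "(\<integral>y. f y * of_real (fejer_kernel N (y - x)) \<partial>lborel)
       = (\<Sum>n. \<integral>u. indicator unit_cell u *\<^sub>R (f (x + (of_int (int_decode n) + u)) * of_real (fejer_kernel N (x + (of_int (int_decode n) + u) - x))) \<partial>lborel)"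
    proof (rule unit_interval_decomposition(2)[where \<beta>="\<lambda>m. \<beta> m * real N"])
      fix u :: real and m assume u: "u \<in> unit_cell"
      show "norm (f (x + (of_int m + u)) * of_real (fejer_kernel N (x + (of_int m + u) - x))) \<le> \<beta> m * real N"
        unfolding norm_mult using bd[OF u, of m] fejer_kernel_le fejer_kernel_nonneg \<beta>0[of m]
        by (intro mult_mono) auto
    qed (use summable_mult2[OF sum] in auto)
    then show ?thesis unfolding fejer_mean_fourier[OF int] q_def by (simp add: fejer_kernel_periodic)
  qed
  have lim: "(\<lambda>N. q n N) \<longlonglongrightarrow> f (x + of_int (int_decode n))" for n
  proof -
    have "(\<lambda>N. \<integral>u. indicator unit_cell u *\<^sub>R (f (x + (of_int (int_decode n) + u)) * of_real (fejer_kernel N u)) \<partial>lborel)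
      \<longlonglongrightarrow> f (x + (of_int (int_decode n) + 0))"
    proof (rule fejer_approximate_identity)
      show "isCont (\<lambda>u. f (x + (of_int (int_decode n) + u))) 0"
      proof -
        have "continuous_on UNIV (\<lambda>u. f (x + (of_int (int_decode n) + u)))"
          by (rule continuous_on_compose2[OF cont]) (auto intro!: continuous_intros)
        then show ?thesis by (simp add: continuous_on_eq_continuous_at)
      qed
    qed (use bd in auto)
    then show ?thesis by (simp add: q_def)
  qed
  have bound: "norm (q n N) \<le> \<beta> (int_decode n)" if N: "0 < N" for n N
  proof -
    have iK: "integrable lborel (\<lambda>u. indicator unit_cell u *\<^sub>R fejer_kernel N u)"
      by (rule unit_integrable[where B="real N"]) (auto simp: fejer_kernel_nonneg fejer_kernel_le)
    have "norm (q n N) \<le> (\<integral>u. \<beta> (int_decode n) * (indicator unit_cell u *\<^sub>R fejer_kernel N u) \<partial>lborel)"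
      unfolding q_def
    proof (rule Bochner_Integration.integral_norm_bound_integral)
      have "norm (f (x + (of_int (int_decode n) + u)) * of_real (fejer_kernel N u)) \<le> \<beta> (int_decode n) * real N"
        if "u \<in> unit_cell" for u
        unfolding norm_mult using bd[OF that] fejer_kernel_le[of N u] fejer_kernel_nonneg[of N u] \<beta>0
        by (intro mult_mono) auto
      then show "integrable lborel (\<lambda>u. indicator unit_cell u *\<^sub>R (f (x + (of_int (int_decode n) + u)) * of_real (fejer_kernel N u)))"
        by (intro unit_integrable) auto
      show "norm (indicator unit_cell u *\<^sub>R (f (x + (of_int (int_decode n) + u)) * of_real (fejer_kernel N u)))
        \<le> \<beta> (int_decode n) * (indicator unit_cell u *\<^sub>R fejer_kernel N u)" for u
        using bd[of u "int_decode n"] fejer_kernel_nonneg[of N u]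
        by (cases "u \<in> unit_cell") (auto simp: norm_mult mult_right_mono)
    qed (use iK in auto)
    also have "\<dots> = \<beta> (int_decode n)" using fejer_kernel_unit_integral[OF N] by simp
    finally show ?thesis .
  qed
  have "eventually (\<lambda>N. 0 < N) sequentially" by (rule eventually_gt_at_top)
  then have "eventually (\<lambda>(k, N). norm (q k N) \<le> \<beta> (int_decode k)) (at_top \<times>\<^sub>F sequentially)"
    unfolding eventually_prod_filter using bound by (intro exI[of _ "\<lambda>_. True"] exI[of _ "\<lambda>N. 0 < N"]) auto
  from tannerys_theorem[OF lim this sum]
  show "(\<lambda>N. fejer_mean N (\<lambda>n. fourier f (of_int n) * e2pi (of_int n * x))) \<longlonglongrightarrow> (\<Sum>n. f (x + of_int (int_decode n)))"
    unfolding eq by simp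
qed

lemma card_difference_fibre:
  assumes "\<bar>n\<bar> < int N"
  shows "card {p \<in> {..<N} \<times> {..<N}. int (fst p) - int (snd p) = n} = N - nat \<bar>n\<bar>"
proof -
  define h where "h = (\<lambda>i. (i + nat n, i + nat (- n)))"
  have "{p \<in> {..<N} \<times> {..<N}. int (fst p) - int (snd p) = n} = h ` {..<N - nat \<bar>n\<bar>}"
  proof (intro equalityI subsetI)
    fix p assume "p \<in> {p \<in> {..<N} \<times> {..<N}. int (fst p) - int (snd p) = n}"
    then have p: "fst p < N" "snd p < N" "int (fst p) - int (snd p) = n" by auto
    show "p \<in> h ` {..<N - nat \<bar>n\<bar>}"
      by (rule image_eqI[of _ _ "min (fst p) (snd p)"]) (use p in \<open>auto simp: h_def min_def prod_eq_iff split: if_splits\<close>)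
  qed (use assms in \<open>auto simp: h_def\<close>)
  moreover have "inj_on h {..<N - nat \<bar>n\<bar>}" by (auto simp: inj_on_def h_def)
  ultimately show ?thesis by (simp add: card_image)
qed

lemma fejer_mean_weights:
  assumes "0 < N"
  shows "fejer_mean N c = (\<Sum>n\<in>{- int N<..<int N}. of_real (1 - real_of_int \<bar>n\<bar> / real N) * c n)"
proof -
  have "(\<Sum>j<N. \<Sum>k<N. c (int j - int k)) = (\<Sum>p\<in>{..<N}\<times>{..<N}. c (int (fst p) - int (snd p)))"
    by (simp add: sum.cartesian_product case_prod_beta)
  also have "\<dots> = (\<Sum>n\<in>{- int N<..<int N}. \<Sum>p\<in>{p \<in> {..<N} \<times> {..<N}. int (fst p) - int (snd p) = n}. c (int (fst p) - int (snd p)))"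
    by (rule sum.group[symmetric]) auto
  also have "\<dots> = (\<Sum>n\<in>{- int N<..<int N}. of_nat (N - nat \<bar>n\<bar>) * c n)"
    by (intro sum.cong refl) (auto simp: card_difference_fibre abs_less_iff)
  finally have *: "(\<Sum>j<N. \<Sum>k<N. c (int j - int k)) = (\<Sum>n\<in>{- int N<..<int N}. of_nat (N - nat \<bar>n\<bar>) * c n)" .
  have w: "of_nat (N - nat \<bar>n\<bar>) / of_nat N = complex_of_real (1 - real_of_int \<bar>n\<bar> / real N)" if "n \<in> {- int N<..<int N}" for n
  proof -
    have "nat \<bar>n\<bar> \<le> N" using that by auto
    then have "real (N - nat \<bar>n\<bar>) = real N - real_of_int \<bar>n\<bar>" by (simp add: of_nat_diff)
    then have "real (N - nat \<bar>n\<bar>) / real N = 1 - real_of_int \<bar>n\<bar> / real N" using assms by (simp add: field_simps)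
    then show ?thesis by (metis of_real_divide of_real_of_nat_eq)
  qed
  have "fejer_mean N c = (\<Sum>n\<in>{- int N<..<int N}. (of_nat (N - nat \<bar>n\<bar>) / of_nat N) * c n)"
    unfolding fejer_mean_def * sum_divide_distrib by simp
  also have "\<dots> = (\<Sum>n\<in>{- int N<..<int N}. of_real (1 - real_of_int \<bar>n\<bar> / real N) * c n)"
    by (intro sum.cong refl) (simp only: w)
  finally show ?thesis .
qed

lemma fejer_mean_summable:
  assumes sum: "summable (\<lambda>n. norm (c (int_decode n)))"
  shows "(\<lambda>N. fejer_mean N c) \<longlonglongrightarrow> (\<Sum>n. c (int_decode n))"
proof -
  define w where "w = (\<lambda>(N::nat) (n::int). if n \<in> {- int N<..<int N} then 1 - real_of_int \<bar>n\<bar> / real N else 0)"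
  define q where "q = (\<lambda>k N. of_real (w N (int_decode k)) * c (int_decode k))"
  have w01: "0 \<le> w N n" "w N n \<le> 1" for N n by (auto simp: w_def field_simps)
  have wlim: "(\<lambda>N. w N n) \<longlonglongrightarrow> 1" for n
  proof -
    have "(\<lambda>N. 1 - real_of_int \<bar>n\<bar> / real N) \<longlonglongrightarrow> 1 - 0"
      by (intro tendsto_intros lim_const_over_n)
    moreover have "eventually (\<lambda>N. 1 - real_of_int \<bar>n\<bar> / real N = w N n) sequentially"
      using eventually_gt_at_top[of "nat \<bar>n\<bar>"] by eventually_elim (auto simp: w_def)
    ultimately show ?thesis by (simp add: Lim_transform_eventually)
  qed
  have lim: "(\<lambda>N. q k N) \<longlonglongrightarrow> c (int_decode k)" for k
    unfolding q_def using tendsto_mult[OF tendsto_of_real[OF wlim[of "int_decode k"]] tendsto_const[of "c (int_decode k)"]] by simp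
  have eq: "fejer_mean N c = (\<Sum>k. q k N)" if N: "0 < N" for N
  proof -
    have "fejer_mean N c = (\<Sum>n\<in>{- int N<..<int N}. of_real (w N n) * c n)"
      unfolding fejer_mean_weights[OF N] by (intro sum.cong refl) (simp only: w_def if_True)
    also have "\<dots> = (\<Sum>k\<in>int_encode ` {- int N<..<int N}. q k N)"
      by (subst sum.reindex) (auto simp: q_def inj_int_encode)
    also have "\<dots> = (\<Sum>k. q k N)"
    proof (rule suminf_finite[symmetric])
      fix k assume "k \<notin> int_encode ` {- int N<..<int N}"
      then have "int_decode k \<notin> {- int N<..<int N}" by (metis image_eqI int_decode_inverse)
      then have "w N (int_decode k) = 0" by (simp only: w_def if_False)
      then show "q k N = 0" by (simp add: q_def)
    qed auto
    finally show ?thesis .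
  qed
  have "norm (q k N) \<le> norm (c (int_decode k))" for k N
    unfolding q_def norm_mult using w01 by (simp add: mult_left_le_one_le)
  then have "eventually (\<lambda>(k, N). norm (q k N) \<le> norm (c (int_decode k))) (at_top \<times>\<^sub>F sequentially)"
    by (intro always_eventually) auto
  from tannerys_theorem[OF lim this sum]
  have "(\<lambda>N. \<Sum>k. q k N) \<longlonglongrightarrow> (\<Sum>n. c (int_decode n))" by simp
  moreover have "eventually (\<lambda>N. (\<Sum>k. q k N) = fejer_mean N c) sequentially"
    using eventually_gt_at_top[of 0] by eventually_elim (simp add: eq)
  ultimately show ?thesis by (rule Lim_transform_eventually)
qed

text \<open>
Every weight is non-negative and the weight of the term \<open>m\<close> tends to \<open>1\<close>.
\<close>
lemma fejer_mean_limit_ge_term: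
  assumes lim: "(\<lambda>N. fejer_mean N c) \<longlonglongrightarrow> s" and nn: "\<And>n. 0 \<le> Re (c n)"
  shows "Re (c m) \<le> Re s"
proof (rule tendsto_le[OF _ tendsto_Re[OF lim]])
  have "(\<lambda>N. 1 - real_of_int \<bar>m\<bar> / real N) \<longlonglongrightarrow> 1 - 0"
    by (intro tendsto_intros lim_const_over_n)
  from tendsto_mult[OF this tendsto_const[of "Re (c m)"]]
  show "(\<lambda>N. (1 - real_of_int \<bar>m\<bar> / real N) * Re (c m)) \<longlonglongrightarrow> Re (c m)" by simp
  show "\<forall>\<^sub>F N in sequentially. (1 - real_of_int \<bar>m\<bar> / real N) * Re (c m) \<le> Re (fejer_mean N c)"
    using eventually_gt_at_top[of "nat \<bar>m\<bar>"]
  proof eventually_elim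
    case (elim N)
    have "(1 - real_of_int \<bar>m\<bar> / real N) * Re (c m) \<le> (\<Sum>n\<in>{- int N<..<int N}. (1 - real_of_int \<bar>n\<bar> / real N) * Re (c n))"
    proof (rule member_le_sum)
      show "m \<in> {- int N<..<int N}" using elim by auto
      show "0 \<le> (1 - real_of_int \<bar>n\<bar> / real N) * Re (c n)" if "n \<in> {- int N<..<int N} - {m}" for n
        using that nn[of n] by (intro mult_nonneg_nonneg) (auto simp: field_simps)
    qed simp
    also have "\<dots> = Re (fejer_mean N c)"
      using elim by (subst fejer_mean_weights) auto
    finally show ?case .
  qed
qed simp

lemma alternating_sum_nonpos:
  fixes a :: "nat \<Rightarrow> real"
  assumes "\<And>n. 0 \<le> a n" "\<And>n. 1 \<le> n \<Longrightarrow> a (Suc n) \<le> a n"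
  shows "(\<Sum>i<m. (-1) ^ Suc i * a (Suc i)) \<le> 0"
proof -
  \<comment> \<open>The induction needs the stronger bound \<open>- a m\<close> for odd \<open>m\<close>.\<close>
  have "(even m \<longrightarrow> (\<Sum>i<m. (-1) ^ Suc i * a (Suc i)) \<le> 0) \<and> (odd m \<longrightarrow> (\<Sum>i<m. (-1) ^ Suc i * a (Suc i)) \<le> - a m)"
  proof (induction m)
    case (Suc m)
    then show ?case using assms(2)[of m] by (cases "even m") (auto elim: oddE)
  qed simp
  then show ?thesis using assms(1)[of m] by (cases "even m") auto
qed

text \<open>
In the row \<open>j\<close> of the double sum the diagonal entry is \<open>a 0\<close>, and the entries on either side of it form
alternating sums that start with \<open>- a 1\<close>. In \<open>fejer_integral_le\<close> the value
\<open>a 0\<close> has a different origin than the others, so monotonicity starts at the index \<open>1\<close>.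
\<close>
lemma fejer_mean_alternating_le:
  fixes a :: "nat \<Rightarrow> real"
  assumes a: "\<And>n. 0 \<le> a n" "\<And>n. 1 \<le> n \<Longrightarrow> a (Suc n) \<le> a n" and N: "0 < N"
    and c: "\<And>n. c n = of_real ((-1) ^ nat \<bar>n\<bar> * a (nat \<bar>n\<bar>))"
  shows "Re (fejer_mean N c) \<le> a 0"
proof -
  define t where "t = (\<lambda>n. (-1) ^ n * a n)"
  have row: "(\<Sum>k<N. t (nat \<bar>int j - int k\<bar>)) \<le> a 0" if j: "j < N" for j
  proof -
    have split: "{..<N} = {..<j} \<union> ({j} \<union> {Suc j..<N})" using j by auto
    have "(\<Sum>k<N. t (nat \<bar>int j - int k\<bar>)) = (\<Sum>k<j. t (nat \<bar>int j - int k\<bar>)) + (t 0 + (\<Sum>k\<in>{Suc j..<N}. t (nat \<bar>int j - int k\<bar>)))"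
      unfolding split by (subst sum.union_disjoint) auto
    also have "(\<Sum>k<j. t (nat \<bar>int j - int k\<bar>)) = (\<Sum>i<j. t (Suc i))"
      by (rule sum.reindex_bij_witness[of _ "\<lambda>i. j - Suc i" "\<lambda>k. j - Suc k"]) (auto simp: nat_diff_distrib' of_nat_diff intro!: arg_cong[where f=t])
    also have "(\<Sum>k\<in>{Suc j..<N}. t (nat \<bar>int j - int k\<bar>)) = (\<Sum>i<N - Suc j. t (Suc i))"
      by (rule sum.reindex_bij_witness[of _ "\<lambda>i. i + Suc j" "\<lambda>k. k - Suc j"]) (auto intro!: arg_cong[where f=t])
    finally show ?thesis
      using alternating_sum_nonpos[of a j, OF a] alternating_sum_nonpos[of a "N - Suc j", OF a]
      by (simp add: t_def)
  qed
  have "Re (fejer_mean N c) = (\<Sum>j<N. \<Sum>k<N. t (nat \<bar>int j - int k\<bar>)) / real N"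
    by (simp add: fejer_mean_def c t_def Re_divide_of_nat)
  also have "\<dots> \<le> (\<Sum>j<N. a 0) / real N"
    by (intro divide_right_mono sum_mono row) auto
  finally show ?thesis using N by simp
qed

text \<open>
Positivity allows all but a small neighbourhood of \<open>x + m\<close> to be dropped from the integral, and there
the kernel is an approximate identity.
\<close>
lemma fejer_lower_bound:
  fixes h :: "real \<Rightarrow> real"
  assumes int: "integrable lborel h" and nn: "AE y in lborel. 0 \<le> h y" and cont: "isCont h (x + of_int m)"
    and lim: "(\<lambda>N. \<integral>y. h y * fejer_kernel N (y - x) \<partial>lborel) \<longlonglongrightarrow> L"
  shows "h (x + of_int m) \<le> L"
proof -
  define z where "z = x + of_int m"
  have [measurable]: "h \<in> borel_measurable borel" using int by auto
  obtain d0 where d0: "0 < d0" "\<And>y. \<bar>y - z\<bar> < d0 \<Longrightarrow> \<bar>h y - h z\<bar> < 1"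
    using cont unfolding continuous_at_eps_delta dist_norm z_def real_norm_def by (metis zero_less_one)
  define d where "d = min d0 (1/2)"
  have d: "0 < d" "d \<le> 1/2" "\<And>y. \<bar>y - z\<bar> < d \<Longrightarrow> \<bar>h y - h z\<bar> < 1" using d0 by (auto simp: d_def)
  \<comment> \<open>Outside this neighbourhood \<open>h\<close> may be unbounded; the cut-off makes the approximate identity
    applicable.\<close>
  define P where "P = (\<lambda>u. h (z + u) * indicator {-d<..<d} u)"
  define Q where "Q = (\<lambda>N. \<integral>u. P u * fejer_kernel N u \<partial>lborel)"
  have P_meas [measurable]: "P \<in> borel_measurable borel" unfolding P_def by measurable
  have P_bd: "\<bar>P u\<bar> \<le> \<bar>h z\<bar> + 1" for u
    using d(3)[of "z + u"] by (cases "u \<in> {-d<..<d}") (auto simp: P_def abs_less_iff)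
  have "isCont P 0"
  proof -
    have c: "isCont (\<lambda>u. h (z + u)) 0" using cont
      by (intro isCont_o2[where g=h and f="\<lambda>u. z + u"]) (auto simp: z_def intro!: continuous_intros)
    have "\<forall>\<^sub>F u in nhds 0. u \<in> {-d<..<d}" using d by (intro eventually_nhds_in_open) auto
    then have "\<forall>\<^sub>F u in nhds 0. h (z + u) = P u" by eventually_elim (simp add: P_def)
    then show ?thesis using c isCont_cong by metis
  qed
  then have "(\<lambda>N. \<integral>u. indicator unit_cell u *\<^sub>R (complex_of_real (P u) * of_real (fejer_kernel N u)) \<partial>lborel) \<longlonglongrightarrow> of_real (P 0)"
    by (intro fejer_approximate_identity[where B="\<bar>h z\<bar> + 1"]) (use P_bd in \<open>auto intro: continuous_intros\<close>)
  moreover have "(\<integral>u. indicator unit_cell u *\<^sub>R (complex_of_real (P u) * of_real (fejer_kernel N u)) \<partial>lborel) = of_real (Q N)" for N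
  proof -
    have "indicator unit_cell u *\<^sub>R (complex_of_real (P u) * of_real (fejer_kernel N u)) = of_real (P u * fejer_kernel N u)" for u
      using d(2) by (auto simp: P_def split: split_indicator)
    then show ?thesis by (simp add: Q_def integral_complex_of_real del: of_real_mult)
  qed
  ultimately have "(\<lambda>N. complex_of_real (Q N)) \<longlonglongrightarrow> of_real (P 0)" by simp
  then have limQ: "Q \<longlonglongrightarrow> P 0" by (simp add: tendsto_of_real_iff)
  have "P 0 \<le> L"
  proof (rule LIMSEQ_le[OF limQ lim], intro exI allI impI)
    fix N
    have ihK: "integrable lborel (\<lambda>y. h y * fejer_kernel N (y - x))"
    proof (rule Bochner_Integration.integrable_bound)
      show "integrable lborel (\<lambda>y. h y * real N)" using int by simp
      show "AE y in lborel. norm (h y * fejer_kernel N (y - x)) \<le> norm (h y * real N)"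
        using fejer_kernel_le fejer_kernel_nonneg by (intro AE_I2) (auto simp: abs_mult intro!: mult_left_mono)
    qed measurable
    have "Q N = (\<integral>y. P (y - z) * fejer_kernel N (y - x) \<partial>lborel)"
      unfolding Q_def
    proof (subst (2) lborel_integral_real_affine[where c=1 and t=z])
      have "fejer_kernel N (z + u - x) = fejer_kernel N u" for u
        using fejer_kernel_periodic[of N m u] by (simp add: z_def add.commute)
      then show "(\<integral>u. P u * fejer_kernel N u \<partial>lborel)
        = \<bar>1\<bar> *\<^sub>R (\<integral>u. P (z + 1 * u - z) * fejer_kernel N (z + 1 * u - x) \<partial>lborel)"
        by simp
    qed simp
    also have "\<dots> \<le> (\<integral>y. h y * fejer_kernel N (y - x) \<partial>lborel)"
    proof (rule integral_mono_AE')
      show "integrable lborel (\<lambda>y. h y * fejer_kernel N (y - x))" by (rule ihK)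
      show "AE y in lborel. P (y - z) * fejer_kernel N (y - x) \<le> h y * fejer_kernel N (y - x)"
        using nn by eventually_elim (auto simp: P_def fejer_kernel_nonneg intro!: mult_right_mono split: split_indicator)
      show "AE y in lborel. 0 \<le> h y * fejer_kernel N (y - x)"
        using nn by eventually_elim (simp add: fejer_kernel_nonneg)
    qed
    finally show "Q N \<le> (\<integral>y. h y * fejer_kernel N (y - x) \<partial>lborel)" .
  qed
  then show ?thesis using d by (simp add: P_def z_def)
qed

section \<open>Continuity, entire functions and derivatives of transforms\<close>

text \<open>
The exceptional set inside \<open>U\<close> is open and null, hence empty. With \<open>C\<close> a point, a half-line or the real
axis this turns almost everywhere statements about continuous functions into pointwise ones.
\<close>
lemma continuous_AE_closed:
  fixes h :: "real \<Rightarrow> 'b :: topological_space"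
  assumes U: "open U" and cont: "continuous_on U h" and C: "closed C"
    and ae: "AE x in lborel. x \<in> U \<longrightarrow> h x \<in> C" and x: "x \<in> U"
  shows "h x \<in> C"
proof -
  define V where "V = h -` (- C) \<inter> U"
  have V: "open V"
    using continuous_on_open_vimage[OF U, THEN iffD1, rule_format, OF cont] C by (simp add: V_def open_Compl)
  have eqV: "{x \<in> space lborel. \<not> (x \<in> U \<longrightarrow> h x \<in> C)} = V" by (auto simp: V_def)
  have "V \<in> sets lborel" using V by simp
  then have "V \<in> null_sets lborel"
    using ae AE_iff_null[of lborel "\<lambda>x. x \<in> U \<longrightarrow> h x \<in> C"] unfolding eqV by blast
  then have "negligible V" by (simp add: negligible_iff_null_sets null_sets_completionI)
  then have "V = {}" using open_not_negligible[OF V] by blast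
  then show ?thesis using x by (auto simp: V_def)
qed

lemma continuous_AE_eq:
  fixes f g :: "real \<Rightarrow> complex"
  assumes "continuous_on UNIV f" "continuous_on UNIV g" "AE x in lborel. f x = g x"
  shows "f x = g x"
proof -
  have "(\<lambda>x. f x - g x) x \<in> {0}"
    by (rule continuous_AE_closed[where U=UNIV]) (use assms in \<open>auto intro!: continuous_intros\<close>)
  then show ?thesis by simp
qed

lemma entire_eq_if_eq_on_reals:
  assumes "f holomorphic_on UNIV" "g holomorphic_on UNIV" "\<And>x::real. f (of_real x) = g (of_real x)"
  shows "f = g"
proof
  fix w
  have "f w - g w = 0"
  proof (rule analytic_continuation[where f="\<lambda>z. f z - g z" and S=UNIV and U="range complex_of_real" and \<xi>=0])
    show "(0::complex) islimpt range complex_of_real"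
    proof (rule islimpt_sequential[THEN iffD2], intro exI conjI allI)
      show "(\<lambda>n. complex_of_real (1 / real (Suc n))) \<longlonglongrightarrow> 0"
        using tendsto_of_real[OF LIMSEQ_Suc[OF lim_1_over_n], where 'a=complex] by simp
      show "complex_of_real (1 / real (Suc n)) \<in> range complex_of_real - {0}" for n
        by (simp del: of_real_divide of_real_add of_real_of_nat_eq)
    qed
  qed (use assms in \<open>auto intro!: holomorphic_intros\<close>)
  then show "f w = g w" by simp
qed

lemma norm_e2pi_diff_le: "norm (e2pi a - e2pi b) \<le> 2 * pi * \<bar>a - b\<bar>"
proof -
  have "e2pi a - e2pi b = e2pi b * (e2pi (a - b) - 1)"
    using e2pi_add[of b "a - b"] by (simp add: algebra_simps)
  moreover have "norm (e2pi (a - b) - 1) \<le> \<bar>2 * pi * (a - b)\<bar>"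
    using iexp_approx1[of "2 * pi * (a - b)" 0] by (simp add: e2pi_exp mult_ac)
  ultimately show ?thesis by (simp add: norm_mult abs_mult)
qed

lemma e2pi_has_vector_derivative:
  "((\<lambda>x. e2pi (c * x)) has_vector_derivative (2 * of_real pi * \<i> * of_real c * e2pi (c * x))) (at x within S)"
proof -
  have "((\<lambda>z. exp (2 * of_real pi * \<i> * of_real c * z)) has_field_derivative
     2 * of_real pi * \<i> * of_real c * exp (2 * of_real pi * \<i> * of_real c * of_real x)) (at (of_real x))"
    by (auto intro!: derivative_eq_intros)
  from has_vector_derivative_real_field[OF this, of S] show ?thesis
    by (simp add: e2pi_exp mult_ac)
qed

lemma has_vector_derivative_iff_quotient:
  fixes f :: "real \<Rightarrow> 'b :: real_normed_vector"
  shows "(f has_vector_derivative f') (at x) \<longleftrightarrow> ((\<lambda>h. (f (x + h) - f x) /\<^sub>R h) \<longlongrightarrow> f') (at 0)"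
proof -
  have eq: "norm (f (x + h) - f x - h *\<^sub>R f') / norm h = norm ((f (x + h) - f x) /\<^sub>R h - f')" if "h \<noteq> 0" for h
  proof -
    have "(f (x + h) - f x) /\<^sub>R h - f' = (f (x + h) - f x - h *\<^sub>R f') /\<^sub>R h"
      using that by (simp add: scaleR_diff_right)
    then show ?thesis by (simp add: divide_inverse mult.commute)
  qed
  have "((\<lambda>h. norm (f (x + h) - f x - h *\<^sub>R f') / norm h) \<longlongrightarrow> 0) (at 0) \<longleftrightarrow>
      ((\<lambda>h. norm ((f (x + h) - f x) /\<^sub>R h - f')) \<longlongrightarrow> 0) (at 0)"
    by (rule tendsto_cong) (unfold eventually_at_filter, rule always_eventually, use eq in blast)
  also have "\<dots> \<longleftrightarrow> ((\<lambda>h. (f (x + h) - f x) /\<^sub>R h) \<longlongrightarrow> f') (at 0)"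
    by (simp add: tendsto_norm_zero_iff LIM_zero_iff)
  finally show ?thesis
    unfolding has_vector_derivative_def has_derivative_at by (simp add: bounded_linear_scaleR_left)
qed

lemma fourier_has_vector_derivative:
  assumes f: "integrable lborel f" and xf: "integrable lborel (\<lambda>x. of_real x * f x)"
  shows "(fourier f has_vector_derivative fourier (\<lambda>x. - 2 * of_real pi * \<i> * (of_real x * f x)) y) (at y)"
proof -
  have [measurable]: "f \<in> borel_measurable borel" using f by auto
  define q where "q = (\<lambda>h x. f x * ((e2pi (- (x * (y + h))) - e2pi (- (x * y))) / of_real h))"
  have iq: "integrable lborel (\<lambda>x. f x * e2pi (- (x * z)))" for z
    using integrable_mult_e2pi[OF f, of "-z" 0] by (simp add: mult.commute)
  have quot: "(fourier f (y + h) - fourier f y) / of_real h = (\<integral>x. q h x \<partial>lborel)" if "h \<noteq> 0" for h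
    unfolding fourier_e2pi q_def using iq[of "y+h"] iq[of y]
    by (subst Bochner_Integration.integral_diff[symmetric]) (auto simp: algebra_simps diff_divide_distrib)
  have qlim: "((\<lambda>h. q h x) \<longlongrightarrow> f x * (2 * of_real pi * \<i> * of_real (- x) * e2pi (- (x * y)))) (at 0)" for x
  proof -
    have "((\<lambda>z. e2pi ((-x) * z)) has_vector_derivative (2 * of_real pi * \<i> * of_real (- x) * e2pi ((-x) * y))) (at y)"
      by (rule e2pi_has_vector_derivative)
    then have "((\<lambda>h. (e2pi (- (x * (y + h))) - e2pi (- (x * y))) /\<^sub>R h) \<longlongrightarrow> 2 * of_real pi * \<i> * of_real (- x) * e2pi (- (x * y))) (at 0)"
      unfolding has_vector_derivative_iff_quotient by simp
    then show ?thesis unfolding q_def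
      by (intro tendsto_intros) (simp add: scaleR_conv_of_real divide_inverse mult.commute)
  qed
  have qbd: "norm (q h x) \<le> 2 * pi * norm (of_real x * f x)" if "h \<noteq> 0" for h x
  proof -
    have "norm (e2pi (- (x * (y + h))) - e2pi (- (x * y))) \<le> 2 * pi * \<bar>x\<bar> * \<bar>h\<bar>"
    proof -
      have "\<bar>- (x * (y + h)) - - (x * y)\<bar> = \<bar>x\<bar> * \<bar>h\<bar>" by (simp add: algebra_simps flip: abs_mult)
      then show ?thesis
        using norm_e2pi_diff_le[of "- (x * (y + h))" "- (x * y)"] by (simp only: mult.assoc)
    qed
    then have "norm ((e2pi (- (x * (y + h))) - e2pi (- (x * y))) / of_real h) \<le> 2 * pi * \<bar>x\<bar>"
      using that by (simp add: norm_divide divide_le_eq)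
    then have "norm (f x) * norm ((e2pi (- (x * (y + h))) - e2pi (- (x * y))) / of_real h) \<le> norm (f x) * (2 * pi * \<bar>x\<bar>)"
      by (rule mult_left_mono) simp
    then show ?thesis unfolding q_def norm_mult[of "f x"] by (simp add: norm_mult mult_ac)
  qed
  have "((\<lambda>h. \<integral>x. q h x \<partial>lborel) \<longlongrightarrow> (\<integral>x. f x * (2 * of_real pi * \<i> * of_real (- x) * e2pi (- (x * y))) \<partial>lborel)) (at 0)"
    unfolding tendsto_at_iff_sequentially o_def
  proof (intro allI impI)
    fix X assume X: "\<forall>i. X i \<in> UNIV - {0::real}" "X \<longlonglongrightarrow> 0"
    show "(\<lambda>i. \<integral>x. q (X i) x \<partial>lborel) \<longlonglongrightarrow> (\<integral>x. f x * (2 * of_real pi * \<i> * of_real (- x) * e2pi (- (x * y))) \<partial>lborel)"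
    proof (rule integral_dominated_convergence[where w="\<lambda>x. 2 * pi * norm (of_real x * f x)"])
      show "integrable lborel (\<lambda>x. 2 * pi * norm (complex_of_real x * f x))"
        using xf by (intro integrable_mult_right integrable_norm)
      show "AE x in lborel. (\<lambda>i. q (X i) x) \<longlonglongrightarrow> f x * (2 * of_real pi * \<i> * of_real (- x) * e2pi (- (x * y)))"
        using qlim X by (intro AE_I2) (simp add: tendsto_at_iff_sequentially o_def)
      show "AE x in lborel. norm (q (X i) x) \<le> 2 * pi * norm (complex_of_real x * f x)" for i
        using qbd X by (intro AE_I2) auto
    qed (auto simp: q_def)
  qed
  moreover have "\<forall>\<^sub>F h in at 0. (\<integral>x. q h x \<partial>lborel) = (fourier f (y + h) - fourier f y) /\<^sub>R h"
    unfolding eventually_at_filter using quot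
    by (intro always_eventually) (auto simp: scaleR_conv_of_real divide_inverse mult.commute)
  moreover have "(\<integral>x. f x * (2 * of_real pi * \<i> * of_real (- x) * e2pi (- (x * y))) \<partial>lborel) = fourier (\<lambda>x. - 2 * of_real pi * \<i> * (of_real x * f x)) y"
    unfolding fourier_e2pi by (intro Bochner_Integration.integral_cong refl) (simp add: mult_ac)
  ultimately have "((\<lambda>h. (fourier f (y + h) - fourier f y) /\<^sub>R h) \<longlongrightarrow> fourier (\<lambda>x. - 2 * of_real pi * \<i> * (of_real x * f x)) y) (at 0)"
    by (simp add: Lim_transform_eventually)
  then show ?thesis by (simp add: has_vector_derivative_iff_quotient)
qed

section \<open>Band-limited functions and their samples at half-integers\<close>

lemma fejer_mean_cong: "(\<And>n. c n = d n) \<Longrightarrow> fejer_mean N c = fejer_mean N d"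
  by (simp add: fejer_mean_def)

lemma integrable_compact_support:
  fixes f :: "real \<Rightarrow> complex"
  assumes "continuous_on UNIV f" "\<And>t. R < \<bar>t\<bar> \<Longrightarrow> f t = 0"
  shows "integrable lborel f"
proof -
  have "integrable lborel (\<lambda>t. indicator {-R..R} t *\<^sub>R f t)"
    by (rule borel_integrable_compact) (use assms(1) continuous_on_subset in auto)
  also have "(\<lambda>t. indicator {-R..R} t *\<^sub>R f t) = f"
    using assms(2) by (force simp: abs_le_iff split: split_indicator)
  finally show ?thesis .
qed

text \<open>
For \<open>f\<close> supported in \<open>[-1, 1]\<close> only the translates by \<open>0\<close> and \<open>-1\<close> meet a point of \<open>[0, 1)\<close>.
\<close>
lemma fejer_compact_support:
  fixes f :: "real \<Rightarrow> complex"
  assumes cont: "continuous_on UNIV f" and supp: "\<And>t. 1 \<le> \<bar>t\<bar> \<Longrightarrow> f t = 0" and x: "0 \<le> x" "x < 1"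
  shows "(\<lambda>N. fejer_mean N (\<lambda>n. fourier f (of_int n) * e2pi (of_int n * x))) \<longlonglongrightarrow> f x + f (x - 1)"
proof -
  have "compact (f ` {-1..1})"
    by (intro compact_continuous_image continuous_on_subset[OF cont]) auto
  then obtain B where B: "\<And>t. t \<in> {-1..1} \<Longrightarrow> norm (f t) \<le> B"
    using compact_imp_bounded[of "f ` {-1..1}"] unfolding bounded_iff by blast
  have B0: "0 \<le> B" using B[of 0] by (auto intro: order_trans[OF norm_ge_zero])
  define \<beta> where "\<beta> = (\<lambda>m::int. if \<bar>m\<bar> \<le> 2 then B else 0)"
  have fB: "norm (f t) \<le> B" for t using B[of t] supp[of t] B0 by (cases "\<bar>t\<bar> \<le> 1") (auto simp: abs_le_iff)
  have bd: "norm (f (x + (of_int m + u))) \<le> \<beta> m" if u: "u \<in> unit_cell" for m u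
  proof (cases "\<bar>m\<bar> \<le> 2")
    case True then show ?thesis using fB by (simp add: \<beta>_def)
  next
    case False
    then have "m \<le> -3 \<or> 3 \<le> m" by linarith
    then have "real_of_int m \<le> -3 \<or> 3 \<le> real_of_int m"
      using of_int_le_iff[of m "-3", where 'a=real] of_int_le_iff[of 3 m, where 'a=real] by simp
    moreover have "-1/2 \<le> u" "u < 1/2" using u by auto
    ultimately have "1 \<le> \<bar>x + (of_int m + u)\<bar>" using x by linarith
    then show ?thesis by (simp add: supp \<beta>_def B0)
  qed
  have sum: "summable (\<lambda>n. \<beta> (int_decode n))"
  proof (rule summable_finite)
    show "finite (int_encode ` {-2..2})" by simp
    fix n assume "n \<notin> int_encode ` {-2..2}"
    then have "int_decode n \<notin> {-2..2}" by (metis image_eqI int_decode_inverse)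
    then show "\<beta> (int_decode n) = 0" by (auto simp: \<beta>_def abs_le_iff)
  qed
  have "(\<Sum>n. f (x + of_int (int_decode n))) = (\<Sum>n\<in>int_encode ` {0, -1}. f (x + of_int (int_decode n)))"
  proof (rule suminf_finite)
    fix n assume "n \<notin> int_encode ` {0, -1}"
    then have "int_decode n \<notin> {0, -1}" by (metis image_eqI int_decode_inverse)
    then have "1 \<le> int_decode n \<or> int_decode n \<le> -2" by auto
    then have "1 \<le> real_of_int (int_decode n) \<or> real_of_int (int_decode n) \<le> -2"
      using of_int_le_iff[of "int_decode n" "-2", where 'a=real] of_int_le_iff[of 1 "int_decode n", where 'a=real] by simp
    then show "f (x + of_int (int_decode n)) = 0" using x by (intro supp) linarith
  qed simp
  also have "\<dots> = f x + f (x - 1)"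
    by (subst sum.reindex[OF inj_int_encode]) simp
  finally show ?thesis
    using fejer_poisson(2)[OF cont bd sum] by simp
qed

locale bandlimited =
  fixes D :: "complex \<Rightarrow> complex"
  assumes entire: "D holomorphic_on UNIV" and type: "exponential_type (2 * pi) D"
    and int: "integrable lborel (\<lambda>x. D (of_real x))"
begin

definition spectrum :: "real \<Rightarrow> complex" where "spectrum = fourier (\<lambda>x. D (of_real x))"

lemma spectrum_continuous: "continuous_on A spectrum"
  unfolding spectrum_def by (rule continuous_on_fourier[OF int])

lemma spectrum_eq_0: assumes "1 \<le> \<bar>t\<bar>" shows "spectrum t = 0"
proof -
  have out: "spectrum s = 0" if "1 < \<bar>s\<bar>" for s
    unfolding spectrum_def using that by (intro paley_wiener_L1[OF entire type _ int]) auto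
  define u where "u = (\<lambda>n. t * (1 + 1 / real (Suc n)))"
  have "u \<longlonglongrightarrow> t * (1 + 0)" unfolding u_def by (intro tendsto_intros LIMSEQ_Suc[OF lim_1_over_n])
  then have "u \<longlonglongrightarrow> t" by simp
  moreover have "isCont spectrum t"
    using spectrum_continuous[of UNIV] by (simp add: continuous_on_eq_continuous_at)
  ultimately have "(\<lambda>n. spectrum (u n)) \<longlonglongrightarrow> spectrum t" by (rule isCont_tendsto_compose[rotated])
  moreover have "spectrum (u n) = 0" for n
  proof (rule out)
    have "1 < 1 * (1 + 1 / real (Suc n))" by simp
    also have "\<dots> \<le> \<bar>t\<bar> * (1 + 1 / real (Suc n))" by (intro mult_right_mono assms) simp
    also have "\<dots> = \<bar>u n\<bar>" unfolding u_def abs_mult by simp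
    finally show "1 < \<bar>u n\<bar>" .
  qed
  ultimately show ?thesis by (simp add: LIMSEQ_const_iff)
qed

lemma spectrum_times_integrable:
  assumes "continuous_on UNIV h" shows "integrable lborel (\<lambda>t. h t * spectrum t)"
  by (rule integrable_compact_support[where R=1])
     (use assms spectrum_eq_0 in \<open>auto intro!: continuous_intros spectrum_continuous\<close>)

lemma spectrum_integrable: "integrable lborel spectrum"
  using spectrum_times_integrable[of "\<lambda>_. 1"] by simp

lemma inversion: "D (of_real x) = fourier spectrum (- x)"
proof (rule continuous_AE_eq[where f="\<lambda>x. D (of_real x)" and g="\<lambda>x. fourier spectrum (- x)"])
  show "continuous_on UNIV (\<lambda>x::real. D (of_real x))"
    by (rule continuous_on_real_restriction[OF entire])
  show "continuous_on UNIV (\<lambda>x. fourier spectrum (- x))"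
    by (rule continuous_on_compose2[OF continuous_on_fourier[OF spectrum_integrable]]) (auto intro!: continuous_intros)
  show "AE x in lborel. D (of_real x) = fourier spectrum (- x)"
    using fourier_inversion[OF int] spectrum_integrable by (simp add: spectrum_def)
qed

text \<open>
Differentiation under the integral sign, as the spectrum has compact support.
\<close>
lemma deriv_inversion: "deriv D (of_real x) = 2 * of_real pi * \<i> * fourier (\<lambda>t. of_real t * spectrum t) (- x)"
proof -
  have "((\<lambda>x. D (of_real x)) has_vector_derivative deriv D (of_real x)) (at x)"
    by (rule real_restriction_has_derivative[OF entire])
  moreover have "((\<lambda>x. fourier spectrum (- x)) has_vector_derivative
     (-1) *\<^sub>R fourier (\<lambda>x. - 2 * of_real pi * \<i> * (of_real x * spectrum x)) (- x)) (at x)"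
  proof (rule vector_diff_chain_at[where f=uminus and g="fourier spectrum", unfolded o_def])
    show "(uminus has_vector_derivative - 1) (at x)"
      by (auto intro!: derivative_eq_intros)
    show "(fourier spectrum has_vector_derivative fourier (\<lambda>x. - 2 * of_real pi * \<i> * (of_real x * spectrum x)) (- x)) (at (- x))"
      by (intro fourier_has_vector_derivative spectrum_integrable spectrum_times_integrable continuous_intros)
  qed
  ultimately have "deriv D (of_real x) = (-1) *\<^sub>R fourier (\<lambda>x. - 2 * of_real pi * \<i> * (of_real x * spectrum x)) (- x)"
    unfolding inversion[abs_def] by (rule vector_derivative_unique_at)
  also have "\<dots> = 2 * of_real pi * \<i> * fourier (\<lambda>t. of_real t * spectrum t) (- x)"
    by (simp add: fourier_e2pi mult.assoc)
  finally show ?thesis .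
qed

text \<open>
The twist moves the sample points from \<open>\<int>\<close> to \<open>\<int> + 1/2\<close>: the transform of \<open>twisted\<close> at the integers
consists of the values of \<open>D\<close> at the half-integers.
\<close>
definition twisted :: "real \<Rightarrow> complex" where "twisted t = e2pi (t / 2) * spectrum t"

lemma twisted_continuous: "continuous_on A twisted"
  unfolding twisted_def by (auto intro!: continuous_intros spectrum_continuous)

lemma twisted_eq_0: "1 \<le> \<bar>t\<bar> \<Longrightarrow> twisted t = 0"
  by (simp add: twisted_def spectrum_eq_0)

lemma fourier_twisted: "fourier twisted (of_int n) = D (of_real (1/2 - of_int n))"
  unfolding inversion twisted_def fourier_e2pi
  by (intro Bochner_Integration.integral_cong refl)
     (simp add: mult.commute[of "e2pi (x / 2)" for x] mult.assoc e2pi_add[symmetric] algebra_simps)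

lemma fourier_t_twisted:
  "fourier (\<lambda>t. of_real t * twisted t) (of_int n) = deriv D (of_real (1/2 - of_int n)) / (2 * of_real pi * \<i>)"
proof -
  have "fourier (\<lambda>t. of_real t * twisted t) (of_int n) = fourier (\<lambda>t. of_real t * spectrum t) (- (1/2 - of_int n))"
    unfolding twisted_def fourier_e2pi
    by (intro Bochner_Integration.integral_cong refl)
       (simp add: mult.commute[of "e2pi (x / 2)" for x] mult.assoc e2pi_add[symmetric] algebra_simps)
  then show ?thesis unfolding deriv_inversion by simp
qed

abbreviation value_mean :: "nat \<Rightarrow> real \<Rightarrow> complex" where
  "value_mean N x \<equiv> fejer_mean N (\<lambda>n. D (of_real (1/2 - of_int n)) * e2pi (of_int n * x))"

abbreviation slope_mean :: "nat \<Rightarrow> real \<Rightarrow> complex" where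
  "slope_mean N x \<equiv> fejer_mean N (\<lambda>n. deriv D (of_real (1/2 - of_int n)) / (2 * of_real pi * \<i>) * e2pi (of_int n * x))"

lemma value_mean_limit:
  assumes "0 \<le> x" "x < 1"
  shows "(\<lambda>N. value_mean N x) \<longlonglongrightarrow> twisted x + twisted (x - 1)"
  using fejer_compact_support[OF twisted_continuous twisted_eq_0 assms] by (simp add: fourier_twisted)

lemma slope_mean_limit:
  assumes "0 \<le> x" "x < 1"
  shows "(\<lambda>N. slope_mean N x) \<longlonglongrightarrow> of_real x * twisted x + of_real (x - 1) * twisted (x - 1)"
proof -
  have "(\<lambda>N. fejer_mean N (\<lambda>n. fourier (\<lambda>t. of_real t * twisted t) (of_int n) * e2pi (of_int n * x)))
      \<longlonglongrightarrow> of_real x * twisted x + of_real (x - 1) * twisted (x - 1)"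
    by (rule fejer_compact_support[OF _ _ assms]) (auto intro!: continuous_intros twisted_continuous simp: twisted_eq_0)
  then show ?thesis by (simp add: fourier_t_twisted)
qed

text \<open>
With \<open>f\<close> for the twisted spectrum, the two means converge to \<open>f(x) + f(x-1)\<close> and
\<open>x f(x) + (x-1) f(x-1)\<close>, two linear equations of determinant \<open>-1\<close>.
\<close>
lemma recover_twisted:
  assumes x: "0 \<le> x" "x < 1"
  shows "(\<lambda>N. slope_mean N x - of_real (x - 1) * value_mean N x) \<longlonglongrightarrow> twisted x"
    and "(\<lambda>N. of_real x * value_mean N x - slope_mean N x) \<longlonglongrightarrow> twisted (x - 1)"
proof -
  have "(\<lambda>N. slope_mean N x - of_real (x - 1) * value_mean N x)
     \<longlonglongrightarrow> (of_real x * twisted x + of_real (x - 1) * twisted (x - 1)) - of_real (x - 1) * (twisted x + twisted (x - 1))"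
    by (intro tendsto_intros value_mean_limit slope_mean_limit x)
  then show "(\<lambda>N. slope_mean N x - of_real (x - 1) * value_mean N x) \<longlonglongrightarrow> twisted x"
    by (simp add: algebra_simps)
  have "(\<lambda>N. of_real x * value_mean N x - slope_mean N x)
     \<longlonglongrightarrow> of_real x * (twisted x + twisted (x - 1)) - (of_real x * twisted x + of_real (x - 1) * twisted (x - 1))"
    by (intro tendsto_intros value_mean_limit slope_mean_limit x)
  then show "(\<lambda>N. of_real x * value_mean N x - slope_mean N x) \<longlonglongrightarrow> twisted (x - 1)"
    by (simp add: algebra_simps)
qed

lemma integral_eq_twisted: "(\<integral>x. D (of_real x) \<partial>lborel) = twisted 0"
  by (simp add: twisted_def spectrum_def fourier_e2pi)

lemma sample_mean_limit: "(\<lambda>N. fejer_mean N (\<lambda>n. D (of_real (1/2 - of_int n)))) \<longlonglongrightarrow> (\<integral>x. D (of_real x) \<partial>lborel)"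
  using value_mean_limit[of 0] by (simp add: integral_eq_twisted twisted_eq_0)

text \<open>
The means are dominated by any single sample, since all samples are non-positive.
\<close>
lemma integral_le_sample:
  assumes "\<And>n::int. Re (D (of_real (of_int n + 1/2))) \<le> 0"
  shows "Re (\<integral>x. D (of_real x) \<partial>lborel) \<le> Re (D (of_real (of_int m + 1/2)))"
proof -
  have "(\<lambda>N. fejer_mean N (\<lambda>n. - D (of_real (1/2 - of_int n)))) \<longlonglongrightarrow> - (\<integral>x. D (of_real x) \<partial>lborel)"
    using tendsto_minus[OF sample_mean_limit] by (simp add: fejer_mean_def sum_negf)
  then have "Re (- D (of_real (1/2 - of_int (- m)))) \<le> Re (- (\<integral>x. D (of_real x) \<partial>lborel))"
  proof (rule fejer_mean_limit_ge_term)
    fix n show "0 \<le> Re (- D (of_real (1/2 - of_int n)))" using assms[of "- n"] by simp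
  qed
  then show ?thesis by (simp add: add.commute)
qed

lemma eq_0_if_double_zeros:
  assumes v: "\<And>n::int. D (of_real (of_int n + 1/2)) = 0" and d: "\<And>n::int. deriv D (of_real (of_int n + 1/2)) = 0"
  shows "D = (\<lambda>_. 0)"
proof -
  have v': "D (of_real (1/2 - of_int n)) = 0" and d': "deriv D (of_real (1/2 - of_int n)) = 0" for n
    using v[of "- n"] d[of "- n"] by (simp_all add: add.commute)
  have z: "fejer_mean N (\<lambda>n. 0) = 0" for N by (simp add: fejer_mean_def)
  have t01: "twisted x = 0" "twisted (x - 1) = 0" if "0 \<le> x" "x < 1" for x
    using recover_twisted[OF that] unfolding v' d' by (simp_all add: z LIMSEQ_const_iff)
  have tw: "twisted t = 0" for t
    using t01(1)[of t] t01(2)[of "t + 1"] twisted_eq_0[of t] by (cases "1 \<le> \<bar>t\<bar>"; cases "0 \<le> t") auto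
  have "spectrum t = 0" for t
  proof -
    have "e2pi (t/2) \<noteq> 0" using norm_e2pi[of "t/2"] by (metis norm_zero zero_neq_one)
    then show ?thesis using tw[of t] by (simp add: twisted_def)
  qed
  then have "D (of_real x) = 0" for x
    unfolding inversion fourier_e2pi by simp
  then show ?thesis by (intro entire_eq_if_eq_on_reals[OF entire]) auto
qed

end

section \<open>Smooth bump functions\<close>

text \<open>
The functions that occur as derivatives of the standard flat function \<open>exp (-1/y)\<close>, extended by \<open>0\<close>.
\<close>
definition flat_exp :: "nat \<Rightarrow> real \<Rightarrow> real" where
  "flat_exp m y = (if 0 < y then exp (- 1 / y) / y ^ m else 0)"

lemma flat_exp_nonneg: "0 \<le> flat_exp m y" by (simp add: flat_exp_def)

lemma flat_exp_shift: "flat_exp m y = y ^ k * flat_exp (m + k) y"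
  by (simp add: flat_exp_def power_add)

lemma power_le_fact_exp:
  fixes x :: real assumes "0 \<le> x" shows "x ^ n \<le> fact n * exp x"
proof -
  have "sum (\<lambda>k. inverse (fact k) * x ^ k) {n} \<le> (\<Sum>k. inverse (fact k) * x ^ k)"
    by (rule sum_le_suminf) (use assms summable_exp[of x] in auto)
  also have "\<dots> = exp x" by (simp add: exp_def)
  finally show ?thesis by (simp add: field_simps)
qed

text \<open>
The quadratic bound at the origin comes from \<open>x\<^sup>n \<le> n! e\<^sup>x\<close> at \<open>x = 1/y\<close>. It makes the derivative at \<open>0\<close>
vanish.
\<close>
lemma flat_exp_le: "flat_exp m y \<le> fact (m + 2) * y\<^sup>2"
proof (cases "0 < y")
  case True
  have "(1 / y) ^ (m + 2) \<le> fact (m + 2) * exp (1 / y)" using True by (intro power_le_fact_exp) simp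
  then have "(1 / y) ^ (m + 2) * (exp (- 1 / y) * y\<^sup>2) \<le> fact (m + 2) * exp (1 / y) * (exp (- 1 / y) * y\<^sup>2)"
    by (rule mult_right_mono) simp
  also have "\<dots> = fact (m + 2) * y\<^sup>2 * (exp (1 / y) * exp (- 1 / y))"
    by (simp only: mult_ac)
  also have "exp (1 / y) * exp (- 1 / y) = 1" by (simp flip: exp_add)
  finally have "(1 / y) ^ (m + 2) * (exp (- 1 / y) * y\<^sup>2) \<le> fact (m + 2) * y\<^sup>2"
    by (simp only: mult_1_right)
  moreover have "(1 / y) ^ (m + 2) * (exp (- 1 / y) * y\<^sup>2) = flat_exp m y"
    using True by (simp add: flat_exp_def power_add power_one_over field_simps power2_eq_square)
  ultimately show ?thesis by (simp only:)
qed (simp add: flat_exp_def)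

lemma flat_exp_has_derivative:
  "(flat_exp m has_real_derivative (flat_exp (m + 2) y - real m * flat_exp (m + 1) y)) (at y)"
proof -
  consider "0 < y" | "y < 0" | "y = 0" by linarith
  then show ?thesis
  proof cases
    case 1
    have "((\<lambda>y. exp (- 1 / y) / y ^ m) has_real_derivative
       (exp (- 1 / y) * (1 / y\<^sup>2) * y ^ m - exp (- 1 / y) * (real m * y ^ (m - 1))) / (y ^ m * y ^ m)) (at y)"
      using 1 by (auto intro!: derivative_eq_intros simp: power2_eq_square)
    moreover have "(exp (- 1 / y) * (1 / y\<^sup>2) * y ^ m - exp (- 1 / y) * (real m * y ^ (m - 1))) / (y ^ m * y ^ m)
        = flat_exp (m + 2) y - real m * flat_exp (m + 1) y"
      using 1 by (cases m) (simp_all add: flat_exp_def field_simps power2_eq_square)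
    ultimately have "((\<lambda>y. exp (- 1 / y) / y ^ m) has_real_derivative (flat_exp (m + 2) y - real m * flat_exp (m + 1) y)) (at y)"
      by simp
    then show ?thesis
      by (rule has_field_derivative_transform_within_open[where S="{0<..}"]) (use 1 in \<open>auto simp: flat_exp_def\<close>)
  next
    case 2
    have "((\<lambda>y. 0) has_real_derivative 0) (at y)" by simp
    then have "(flat_exp m has_real_derivative 0) (at y)"
      by (rule has_field_derivative_transform_within_open[where S="{..<0}"]) (use 2 in \<open>auto simp: flat_exp_def\<close>)
    then show ?thesis using 2 by (simp add: flat_exp_def)
  next
    case 3
    have "((\<lambda>h. (flat_exp m (0 + h) - flat_exp m 0) / h) \<longlongrightarrow> 0) (at 0)"
    proof (rule Lim_null_comparison)
      show "\<forall>\<^sub>F h in at 0. norm ((flat_exp m (0 + h) - flat_exp m 0) / h) \<le> fact (m + 2) * \<bar>h\<bar>"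
        unfolding eventually_at_filter
      proof (intro always_eventually allI impI)
        fix h :: real assume "h \<noteq> 0"
        define F :: real where "F = fact (m + 2)"
        have "\<bar>flat_exp m h\<bar> \<le> F * h\<^sup>2" using flat_exp_le[of m h] flat_exp_nonneg[of m h] by (simp add: F_def)
        then have "\<bar>flat_exp m h\<bar> \<le> F * \<bar>h\<bar> * \<bar>h\<bar>" by (simp add: power2_eq_square mult.assoc flip: abs_mult)
        then have "\<bar>flat_exp m h\<bar> / \<bar>h\<bar> \<le> F * \<bar>h\<bar>" using \<open>h \<noteq> 0\<close> by (simp add: pos_divide_le_eq)
        then show "norm ((flat_exp m (0 + h) - flat_exp m 0) / h) \<le> fact (m + 2) * \<bar>h\<bar>"
          unfolding F_def by (simp add: flat_exp_def[of m 0])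
      qed
      show "((\<lambda>h::real. fact (m + 2) * \<bar>h\<bar>) \<longlongrightarrow> 0) (at 0)"
        by (rule tendsto_eq_intros | simp)+
    qed
    then show ?thesis using 3 by (simp add: DERIV_def flat_exp_def[of _ 0])
  qed
qed

text \<open>
Smooth functions supported in \<open>[t - \<delta>, t + \<delta>]\<close>, in a shape that is closed under differentiation and
under multiplication by polynomials and, by the choice of \<open>c\<close>, admits modulated bumps.
\<close>
definition bump_space :: "real \<Rightarrow> real \<Rightarrow> complex \<Rightarrow> (real \<Rightarrow> complex) set" where
  "bump_space t \<delta> c = {f. \<exists>p m. f = (\<lambda>s. poly p (of_real ((s - t) / \<delta>)) *
      of_real (flat_exp m (1 - ((s - t) / \<delta>)\<^sup>2)) * exp (c * of_real ((s - t) / \<delta>)))}"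

lemma bump_space_memI:
  "(\<And>s. f s = poly p (of_real ((s - t) / \<delta>)) * of_real (flat_exp m (1 - ((s - t) / \<delta>)\<^sup>2)) * exp (c * of_real ((s - t) / \<delta>)))
   \<Longrightarrow> f \<in> bump_space t \<delta> c"
  unfolding bump_space_def by blast

lemma bump_space_eq_0:
  assumes "f \<in> bump_space t \<delta> c" "0 < \<delta>" "\<delta> \<le> \<bar>s - t\<bar>"
  shows "f s = 0"
proof -
  have "1 \<le> \<bar>(s - t) / \<delta>\<bar>" using assms by (simp add: abs_divide)
  then have "1 \<le> ((s - t) / \<delta>)\<^sup>2" by (metis abs_ge_zero one_le_power power2_abs)
  then show ?thesis using assms(1) by (auto simp: bump_space_def flat_exp_def)
qed

lemma bump_space_times_poly:
  assumes "f \<in> bump_space t \<delta> c" "\<delta> \<noteq> 0"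
  shows "(\<lambda>s. k * (of_real s * f s)) \<in> bump_space t \<delta> c"
proof -
  obtain p m where f: "\<And>s. f s = poly p (of_real ((s - t) / \<delta>)) * of_real (flat_exp m (1 - ((s - t) / \<delta>)\<^sup>2)) * exp (c * of_real ((s - t) / \<delta>))"
    using assms(1) by (auto simp: bump_space_def)
  show ?thesis
  proof (rule bump_space_memI)
    fix s
    have "complex_of_real s = poly [:of_real t, of_real \<delta>:] (of_real ((s - t) / \<delta>))"
      using assms(2) by simp
    then show "k * (of_real s * f s) = poly (smult k ([:of_real t, of_real \<delta>:] * p)) (of_real ((s - t) / \<delta>))
       * of_real (flat_exp m (1 - ((s - t) / \<delta>)\<^sup>2)) * exp (c * of_real ((s - t) / \<delta>))"
      unfolding f by (simp only: poly_smult poly_mult mult.assoc)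
  qed
qed

lemma bump_space_derivative:
  assumes "f \<in> bump_space t \<delta> c" "\<delta> \<noteq> 0"
  shows "\<exists>f'\<in>bump_space t \<delta> c. \<forall>s. (f has_vector_derivative f' s) (at s)"
proof -
  obtain p m where f: "f = (\<lambda>s. poly p (of_real ((s - t) / \<delta>)) * of_real (flat_exp m (1 - ((s - t) / \<delta>)\<^sup>2)) * exp (c * of_real ((s - t) / \<delta>)))"
    using assms(1) by (auto simp: bump_space_def)
  define y :: "complex poly" where "y = [:1, 0, -1:]"
  \<comment> \<open>The polynomial factor of the derivative, once all terms are written with \<open>flat_exp (m + 2)\<close>;
    here \<open>y\<close> stands for \<open>1 - \<sigma>\<^sup>2\<close>.\<close>
  define q where "q = smult (1 / of_real \<delta>) (pderiv p * y ^ 2 + [:0, -2:] * (p - smult (of_nat m) (p * y)) + smult c (p * y ^ 2))"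
  define h where "h = (\<lambda>\<sigma>. poly p (of_real \<sigma>) * of_real (flat_exp m (1 - \<sigma>\<^sup>2)) * exp (c * of_real \<sigma>))"
  define h' where "h' = (\<lambda>\<sigma>. of_real \<delta> * poly q (of_real \<sigma>) * of_real (flat_exp (m + 2) (1 - \<sigma>\<^sup>2)) * exp (c * of_real \<sigma>))"
  have h: "(h has_vector_derivative h' \<sigma>) (at \<sigma>)" for \<sigma>
  proof -
    have 1: "((\<lambda>\<sigma>. poly p (of_real \<sigma>)) has_vector_derivative poly (pderiv p) (of_real \<sigma>)) (at \<sigma>)"
      by (rule has_vector_derivative_real_field) (rule poly_DERIV)
    have 2: "((\<lambda>\<sigma>. exp (c * of_real \<sigma>)) has_vector_derivative c * exp (c * of_real \<sigma>)) (at \<sigma>)"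
      by (rule has_vector_derivative_real_field[of "\<lambda>z. exp (c * z)"]) (auto intro!: derivative_eq_intros)
    have "((\<lambda>\<sigma>. flat_exp m (1 - \<sigma>\<^sup>2)) has_real_derivative (flat_exp (m + 2) (1 - \<sigma>\<^sup>2) - real m * flat_exp (m + 1) (1 - \<sigma>\<^sup>2)) * (- 2 * \<sigma>)) (at \<sigma>)"
      by (rule DERIV_chain2[OF flat_exp_has_derivative]) (auto intro!: derivative_eq_intros)
    then have 3: "((\<lambda>\<sigma>. complex_of_real (flat_exp m (1 - \<sigma>\<^sup>2))) has_vector_derivative of_real ((flat_exp (m + 2) (1 - \<sigma>\<^sup>2) - real m * flat_exp (m + 1) (1 - \<sigma>\<^sup>2)) * (- 2 * \<sigma>))) (at \<sigma>)"
      by (rule has_vector_derivative_of_real)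
    note d = has_vector_derivative_mult[OF has_vector_derivative_mult[OF 1 3] 2]
    have fl: "flat_exp m (1 - \<sigma>\<^sup>2) = (1 - \<sigma>\<^sup>2) ^ 2 * flat_exp (m + 2) (1 - \<sigma>\<^sup>2)" "flat_exp (m + 1) (1 - \<sigma>\<^sup>2) = (1 - \<sigma>\<^sup>2) * flat_exp (m + 2) (1 - \<sigma>\<^sup>2)"
      using flat_exp_shift[of m _ 2] flat_exp_shift[of "m + 1" _ 1] by (simp_all add: numeral_2_eq_2)
    define Y where "Y = complex_of_real (1 - \<sigma>\<^sup>2)"
    define Fl where "Fl = complex_of_real (flat_exp (m + 2) (1 - \<sigma>\<^sup>2))"
    have F: "complex_of_real (flat_exp m (1 - \<sigma>\<^sup>2)) = Y\<^sup>2 * Fl"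
      by (simp add: Y_def Fl_def fl(1))
    have F': "complex_of_real ((flat_exp (m + 2) (1 - \<sigma>\<^sup>2) - real m * flat_exp (m + 1) (1 - \<sigma>\<^sup>2)) * (- 2 * \<sigma>))
        = (Fl - of_nat m * (Y * Fl)) * (- 2 * of_real \<sigma>)"
      unfolding fl(2) by (simp add: Y_def Fl_def)
    have py: "poly y (of_real \<sigma>) = Y" by (simp add: y_def Y_def power2_eq_square)
    have h'_eq: "h' \<sigma> = (poly (pderiv p) (of_real \<sigma>) * Y\<^sup>2 + (- 2 * of_real \<sigma>) * (poly p (of_real \<sigma>) - of_nat m * (poly p (of_real \<sigma>) * Y))
        + c * (poly p (of_real \<sigma>) * Y\<^sup>2)) * Fl * exp (c * of_real \<sigma>)"
      using assms(2) by (simp add: h'_def q_def py Fl_def algebra_simps)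
    show ?thesis
      unfolding h_def
      by (rule has_vector_derivative_eq_rhs[OF d[unfolded F F']]) (simp add: h'_eq algebra_simps)
  qed
  have "(f has_vector_derivative poly q (of_real ((s - t) / \<delta>)) * of_real (flat_exp (m + 2) (1 - ((s - t) / \<delta>)\<^sup>2)) * exp (c * of_real ((s - t) / \<delta>))) (at s)" for s
  proof -
    have "((\<lambda>s. (s - t) / \<delta>) has_vector_derivative (1 / \<delta>)) (at s)"
      unfolding has_real_derivative_iff_has_vector_derivative[symmetric]
      using assms(2) by (auto intro!: derivative_eq_intros)
    from vector_diff_chain_at[OF this h]
    have "(f has_vector_derivative ((1 / \<delta>) *\<^sub>R h' ((s - t) / \<delta>))) (at s)"
      unfolding f h_def o_def .
    then show ?thesis
      by (rule has_vector_derivative_eq_rhs) (use assms(2) in \<open>simp add: h'_def scaleR_conv_of_real\<close>)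
  qed
  then show ?thesis
    by (intro bexI[of _ "\<lambda>s. poly q (of_real ((s - t) / \<delta>)) * of_real (flat_exp (m + 2) (1 - ((s - t) / \<delta>)\<^sup>2)) * exp (c * of_real ((s - t) / \<delta>))"])
       (auto simp: bump_space_def)
qed

section \<open>Schwartz functions from spaces of bumps\<close>

text \<open>
An abstract form of \<open>bump_space\<close>: the two closure properties and the common compact
support make the members and their Fourier transforms Schwartz functions.
\<close>
locale test_space =
  fixes S :: "(real \<Rightarrow> complex) set" and R :: real
  assumes deriv: "\<And>f. f \<in> S \<Longrightarrow> \<exists>f'\<in>S. \<forall>s. (f has_vector_derivative f' s) (at s)"
    and times: "\<And>f k. f \<in> S \<Longrightarrow> (\<lambda>s. k * (of_real s * f s)) \<in> S"
    and supp: "\<And>f s. f \<in> S \<Longrightarrow> R < \<bar>s\<bar> \<Longrightarrow> f s = 0"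
begin

lemma continuous: "f \<in> S \<Longrightarrow> continuous_on A f"
  using deriv[of f] by (metis continuous_at_imp_continuous_on has_vector_derivative_continuous)

lemma integrable: "f \<in> S \<Longrightarrow> integrable lborel f"
  by (rule integrable_compact_support[OF continuous supp])

lemma nth_derivative_mem: "f \<in> S \<Longrightarrow> nth_derivative n f \<in> S"
proof (induction n)
  case 0 then show ?case by (simp add: nth_derivative_def)
next
  case (Suc n)
  obtain f' where f': "f' \<in> S" "\<And>s. (nth_derivative n f has_vector_derivative f' s) (at s)"
    using deriv[OF Suc.IH[OF Suc.prems]] by blast
  have "nth_derivative (Suc n) f = (\<lambda>x. vector_derivative (nth_derivative n f) (at x))"
    by (simp add: nth_derivative_def)
  also have "\<dots> = f'" using f'(2) by (auto intro: vector_derivative_at)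
  finally show ?case using f'(1) by simp
qed

lemma schwartz: assumes "f \<in> S" shows "schwartz f"
  unfolding schwartz_def
proof (intro conjI allI)
  fix n x
  show "nth_derivative n f differentiable (at x)"
    using deriv[OF nth_derivative_mem[OF assms]] by (metis differentiableI_vector)
next
  fix m n :: nat
  let ?g = "\<lambda>x. complex_of_real (x ^ m) * nth_derivative n f x"
  have "compact (?g ` {-R..R})"
    by (intro compact_continuous_image continuous_intros continuous nth_derivative_mem assms) auto
  then have "bounded (?g ` {-R..R})" by (rule compact_imp_bounded)
  then obtain B where B: "\<And>y. y \<in> ?g ` {-R..R} \<Longrightarrow> norm y \<le> B"
    unfolding bounded_iff by blast
  have le: "norm (?g x) \<le> max B 0" for x
  proof (cases "x \<in> {-R..R}")
    case True
    then show ?thesis using B[of "?g x"] by (meson imageI le_max_iff_disj)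
  next
    case False
    then have "R < \<bar>x\<bar>" by (auto simp: abs_if split: if_splits)
    then show ?thesis using supp[OF nth_derivative_mem[OF assms]] by simp
  qed
  show "bounded (range ?g)" by (rule boundedI[of _ "max B 0"]) (use le in blast)
qed

text \<open>
Integration by parts; the boundary terms vanish since \<open>f\<close> is supported inside the interval.
\<close>
lemma fourier_derivative:
  assumes f: "f \<in> S" "f' \<in> S" "\<And>s. (f has_vector_derivative f' s) (at s)"
  shows "fourier f' x = 2 * of_real pi * \<i> * of_real x * fourier f x"
proof -
  define b where "b = \<bar>R\<bar> + 1"
  have z: "f b = 0" "f (- b) = 0" using supp[OF f(1)] by (auto simp: b_def)
  define g where "g = (\<lambda>s. f s * (2 * of_real pi * \<i> * of_real (- x) * e2pi ((- x) * s)) + f' s * e2pi ((- x) * s))"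
  have d: "((\<lambda>s. f s * e2pi ((- x) * s)) has_vector_derivative g s) (at s within A)" for s A
    unfolding g_def by (rule has_vector_derivative_mult[OF has_vector_derivative_at_within[OF f(3)] e2pi_has_vector_derivative])
  have "(\<integral>s. indicator {-b..b} s *\<^sub>R g s \<partial>lborel) = f b * e2pi ((- x) * b) - f (- b) * e2pi ((- x) * (- b))"
    by (rule integral_FTC_atLeastAtMost[OF _ d])
       (auto simp: b_def g_def intro!: continuous_intros continuous[OF f(1)] continuous[OF f(2)])
  also have "(\<lambda>s. indicator {-b..b} s *\<^sub>R g s) = g"
  proof
    fix s show "indicator {-b..b} s *\<^sub>R g s = g s"
    proof (cases "s \<in> {-b..b}")
      case False
      then have "R < \<bar>s\<bar>" by (auto simp: b_def abs_if split: if_splits)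
      then show ?thesis using supp[OF f(1)] supp[OF f(2)] by (simp add: g_def)
    qed auto
  qed
  finally have "(\<integral>s. g s \<partial>lborel) = 0" using z by simp
  moreover have "(\<integral>s. g s \<partial>lborel) = (- 2 * of_real pi * \<i> * of_real x) * fourier f x + fourier f' x"
  proof -
    have i: "integrable lborel (\<lambda>s. h s * e2pi (- (s * x)))" if "h \<in> S" for h
      using integrable_mult_e2pi[OF integrable[OF that], of "-x" 0] by (simp add: mult.commute)
    have "(\<integral>s. g s \<partial>lborel) = (\<integral>s. (- 2 * of_real pi * \<i> * of_real x) * (f s * e2pi (- (s * x))) + f' s * e2pi (- (s * x)) \<partial>lborel)"
      unfolding g_def by (intro Bochner_Integration.integral_cong refl) (simp add: mult_ac)
    also have "\<dots> = (- 2 * of_real pi * \<i> * of_real x) * fourier f x + fourier f' x"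
      unfolding fourier_e2pi using i[OF f(1)] i[OF f(2)]
      by (subst Bochner_Integration.integral_add) auto
    finally show ?thesis .
  qed
  ultimately show ?thesis by (simp add: algebra_simps add_eq_0_iff)
qed

lemma fourier_decay: "f \<in> S \<Longrightarrow> \<exists>C. \<forall>x. (1 + \<bar>x\<bar>) ^ m * norm (fourier f x) \<le> C"
proof (induction m arbitrary: f)
  case 0
  then show ?case using norm_fourier_le[of f] by auto
next
  case (Suc m)
  obtain f' where f': "f' \<in> S" "\<And>s. (f has_vector_derivative f' s) (at s)" using deriv[OF Suc.prems] by blast
  obtain A B where A: "\<And>x. (1 + \<bar>x\<bar>) ^ m * norm (fourier f x) \<le> A" and B: "\<And>x. (1 + \<bar>x\<bar>) ^ m * norm (fourier f' x) \<le> B"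
    using Suc.IH[OF Suc.prems] Suc.IH[OF f'(1)] by metis
  have "(1 + \<bar>x\<bar>) ^ Suc m * norm (fourier f x) \<le> A + B" for x
  proof -
    have "\<bar>x\<bar> * norm (fourier f x) \<le> 2 * pi * \<bar>x\<bar> * norm (fourier f x)"
      using pi_ge_two by (intro mult_right_mono) (auto simp: mult_le_cancel_right1)
    also have "\<dots> = norm (fourier f' x)"
      by (simp add: fourier_derivative[OF Suc.prems f'] norm_mult)
    finally have "(1 + \<bar>x\<bar>) ^ m * (\<bar>x\<bar> * norm (fourier f x)) \<le> (1 + \<bar>x\<bar>) ^ m * norm (fourier f' x)"
      by (intro mult_left_mono) auto
    moreover have "(1 + \<bar>x\<bar>) ^ Suc m * norm (fourier f x)
        = (1 + \<bar>x\<bar>) ^ m * norm (fourier f x) + (1 + \<bar>x\<bar>) ^ m * (\<bar>x\<bar> * norm (fourier f x))"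
      by (simp add: algebra_simps)
    ultimately show ?thesis using A[of x] B[of x] by linarith
  qed
  then show ?case by blast
qed

lemma nth_derivative_fourier:
  "f \<in> S \<Longrightarrow> nth_derivative n (fourier f) = fourier (\<lambda>s. (- 2 * of_real pi * \<i> * of_real s) ^ n * f s)
    \<and> (\<lambda>s. (- 2 * of_real pi * \<i> * of_real s) ^ n * f s) \<in> S"
proof (induction n)
  case 0 then show ?case by (simp add: nth_derivative_def)
next
  case (Suc n)
  define g where "g = (\<lambda>s. (- 2 * of_real pi * \<i> * of_real s) ^ n * f s)"
  have g: "nth_derivative n (fourier f) = fourier g" "g \<in> S" using Suc by (auto simp: g_def)
  have eq: "(\<lambda>s. (- 2 * of_real pi * \<i>) * (of_real s * g s)) = (\<lambda>s. (- 2 * of_real pi * \<i> * of_real s) ^ Suc n * f s)"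
    by (auto simp: g_def mult_ac)
  have gS: "(\<lambda>s. (- 2 * of_real pi * \<i>) * (of_real s * g s)) \<in> S" by (rule times[OF g(2)])
  have "(fourier g has_vector_derivative fourier (\<lambda>s. - 2 * of_real pi * \<i> * (of_real s * g s)) x) (at x)" for x
    by (rule fourier_has_vector_derivative[OF integrable[OF g(2)]])
       (use integrable[OF times[OF g(2), of 1]] in simp)
  then have "nth_derivative (Suc n) (fourier f) = fourier (\<lambda>s. - 2 * of_real pi * \<i> * (of_real s * g s))"
    using g(1) by (auto simp: nth_derivative_def intro!: vector_derivative_at)
  then show ?case using gS unfolding eq by simp
qed

lemma schwartz_fourier: assumes "f \<in> S" shows "schwartz (fourier f)"
  unfolding schwartz_def
proof (intro conjI allI)
  fix n x
  define g where "g = (\<lambda>s. (- 2 * of_real pi * \<i> * of_real s) ^ n * f s)"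
  have g: "nth_derivative n (fourier f) = fourier g" "g \<in> S" using nth_derivative_fourier[OF assms] by (auto simp: g_def)
  show "nth_derivative n (fourier f) differentiable (at x)"
    unfolding g(1)
    by (rule differentiableI_vector, rule fourier_has_vector_derivative[OF integrable[OF g(2)]])
       (use integrable[OF times[OF g(2), of 1]] in simp)
next
  fix m n :: nat
  define g where "g = (\<lambda>s. (- 2 * of_real pi * \<i> * of_real s) ^ n * f s)"
  have g: "nth_derivative n (fourier f) = fourier g" "g \<in> S" using nth_derivative_fourier[OF assms] by (auto simp: g_def)
  obtain C where C: "\<And>x. (1 + \<bar>x\<bar>) ^ m * norm (fourier g x) \<le> C" using fourier_decay[OF g(2)] by blast
  have le: "norm (complex_of_real (x ^ m) * fourier g x) \<le> C" for x
  proof -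
    have "\<bar>x\<bar> ^ m * norm (fourier g x) \<le> (1 + \<bar>x\<bar>) ^ m * norm (fourier g x)"
      by (intro mult_right_mono power_mono) auto
    then show ?thesis using C[of x] by (simp add: norm_mult norm_power power_abs)
  qed
  show "bounded (range (\<lambda>x. complex_of_real (x ^ m) * nth_derivative n (fourier f) x))"
    unfolding g(1) by (rule boundedI[of _ C]) (use le in blast)
qed

end

section \<open>Test functions localised in frequency\<close>

text \<open>
The inverse Fourier integral at complex arguments.
\<close>
definition laplace :: "(real \<Rightarrow> complex) \<Rightarrow> complex \<Rightarrow> complex" where
  "laplace f z = (\<integral>t. f t * exp (2 * of_real pi * \<i> * of_real t * z) \<partial>lborel)"

lemma laplace_real: "laplace f (of_real x) = fourier f (- x)"
  by (simp add: laplace_def fourier_e2pi e2pi_exp mult_ac)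

lemma laplace_integrand_bound:
  assumes "R < \<bar>t\<bar> \<Longrightarrow> f t = 0"
  shows "norm (f t * exp (2 * of_real pi * \<i> * of_real t * z)) \<le> norm (f t) * exp (2 * pi * R * \<bar>Im z\<bar>)"
proof (cases "R < \<bar>t\<bar>")
  case False
  have "- (t * Im z) \<le> \<bar>t\<bar> * \<bar>Im z\<bar>" by (metis abs_ge_self abs_mult abs_minus_cancel)
  also have "\<dots> \<le> R * \<bar>Im z\<bar>" using False by (intro mult_right_mono) auto
  finally have "2 * pi * - (t * Im z) \<le> 2 * pi * (R * \<bar>Im z\<bar>)" by (intro mult_left_mono) auto
  then show ?thesis by (simp add: norm_mult mult_left_mono mult.assoc)
qed (use assms in simp)

lemma laplace_integrand_integrable:
  assumes f: "integrable lborel f" and supp: "\<And>t. R < \<bar>t\<bar> \<Longrightarrow> f t = 0"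
  shows "integrable lborel (\<lambda>t. f t * exp (2 * of_real pi * \<i> * of_real t * z))"
proof (rule Bochner_Integration.integrable_bound)
  show "integrable lborel (\<lambda>t. norm (f t) * exp (2 * pi * R * \<bar>Im z\<bar>))" using f by simp
  show "(\<lambda>t. f t * exp (2 * of_real pi * \<i> * of_real t * z)) \<in> borel_measurable lborel"
    using f by measurable
  show "AE t in lborel. norm (f t * exp (2 * of_real pi * \<i> * of_real t * z)) \<le> norm (norm (f t) * exp (2 * pi * R * \<bar>Im z\<bar>))"
    using laplace_integrand_bound[of R _ f z] supp by (intro AE_I2) simp
qed

lemma laplace_bound:
  assumes f: "integrable lborel f" and supp: "\<And>t. R < \<bar>t\<bar> \<Longrightarrow> f t = 0"
  shows "norm (laplace f z) \<le> (\<integral>t. norm (f t) \<partial>lborel) * exp (2 * pi * R * \<bar>Im z\<bar>)"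
proof -
  have "norm (laplace f z) \<le> (\<integral>t. norm (f t) * exp (2 * pi * R * \<bar>Im z\<bar>) \<partial>lborel)"
    unfolding laplace_def
    by (rule Bochner_Integration.integral_norm_bound_integral[OF laplace_integrand_integrable[OF f supp]])
       (use f laplace_integrand_bound[of R _ f z] supp in auto)
  then show ?thesis by simp
qed

lemma laplace_entire:
  assumes f: "integrable lborel f" and supp: "\<And>t. R < \<bar>t\<bar> \<Longrightarrow> f t = 0"
  shows "laplace f holomorphic_on UNIV"
proof -
  have ball: "laplace f holomorphic_on ball 0 (real n)" for n
    unfolding laplace_def[abs_def]
  proof (rule holomorphic_on_parameter_integral[where b="\<lambda>t. norm (f t) * exp (2 * pi * \<bar>R\<bar> * real n)"])
    show "(\<lambda>t. f t * exp (2 * of_real pi * \<i> * of_real t * w)) \<in> borel_measurable lborel" for w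
      using f by measurable
    show "norm (f t * exp (2 * of_real pi * \<i> * of_real t * w)) \<le> norm (f t) * exp (2 * pi * \<bar>R\<bar> * real n)"
      if "w \<in> ball 0 (real n)" for t w
    proof -
      have "R * \<bar>Im w\<bar> \<le> \<bar>R\<bar> * real n"
        using that abs_Im_le_cmod[of w] by (intro mult_mono) auto
      then have "2 * pi * (R * \<bar>Im w\<bar>) \<le> 2 * pi * (\<bar>R\<bar> * real n)" by (intro mult_left_mono) auto
      then have "norm (f t) * exp (2 * pi * R * \<bar>Im w\<bar>) \<le> norm (f t) * exp (2 * pi * \<bar>R\<bar> * real n)"
        by (intro mult_left_mono) (auto simp: mult.assoc)
      then show ?thesis using laplace_integrand_bound[of R t f w] supp by (meson order_trans)
    qed
  qed (use f in \<open>auto intro!: holomorphic_intros\<close>)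
  have "laplace f holomorphic_on (\<Union>n. ball 0 (real n))"
    by (rule holomorphic_on_UN_open) (use ball in auto)
  moreover have "(\<Union>n. ball (0::complex) (real n)) = UNIV"
    using reals_Archimedean2 by (auto simp: dist_norm)
  ultimately show ?thesis by simp
qed

context
  fixes \<delta> :: real
  assumes \<delta>: "0 < \<delta>"
begin

definition bump :: "real \<Rightarrow> complex" where "bump s = of_real (flat_exp 0 (1 - (s / \<delta>)\<^sup>2))"

text \<open>
A bump moved to frequency \<open>t\<close> and modulated so that its Fourier transform is the transform of the bump,
moved to \<open>a\<close> and multiplied by a character (\<open>fourier_wave\<close>).
\<close>
definition wave :: "real \<Rightarrow> real \<Rightarrow> real \<Rightarrow> complex" where
  "wave t a s = bump (s - t) * e2pi (a * (s - t))"

lemma test_space_bump: "test_space (bump_space t \<delta> c) (\<bar>t\<bar> + \<delta>)"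
proof
  fix f s assume "f \<in> bump_space t \<delta> c" "\<bar>t\<bar> + \<delta> < \<bar>s\<bar>"
  then show "f s = 0" using \<delta> by (intro bump_space_eq_0[of f t \<delta> c s]) auto
qed (use \<delta> bump_space_derivative bump_space_times_poly in auto)

lemma wave_mem: "wave t a \<in> bump_space t \<delta> (2 * of_real pi * \<i> * of_real (a * \<delta>))"
  by (rule bump_space_memI[of _ "[:1:]" _ _ 0])
     (use \<delta> in \<open>simp add: wave_def bump_def e2pi_exp mult_ac\<close>)

lemma bump_mem: "bump \<in> bump_space 0 \<delta> 0"
  by (rule bump_space_memI[of _ "[:1:]" _ _ 0]) (simp add: bump_def)

lemma bump_eq_0: "\<delta> < \<bar>s\<bar> \<Longrightarrow> bump s = 0"
  using bump_space_eq_0[OF bump_mem \<delta>, of s] by simp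

lemma bump_integrable: "integrable lborel bump"
  using test_space.integrable[OF test_space_bump bump_mem] .

lemma support_wave: "support (wave t a) \<subseteq> {t - \<delta>..t + \<delta>}"
  unfolding support_def
proof (rule closure_minimal)
  show "{s. wave t a s \<noteq> 0} \<subseteq> {t - \<delta>..t + \<delta>}"
  proof
    fix s assume "s \<in> {s. wave t a s \<noteq> 0}"
    then have "\<not> \<delta> < \<bar>s - t\<bar>" using bump_eq_0[of "s - t"] by (auto simp: wave_def)
    then show "s \<in> {t - \<delta>..t + \<delta>}" by (auto simp: abs_le_iff not_less)
  qed
qed simp

lemma fourier_shift_modulated:
  "fourier (\<lambda>s. h s * (bump (s - t) * e2pi (a * (s - t)))) x = e2pi (- (t * x)) * fourier (\<lambda>s. h (t + s) * bump s) (x - a)"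
proof -
  have "fourier (\<lambda>s. h s * (bump (s - t) * e2pi (a * (s - t)))) x
      = (\<integral>v. h (t + v) * (bump v * e2pi (a * v)) * e2pi (- ((t + v) * x)) \<partial>lborel)"
    unfolding fourier_e2pi by (subst lborel_integral_real_affine[where c=1 and t=t]) auto
  also have "\<dots> = (\<integral>v. e2pi (- (t * x)) * (h (t + v) * bump v * e2pi (- (v * (x - a)))) \<partial>lborel)"
  proof (intro Bochner_Integration.integral_cong refl)
    fix v
    have "e2pi (a * v) * e2pi (- ((t + v) * x)) = e2pi (- (t * x)) * e2pi (- (v * (x - a)))"
      unfolding e2pi_add[symmetric] by (rule arg_cong[where f=e2pi]) (simp add: algebra_simps)
    then show "h (t + v) * (bump v * e2pi (a * v)) * e2pi (- ((t + v) * x)) = e2pi (- (t * x)) * (h (t + v) * bump v * e2pi (- (v * (x - a))))"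
      by (simp add: mult_ac)
  qed
  finally show ?thesis unfolding fourier_e2pi by simp
qed

lemma fourier_wave: "fourier (wave t a) x = e2pi (- (t * x)) * fourier bump (x - a)"
  using fourier_shift_modulated[of "\<lambda>_. 1" t a x] by (simp add: wave_def[abs_def])

lemma schwartz_wave: "schwartz (wave t a)"
  by (rule test_space.schwartz[OF test_space_bump wave_mem])

lemma schwartz_fourier_wave: "schwartz (fourier (wave t a))"
  by (rule test_space.schwartz_fourier[OF test_space_bump wave_mem])

text \<open>
After the shift by \<open>t\<close>, an \<open>n\<close>-th derivative is the transform of \<open>(t + s)\<^sup>n bump s\<close> at \<open>x - a\<close>. The binomial
theorem leaves finitely many rapidly decreasing functions of \<open>x - a\<close>, and \<open>1 + \<bar>x\<bar>\<close> is at most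
\<open>(1 + \<bar>x - a\<bar>)(1 + \<bar>a\<bar>)\<close>. The growth in \<open>a\<close> is therefore polynomial, uniformly for bounded \<open>t\<close>.
\<close>
lemma wave_seminorm_bound:
  "\<exists>C\<ge>0. \<forall>a t x. \<bar>t\<bar> \<le> T \<longrightarrow> \<bar>x\<bar> ^ m * norm (nth_derivative n (fourier (wave t a)) x) \<le> C * (1 + \<bar>a\<bar>) ^ m"
proof -
  interpret B: test_space "bump_space 0 \<delta> 0" "\<bar>0\<bar> + \<delta>" by (rule test_space_bump)
  define g where "g = (\<lambda>k s. (- 2 * of_real pi * \<i> * of_real s) ^ k * bump s)"
  have gS: "g k \<in> bump_space 0 \<delta> 0" for k
    using B.nth_derivative_fourier[OF bump_mem, of k] by (simp add: g_def)
  obtain A where A: "\<And>k y. (1 + \<bar>y\<bar>) ^ m * norm (fourier (g k) y) \<le> A k"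
    using B.fourier_decay[OF gS, of m] by metis
  have A0: "0 \<le> A k" for k using A[where k=k and y=0] by (auto intro: order_trans[rotated])
  define C where "C = (\<Sum>k\<le>n. of_nat (n choose k) * (2 * pi * \<bar>T\<bar>) ^ (n - k) * A k)"
  have C0: "0 \<le> C" unfolding C_def using A0 by (intro sum_nonneg mult_nonneg_nonneg) auto
  have "\<bar>x\<bar> ^ m * norm (nth_derivative n (fourier (wave t a)) x) \<le> C * (1 + \<bar>a\<bar>) ^ m" if t: "\<bar>t\<bar> \<le> T" for a t x
  proof -
    define c where "c = (- 2 * of_real pi * \<i> * of_real t :: complex)"
    have "nth_derivative n (fourier (wave t a)) x = fourier (\<lambda>s. (- 2 * of_real pi * \<i> * of_real s) ^ n * wave t a s) x"
      using test_space.nth_derivative_fourier[OF test_space_bump wave_mem] by simp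
    also have "\<dots> = e2pi (- (t * x)) * fourier (\<lambda>s. (- 2 * of_real pi * \<i> * of_real (t + s)) ^ n * bump s) (x - a)"
      unfolding wave_def by (rule fourier_shift_modulated)
    also have "(\<lambda>s. (- 2 * of_real pi * \<i> * of_real (t + s)) ^ n * bump s) = (\<lambda>s. \<Sum>k\<le>n. of_nat (n choose k) * c ^ (n - k) * g k s)"
    proof
      fix s
      have shift: "- 2 * of_real pi * \<i> * of_real (t + s) = (- 2 * of_real pi * \<i> * of_real s) + c" by (simp add: c_def algebra_simps)
      show "(- 2 * of_real pi * \<i> * of_real (t + s)) ^ n * bump s = (\<Sum>k\<le>n. of_nat (n choose k) * c ^ (n - k) * g k s)"
        unfolding g_def shift binomial_ring sum_distrib_right by (intro sum.cong refl) (simp only: mult_ac)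
    qed
    also have "fourier (\<lambda>s. \<Sum>k\<le>n. of_nat (n choose k) * c ^ (n - k) * g k s) (x - a)
        = (\<Sum>k\<le>n. of_nat (n choose k) * c ^ (n - k) * fourier (g k) (x - a))"
    proof -
      have i: "integrable lborel (\<lambda>s. g k s * e2pi (- (s * (x - a))))" for k
        using integrable_mult_e2pi[OF B.integrable[OF gS], of k "- (x - a)" 0]
        by (simp only: mult_minus_left add_0_right mult.commute[of "x - a"])
      have "fourier (\<lambda>s. \<Sum>k\<le>n. of_nat (n choose k) * c ^ (n - k) * g k s) (x - a)
         = (\<integral>s. (\<Sum>k\<le>n. of_nat (n choose k) * c ^ (n - k) * (g k s * e2pi (- (s * (x - a))))) \<partial>lborel)"
        unfolding fourier_e2pi by (simp only: sum_distrib_right mult.assoc)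
      also have "\<dots> = (\<Sum>k\<le>n. of_nat (n choose k) * c ^ (n - k) * fourier (g k) (x - a))"
        unfolding fourier_e2pi using i by (subst Bochner_Integration.integral_sum) auto
      finally show ?thesis .
    qed
    finally have eq: "norm (nth_derivative n (fourier (wave t a)) x)
        = norm (\<Sum>k\<le>n. of_nat (n choose k) * c ^ (n - k) * fourier (g k) (x - a))"
      by (simp add: norm_mult)
    have nc: "norm c \<le> 2 * pi * \<bar>T\<bar>" using t by (simp add: c_def norm_mult)
    have xm: "\<bar>x\<bar> ^ m \<le> (1 + \<bar>x - a\<bar>) ^ m * (1 + \<bar>a\<bar>) ^ m"
    proof -
      have "\<bar>x\<bar> \<le> \<bar>x - a\<bar> + \<bar>a\<bar>" by linarith
      also have "\<dots> \<le> (1 + \<bar>x - a\<bar>) * (1 + \<bar>a\<bar>)" by (simp add: algebra_simps)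
      finally show ?thesis unfolding power_mult_distrib[symmetric] by (rule power_mono) simp
    qed
    have "\<bar>x\<bar> ^ m * norm (nth_derivative n (fourier (wave t a)) x)
       \<le> ((1 + \<bar>x - a\<bar>) ^ m * (1 + \<bar>a\<bar>) ^ m) * (\<Sum>k\<le>n. of_nat (n choose k) * norm c ^ (n - k) * norm (fourier (g k) (x - a)))"
      unfolding eq
      by (intro mult_mono xm order_trans[OF norm_sum] sum_mono) (auto simp: norm_mult norm_power)
    also have "\<dots> = (1 + \<bar>a\<bar>) ^ m * (\<Sum>k\<le>n. of_nat (n choose k) * norm c ^ (n - k) * ((1 + \<bar>x - a\<bar>) ^ m * norm (fourier (g k) (x - a))))"
      by (simp add: sum_distrib_left mult_ac)
    also have "\<dots> \<le> (1 + \<bar>a\<bar>) ^ m * C"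
      unfolding C_def
      by (intro mult_left_mono sum_mono mult_mono A power_mono nc mult_nonneg_nonneg) auto
    finally show ?thesis by (simp add: mult.commute)
  qed
  then show ?thesis using C0 by blast
qed

text \<open>
This is where temperedness enters: it controls the growth of the entire function \<open>l\<close> in the horizontal
direction.
\<close>
lemma tempered_wave_bound:
  assumes "defines_tempered_distribution g"
  shows "\<exists>M N. 0 \<le> M \<and> (\<forall>a t. \<bar>t\<bar> \<le> T \<longrightarrow> norm (distribution_of g (fourier (wave t a))) \<le> M * (1 + \<bar>a\<bar>) ^ N)"
proof -
  obtain C N where CN: "\<And>\<phi>. schwartz \<phi> \<Longrightarrow> norm (distribution_of g \<phi>) \<le> C * (\<Sum>m\<le>N. \<Sum>n\<le>N. schwartz_seminorm m n \<phi>)"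
    using assms unfolding defines_tempered_distribution_def by blast
  obtain K where K: "\<And>m n. 0 \<le> K m n" "\<And>m n a t x. \<bar>t\<bar> \<le> T \<Longrightarrow>
      \<bar>x\<bar> ^ m * norm (nth_derivative n (fourier (wave t a)) x) \<le> K m n * (1 + \<bar>a\<bar>) ^ m"
    using wave_seminorm_bound[of T] by metis
  define M where "M = \<bar>C\<bar> * (\<Sum>m\<le>N. \<Sum>n\<le>N. K m n)"
  have "norm (distribution_of g (fourier (wave t a))) \<le> M * (1 + \<bar>a\<bar>) ^ N" if t: "\<bar>t\<bar> \<le> T" for a t
  proof -
    let ?\<phi> = "fourier (wave t a)"
    have sn: "0 \<le> schwartz_seminorm m n ?\<phi> \<and> schwartz_seminorm m n ?\<phi> \<le> K m n * (1 + \<bar>a\<bar>) ^ N" if "m \<le> N" for m n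
    proof
      have bdd: "bdd_above (range (\<lambda>x. \<bar>x\<bar> ^ m * norm (nth_derivative n ?\<phi> x)))"
        using K(2)[OF t, of _ m n a] by (intro bdd_aboveI[of _ "K m n * (1 + \<bar>a\<bar>) ^ m"]) auto
      show "0 \<le> schwartz_seminorm m n ?\<phi>"
        unfolding schwartz_seminorm_def by (rule cSUP_upper2[OF bdd, of 0]) auto
      have "schwartz_seminorm m n ?\<phi> \<le> K m n * (1 + \<bar>a\<bar>) ^ m"
        unfolding schwartz_seminorm_def by (rule cSUP_least) (use K(2)[OF t] in auto)
      also have "\<dots> \<le> K m n * (1 + \<bar>a\<bar>) ^ N"
        using that K(1) by (intro mult_left_mono power_increasing) auto
      finally show "schwartz_seminorm m n ?\<phi> \<le> K m n * (1 + \<bar>a\<bar>) ^ N" .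
    qed
    have "norm (distribution_of g ?\<phi>) \<le> C * (\<Sum>m\<le>N. \<Sum>n\<le>N. schwartz_seminorm m n ?\<phi>)"
      by (rule CN[OF schwartz_fourier_wave])
    also have "\<dots> \<le> \<bar>C\<bar> * (\<Sum>m\<le>N. \<Sum>n\<le>N. schwartz_seminorm m n ?\<phi>)"
      using sn by (intro mult_right_mono sum_nonneg) auto
    also have "\<dots> \<le> \<bar>C\<bar> * (\<Sum>m\<le>N. \<Sum>n\<le>N. K m n * (1 + \<bar>a\<bar>) ^ N)"
      using sn by (intro mult_left_mono sum_mono) auto
    also have "\<dots> = M * (1 + \<bar>a\<bar>) ^ N" by (simp add: M_def sum_distrib_right mult.assoc)
    finally show ?thesis .
  qed
  moreover have "0 \<le> M" unfolding M_def by (intro mult_nonneg_nonneg sum_nonneg K) auto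
  ultimately show ?thesis by blast
qed

text \<open>
On the imaginary axis the transform of the bump is an integral of non-negative functions, and on the support
of the bump the exponential is at least \<open>exp (- 2\<pi>\<delta>\<bar>y\<bar>)\<close>.
\<close>
lemma bump_laplace_lower: "\<exists>\<kappa>>0. \<forall>y. \<kappa> * exp (- (2 * pi * \<delta> * \<bar>y\<bar>)) \<le> norm (laplace bump (\<i> * of_real y))"
proof -
  define b where "b = (\<lambda>s. flat_exp 0 (1 - (s / \<delta>)\<^sup>2))"
  have bb: "bump s = of_real (b s)" for s by (simp add: bump_def b_def)
  have b0: "0 \<le> b s" for s by (simp add: b_def flat_exp_nonneg)
  have ib: "integrable lborel b" using integrable_Re[OF bump_integrable] by (simp add: bb)
  have contb: "continuous_on UNIV b"
    using continuous_on_Re[OF test_space.continuous[OF test_space_bump bump_mem, of UNIV]] by (simp add: bb)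
  define \<kappa> where "\<kappa> = (\<integral>s. b s \<partial>lborel)"
  have "\<kappa> \<noteq> 0"
  proof
    assume "\<kappa> = 0"
    then have "AE s in lborel. b s = 0"
      using integral_nonneg_eq_0_iff_AE[OF ib] b0 by (simp add: \<kappa>_def)
    then have "AE s in lborel. complex_of_real (b s) = 0" by simp
    then have "complex_of_real (b 0) = 0"
      by (intro continuous_AE_eq[of "\<lambda>s. complex_of_real (b s)" "\<lambda>_. 0" 0])
         (use contb in \<open>auto intro!: continuous_intros\<close>)
    then show False by (simp add: b_def flat_exp_def)
  qed
  moreover have "0 \<le> \<kappa>" unfolding \<kappa>_def by (intro integral_nonneg_AE AE_I2 b0)
  ultimately have \<kappa>: "0 < \<kappa>" by simp
  have "\<kappa> * exp (- (2 * pi * \<delta> * \<bar>y\<bar>)) \<le> norm (laplace bump (\<i> * of_real y))" for y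
  proof -
    have eq: "bump t * exp (2 * of_real pi * \<i> * of_real t * (\<i> * of_real y)) = of_real (b t * exp (- (2 * pi * t * y)))" for t
      by (simp add: bb exp_of_real[symmetric] algebra_simps)
    have "integrable lborel (\<lambda>t. complex_of_real (b t * exp (- (2 * pi * t * y))))"
      using laplace_integrand_integrable[OF bump_integrable, of \<delta> "\<i> * of_real y"] bump_eq_0 unfolding eq by blast
    then have i: "integrable lborel (\<lambda>t. b t * exp (- (2 * pi * t * y)))"
      by (drule_tac integrable_Re) simp
    have l: "laplace bump (\<i> * of_real y) = of_real (\<integral>t. b t * exp (- (2 * pi * t * y)) \<partial>lborel)"
      unfolding laplace_def eq by (rule integral_complex_of_real)
    have "(\<integral>t. b t * exp (- (2 * pi * \<delta> * \<bar>y\<bar>)) \<partial>lborel) \<le> (\<integral>t. b t * exp (- (2 * pi * t * y)) \<partial>lborel)"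
    proof (rule integral_mono)
      fix t
      show "b t * exp (- (2 * pi * \<delta> * \<bar>y\<bar>)) \<le> b t * exp (- (2 * pi * t * y))"
      proof (cases "\<delta> < \<bar>t\<bar>")
        case True
        then have "b t = 0" using bump_eq_0[of t] by (simp add: bb)
        then show ?thesis by simp
      next
        case False
        have "t * y \<le> \<bar>t\<bar> * \<bar>y\<bar>" by (metis abs_ge_self abs_mult)
        also have "\<dots> \<le> \<delta> * \<bar>y\<bar>" using False by (intro mult_right_mono) auto
        finally have "2 * pi * (t * y) \<le> 2 * pi * (\<delta> * \<bar>y\<bar>)" by (intro mult_left_mono) auto
        then show ?thesis by (intro mult_left_mono b0) (simp add: mult.assoc)
      qed
    qed (use i ib in auto)
    then show ?thesis unfolding l \<kappa>_def by simp
  qed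
  then show ?thesis using \<kappa> by blast
qed

end

section \<open>Tempered functions with bounded spectrum\<close>

lemma polynomial_le_exponential:
  assumes "0 < (\<epsilon>::real)"
  obtains C where "0 < C" "\<And>x. 0 \<le> x \<Longrightarrow> (1 + x) ^ N \<le> C * exp (\<epsilon> * x)"
proof (rule that[of "fact N * exp \<epsilon> / \<epsilon> ^ N"])
  fix x :: real assume "0 \<le> x"
  then have "(\<epsilon> * (1 + x)) ^ N \<le> fact N * exp (\<epsilon> * (1 + x))" using assms by (intro power_le_fact_exp) auto
  then show "(1 + x) ^ N \<le> fact N * exp \<epsilon> / \<epsilon> ^ N * exp (\<epsilon> * x)"
  proof -
    have "exp (\<epsilon> * (1 + x)) = exp \<epsilon> * exp (\<epsilon> * x)" by (simp add: distrib_left exp_add)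
    then have "(1 + x) ^ N * \<epsilon> ^ N \<le> fact N * (exp \<epsilon> * exp (\<epsilon> * x))"
      using \<open>(\<epsilon> * (1 + x)) ^ N \<le> _\<close> by (simp only: power_mult_distrib mult.commute)
    then have "(1 + x) ^ N \<le> fact N * (exp \<epsilon> * exp (\<epsilon> * x)) / \<epsilon> ^ N"
      using assms by (simp only: pos_le_divide_eq zero_less_power)
    then show ?thesis by (simp add: mult.assoc)
  qed
qed (use assms in auto)

text \<open>
Let \<open>\<omega>\<close> be the transform of the bump. Then \<open>(g - k) \<omega>(x - a)\<close> is integrable for every \<open>a\<close>, and its
Fourier transform at \<open>t\<close> is \<open>g - k\<close> tested against a wave at frequency \<open>t\<close>; this vanishes for
\<open>\<bar>t\<bar> > 1 + \<delta>\<close>. By inversion the product is the restriction of an entire function \<open>E a\<close>, and \<open>g - k\<close>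
is \<open>E a\<close> divided by the translate of \<open>\<omega>\<close>. The quotients for different \<open>a\<close> agree, so at each point \<open>z\<close>
one may choose the translate \<open>a = Re z\<close>, for which the denominator is bounded below; this makes the
quotient entire and bounds its growth.
\<close>
lemma band_extension:
  fixes g k :: "real \<Rightarrow> real"
  assumes \<delta>: "0 < \<delta>" and temp: "defines_tempered_distribution g" and k: "integrable lborel k"
    and spec: "\<And>\<phi>. schwartz \<phi> \<Longrightarrow> support \<phi> \<subseteq> - {-1..1} \<Longrightarrow>
      distribution_of g (fourier \<phi>) = (\<integral>x. of_real (k x) * fourier \<phi> x \<partial>lborel)"
  shows "\<exists>l. l holomorphic_on UNIV \<and> (\<exists>A N. 0 \<le> A \<and> (\<forall>z. norm (l z) \<le> A * (1 + norm z) ^ N * exp (2 * pi * (1 + 2 * \<delta>) * norm z)))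
     \<and> (AE x in lborel. l (of_real x) = of_real (g x - k x))"
proof -
  let ?b = "bump \<delta>"
  let ?w = "wave \<delta>"
  define \<omega> where "\<omega> = fourier ?b"
  define \<Omega> where "\<Omega> = (\<lambda>z. laplace ?b (- z))"
  define v where "v = (\<lambda>a x. of_real (g x - k x) * \<omega> (x - a))"
  have [measurable]: "k \<in> borel_measurable borel" using k by auto
  have [measurable]: "\<omega> \<in> borel_measurable borel" unfolding \<omega>_def by (rule measurable_fourier[OF bump_integrable[OF \<delta>]])
  have \<Omega>_real: "\<Omega> (of_real x) = \<omega> x" for x
    using laplace_real[of ?b "- x"] by (simp add: \<Omega>_def \<omega>_def)
  have \<Omega>_hol: "\<Omega> holomorphic_on UNIV"
    unfolding \<Omega>_def
    by (rule holomorphic_on_compose_gen[OF _ laplace_entire[OF bump_integrable[OF \<delta>], of \<delta>], unfolded o_def])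
       (auto intro!: holomorphic_intros simp: bump_eq_0[OF \<delta>])
  have fw: "fourier (?w t a) x = e2pi (- (t * x)) * \<omega> (x - a)" for t a x
    by (simp add: fourier_wave[OF \<delta>] \<omega>_def)
  define B where "B = (\<integral>s. norm (?b s) \<partial>lborel)"
  have \<omega>B: "norm (\<omega> x) \<le> B" for x unfolding \<omega>_def B_def by (rule norm_fourier_le)
  have B0: "0 \<le> B" using \<omega>B[of 0] norm_ge_zero order_trans by blast
  have ig: "integrable lborel (\<lambda>x. of_real (g x) * fourier (?w t a) x)" for t a
    using temp schwartz_fourier_wave[OF \<delta>] unfolding defines_tempered_distribution_def by blast
  have ik: "integrable lborel (\<lambda>x. of_real (k x) * fourier (?w t a) x)" for t a
  proof (rule integrable_mult_bounded)
    show "fourier (?w t a) \<in> borel_measurable lborel"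
      unfolding fw[abs_def] by measurable
    show "norm (fourier (?w t a) x) \<le> B" for x by (simp add: fw norm_mult \<omega>B)
  qed (use k in simp)
  have v_eq: "v a = (\<lambda>x. of_real (g x) * fourier (?w 0 a) x - of_real (k x) * fourier (?w 0 a) x)" for a
    by (auto simp: v_def fw algebra_simps)
  have iv: "integrable lborel (v a)" for a
    unfolding v_eq by (rule Bochner_Integration.integrable_diff[OF ig ik])
  \<comment> \<open>The pairing with the wave at frequency \<open>t\<close>: the character in \<open>fourier_wave\<close> is the kernel of the
    Fourier transform.\<close>
  have Fv: "fourier (v a) t = distribution_of g (fourier (?w t a)) - (\<integral>x. of_real (k x) * fourier (?w t a) x \<partial>lborel)" for a t
    unfolding distribution_of_def Bochner_Integration.integral_diff[OF ig ik, symmetric] fourier_e2pi[of "v a"]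
    by (intro Bochner_Integration.integral_cong refl) (simp add: v_def fw algebra_simps)
  have Fv0: "fourier (v a) t = 0" if t: "1 + \<delta> < \<bar>t\<bar>" for a t
  proof -
    have "support (?w t a) \<subseteq> - {-1..1}"
      using support_wave[OF \<delta>, of t a] t by (auto simp: abs_if split: if_splits)
    then show ?thesis unfolding Fv by (simp add: spec schwartz_wave[OF \<delta>])
  qed
  obtain M N where M: "0 \<le> M" "\<And>a t. \<bar>t\<bar> \<le> 1 + \<delta> \<Longrightarrow> norm (distribution_of g (fourier (?w t a))) \<le> M * (1 + \<bar>a\<bar>) ^ N"
    using tempered_wave_bound[OF \<delta> temp, of "1 + \<delta>"] by blast
  define M' where "M' = M + (\<integral>x. norm (k x) \<partial>lborel) * B"
  have M'0: "0 \<le> M'" unfolding M'_def using M(1) B0 by (intro add_nonneg_nonneg mult_nonneg_nonneg) auto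
  have Fv_bd: "norm (fourier (v a) t) \<le> M' * (1 + \<bar>a\<bar>) ^ N" for a t
  proof (cases "1 + \<delta> < \<bar>t\<bar>")
    case True then show ?thesis using Fv0 M'0 by simp
  next
    case False
    have "norm (\<integral>x. of_real (k x) * fourier (?w t a) x \<partial>lborel) \<le> (\<integral>x. norm (k x) * B \<partial>lborel)"
      by (rule Bochner_Integration.integral_norm_bound_integral[OF ik])
         (use k in \<open>auto simp: fw norm_mult intro!: mult_left_mono \<omega>B\<close>)
    then have "norm (\<integral>x. of_real (k x) * fourier (?w t a) x \<partial>lborel) \<le> (\<integral>x. norm (k x) \<partial>lborel) * B * 1" by simp
    also have "\<dots> \<le> (\<integral>x. norm (k x) \<partial>lborel) * B * (1 + \<bar>a\<bar>) ^ N"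
      using B0 by (intro mult_left_mono mult_nonneg_nonneg) auto
    finally have "norm (\<integral>x. of_real (k x) * fourier (?w t a) x \<partial>lborel) \<le> (\<integral>x. norm (k x) \<partial>lborel) * B * (1 + \<bar>a\<bar>) ^ N" .
    then show ?thesis
      using M(2)[of t a] False norm_triangle_ineq4[of "distribution_of g (fourier (?w t a))" "\<integral>x. of_real (k x) * fourier (?w t a) x \<partial>lborel"]
      unfolding Fv M'_def by (simp add: algebra_simps)
  qed
  have iFv: "integrable lborel (fourier (v a))" for a
    by (rule integrable_compact_support[OF continuous_on_fourier[OF iv] Fv0])
  define E where "E = (\<lambda>a. laplace (fourier (v a)))"
  have E_hol: "E a holomorphic_on UNIV" for a
    unfolding E_def by (rule laplace_entire[OF iFv Fv0])
  have E_bd: "norm (E a z) \<le> (2 * (1 + \<delta>) * M') * (1 + \<bar>a\<bar>) ^ N * exp (2 * pi * (1 + \<delta>) * \<bar>Im z\<bar>)" for a z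
  proof -
    have "(\<integral>t. norm (fourier (v a) t) \<partial>lborel) \<le> (\<integral>t. indicator {-(1 + \<delta>)..1 + \<delta>} t * (M' * (1 + \<bar>a\<bar>) ^ N) \<partial>lborel)"
    proof (rule integral_mono)
      show "integrable lborel (\<lambda>t. indicator {-(1 + \<delta>)..1 + \<delta>} t * (M' * (1 + \<bar>a\<bar>) ^ N))"
        using emeasure_compact_finite[of "{-(1 + \<delta>)..1 + \<delta>}"]
        by (intro integrable_mult_left integrable_real_indicator) auto
      show "norm (fourier (v a) t) \<le> indicator {-(1 + \<delta>)..1 + \<delta>} t * (M' * (1 + \<bar>a\<bar>) ^ N)" for t
      proof (cases "1 + \<delta> < \<bar>t\<bar>")
        case True
        then show ?thesis using Fv0 M'0 by (auto split: split_indicator)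
      next
        case False
        then have "t \<in> {-(1 + \<delta>)..1 + \<delta>}" by (auto simp: abs_le_iff not_less)
        then show ?thesis using Fv_bd by simp
      qed
    qed (use iFv in simp)
    also have "\<dots> = (2 * (1 + \<delta>) * M') * (1 + \<bar>a\<bar>) ^ N" using \<delta> by simp
    finally have "(\<integral>t. norm (fourier (v a) t) \<partial>lborel) * exp (2 * pi * (1 + \<delta>) * \<bar>Im z\<bar>)
       \<le> (2 * (1 + \<delta>) * M') * (1 + \<bar>a\<bar>) ^ N * exp (2 * pi * (1 + \<delta>) * \<bar>Im z\<bar>)"
      by (rule mult_right_mono) simp
    then show ?thesis unfolding E_def using laplace_bound[OF iFv Fv0, where z=z] order_trans by blast
  qed
  have E_AE: "AE x in lborel. v a x = E a (of_real x)" for a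
    using fourier_inversion[OF iv iFv] by (simp add: E_def laplace_real)
  have shift_hol: "(\<lambda>z. \<Omega> (z - of_real b)) holomorphic_on UNIV" for b
    by (rule holomorphic_on_compose_gen[OF _ \<Omega>_hol, unfolded o_def]) (auto intro!: holomorphic_intros)
  have consistent: "E a z * \<Omega> (z - of_real b) = E b z * \<Omega> (z - of_real a)" for a b z
  proof -
    have hol: "(\<lambda>z. E a z * \<Omega> (z - of_real b)) holomorphic_on UNIV" for a b
      by (intro holomorphic_on_mult E_hol shift_hol)
    have "(\<lambda>z. E a z * \<Omega> (z - of_real b)) = (\<lambda>z. E b z * \<Omega> (z - of_real a))"
    proof (rule entire_eq_if_eq_on_reals[OF hol hol])
      fix x :: real
      have "AE x in lborel. E a (of_real x) * \<Omega> (of_real x - of_real b) = E b (of_real x) * \<Omega> (of_real x - of_real a)"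
        using E_AE[of a] E_AE[of b]
      proof eventually_elim
        case (elim x)
        have "\<Omega> (of_real x - of_real c) = \<omega> (x - c)" for c using \<Omega>_real[of "x - c"] by simp
        then show ?case by (simp add: elim[symmetric] v_def mult_ac)
      qed
      then show "E a (of_real x) * \<Omega> (of_real x - of_real b) = E b (of_real x) * \<Omega> (of_real x - of_real a)"
        by (rule continuous_AE_eq[OF continuous_on_real_restriction[OF hol[of a b]] continuous_on_real_restriction[OF hol[of b a]]])
    qed
    then show ?thesis by (rule fun_cong)
  qed
  obtain \<kappa> where \<kappa>: "0 < \<kappa>" "\<And>y. \<kappa> * exp (- (2 * pi * \<delta> * \<bar>y\<bar>)) \<le> norm (laplace ?b (\<i> * of_real y))"
    using bump_laplace_lower[OF \<delta>] by blast
  have \<Omega>_low: "\<kappa> * exp (- (2 * pi * \<delta> * \<bar>Im z\<bar>)) \<le> norm (\<Omega> (z - of_real (Re z)))" for z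
  proof -
    have "- (z - of_real (Re z)) = \<i> * of_real (- Im z)" by (simp add: complex_eq_iff)
    then show ?thesis using \<kappa>(2)[of "- Im z"] unfolding \<Omega>_def by simp
  qed
  have \<Omega>_nz: "\<Omega> (z - of_real (Re z)) \<noteq> 0" for z
    using \<Omega>_low[of z] mult_pos_pos[OF \<kappa>(1) exp_gt_zero[of "- (2 * pi * \<delta> * \<bar>Im z\<bar>)"]] by auto
  define l where "l = (\<lambda>z. E (Re z) z / \<Omega> (z - of_real (Re z)))"
  have l_eq: "l z = E a z / \<Omega> (z - of_real a)" if "\<Omega> (z - of_real a) \<noteq> 0" for a z
    using consistent[of "Re z" z a] that \<Omega>_nz[of z] by (simp add: l_def frac_eq_eq)
  have l_hol: "l holomorphic_on UNIV"
  proof -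
    have op: "open {z. \<Omega> (z - of_real a) \<noteq> 0}" for a
      by (intro open_Collect_neq holomorphic_on_imp_continuous_on shift_hol continuous_intros)
    have h: "l holomorphic_on {z. \<Omega> (z - of_real a) \<noteq> 0}" for a
    proof -
      have "(\<lambda>z. E a z / \<Omega> (z - of_real a)) holomorphic_on {z. \<Omega> (z - of_real a) \<noteq> 0}"
        by (intro holomorphic_on_divide holomorphic_on_subset[OF E_hol] holomorphic_on_subset[OF shift_hol]) auto
      then show ?thesis using l_eq by (subst holomorphic_cong[OF refl, where g="\<lambda>z. E a z / \<Omega> (z - of_real a)"]) auto
    qed
    have "l holomorphic_on (\<Union>a. {z. \<Omega> (z - of_real a) \<noteq> 0})"
      by (rule holomorphic_on_UN_open) (use h op in auto)
    moreover have "(\<Union>a. {z. \<Omega> (z - of_real a) \<noteq> 0}) = UNIV" using \<Omega>_nz by blast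
    ultimately show ?thesis by simp
  qed
  have l_bd: "norm (l z) \<le> (2 * (1 + \<delta>) * M' / \<kappa>) * (1 + norm z) ^ N * exp (2 * pi * (1 + 2 * \<delta>) * norm z)" for z
  proof -
    define A where "A = 2 * (1 + \<delta>) * M'"
    have A0: "0 \<le> A" using \<delta> M'0 by (simp add: A_def)
    have "norm (l z) \<le> (A * (1 + \<bar>Re z\<bar>) ^ N * exp (2 * pi * (1 + \<delta>) * \<bar>Im z\<bar>)) / (\<kappa> * exp (- (2 * pi * \<delta> * \<bar>Im z\<bar>)))"
      unfolding l_def norm_divide using \<kappa>(1) A0 E_bd[of "Re z" z]
      by (intro frac_le \<Omega>_low mult_nonneg_nonneg) (auto simp: A_def)
    also have "\<dots> = A / \<kappa> * (1 + \<bar>Re z\<bar>) ^ N * exp (2 * pi * (1 + \<delta>) * \<bar>Im z\<bar> + 2 * pi * \<delta> * \<bar>Im z\<bar>)"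
      by (simp only: exp_add exp_minus) (simp only: divide_inverse inverse_mult_distrib inverse_inverse_eq mult_ac)
    also have "2 * pi * (1 + \<delta>) * \<bar>Im z\<bar> + 2 * pi * \<delta> * \<bar>Im z\<bar> = 2 * pi * (1 + 2 * \<delta>) * \<bar>Im z\<bar>"
      by (simp add: algebra_simps)
    also have "A / \<kappa> * (1 + \<bar>Re z\<bar>) ^ N * exp (2 * pi * (1 + 2 * \<delta>) * \<bar>Im z\<bar>)
        \<le> A / \<kappa> * (1 + norm z) ^ N * exp (2 * pi * (1 + 2 * \<delta>) * norm z)"
      using A0 \<kappa>(1) \<delta> by (intro mult_mono power_mono mult_nonneg_nonneg) (auto simp: abs_Re_le_cmod abs_Im_le_cmod)
    finally show ?thesis by (simp add: A_def)
  qed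
  \<comment> \<open>Rational translates are enough to avoid the zeros of \<open>\<Omega>\<close>, and there are only countably many null
    sets to discard.\<close>
  have "AE x in lborel. \<forall>q\<in>\<rat>. v q x = E q (of_real x)"
    by (subst AE_ball_countable) (use E_AE countable_rat in auto)
  then have "AE x in lborel. l (of_real x) = of_real (g x - k x)"
  proof eventually_elim
    case (elim x)
    have "open {a. \<Omega> (of_real x - of_real a) \<noteq> 0}"
    proof -
      have "continuous_on UNIV (\<lambda>a::real. \<Omega> (of_real x - of_real a))"
        by (rule continuous_on_compose2[OF holomorphic_on_imp_continuous_on[OF \<Omega>_hol]]) (auto intro!: continuous_intros)
      then show ?thesis by (intro open_Collect_neq continuous_intros)
    qed
    moreover have "x \<in> {a. \<Omega> (of_real x - of_real a) \<noteq> 0}" using \<Omega>_nz[of "of_real x"] by simp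
    ultimately obtain e where e: "0 < e" "ball x e \<subseteq> {a. \<Omega> (of_real x - of_real a) \<noteq> 0}"
      unfolding open_contains_ball by blast
    obtain q where q: "q \<in> \<rat>" "x < q" "q < x + e" using Rats_dense_in_real[of x "x + e"] e(1) by auto
    then have nz: "\<Omega> (of_real x - of_real q) \<noteq> 0" using e(2) by (auto simp: dist_real_def subset_iff)
    have "l (of_real x) = v q x / \<Omega> (of_real x - of_real q)" using l_eq[OF nz] elim q(1) by simp
    also have "\<dots> = of_real (g x - k x)"
      using nz \<Omega>_real[of "x - q"] by (simp add: v_def)
    finally show ?case .
  qed
  then show ?thesis
    using l_hol l_bd \<delta> M'0 \<kappa>(1)
    by (intro exI[of _ l] conjI exI[of _ "2 * (1 + \<delta>) * M' / \<kappa>"] exI[of _ N] allI) auto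
qed

text \<open>
A distribution with spectrum in \<open>[-1, 1]\<close> that is given by a function is almost everywhere an entire
function of type \<open>2\<pi>\<close>. For each \<open>\<delta>\<close> the preceding lemma gives type \<open>2\<pi>(1 + 2\<delta>)\<close>; the entire
functions obtained for different \<open>\<delta>\<close> agree almost everywhere on the line and so coincide.
\<close>
theorem paley_wiener_schwartz:
  fixes g k :: "real \<Rightarrow> real"
  assumes temp: "defines_tempered_distribution g" and k: "integrable lborel k"
    and spec: "\<And>\<phi>. schwartz \<phi> \<Longrightarrow> support \<phi> \<subseteq> - {-1..1} \<Longrightarrow>
      distribution_of g (fourier \<phi>) = (\<integral>x. of_real (k x) * fourier \<phi> x \<partial>lborel)"
  obtains l where "l holomorphic_on UNIV" "exponential_type (2 * pi) l"
    "AE x in lborel. l (of_real x) = of_real (g x - k x)"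
proof -
  let ?P = "\<lambda>\<delta> l. l holomorphic_on UNIV \<and> (\<exists>A N. 0 \<le> A \<and> (\<forall>z. norm (l z) \<le> A * (1 + norm z) ^ N * exp (2 * pi * (1 + 2 * \<delta>) * norm z)))
     \<and> (AE x in lborel. l (of_real x) = of_real (g x - k x))"
  have ex: "\<exists>l. ?P \<delta> l" if "0 < \<delta>" for \<delta> by (rule band_extension[OF that temp k spec])
  obtain l where l: "?P 1 l" using ex[of 1] by auto
  \<comment> \<open>Continuous functions that agree almost everywhere agree on the line, and so on the plane.\<close>
  have same: "l' = l" if l': "?P \<delta> l'" for l' \<delta>
  proof (rule entire_eq_if_eq_on_reals)
    fix x :: real
    have "AE x in lborel. l' (of_real x) = of_real (g x - k x)" "AE x in lborel. l (of_real x) = of_real (g x - k x)"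
      using l l' by blast+
    then have "AE x in lborel. l' (of_real x) = l (of_real x)" by eventually_elim simp
    then show "l' (of_real x) = l (of_real x)"
      using l l' by (intro continuous_AE_eq[of "\<lambda>x. l' (of_real x)" "\<lambda>x. l (of_real x)"] continuous_on_real_restriction) auto
  qed (use l l' in auto)
  have "exponential_type (2 * pi) l"
    unfolding exponential_type_def
  proof (intro allI impI)
    fix \<epsilon> :: real assume \<epsilon>: "0 < \<epsilon>"
    \<comment> \<open>This makes \<open>2\<pi> * 2\<delta> = \<epsilon>/2\<close>; the other half of \<open>\<epsilon>\<close> absorbs the polynomial factor.\<close>
    define \<delta> where "\<delta> = \<epsilon> / (8 * pi)"
    have \<delta>: "0 < \<delta>" using \<epsilon> by (simp add: \<delta>_def)
    obtain l' where l': "?P \<delta> l'" using ex[OF \<delta>] by blast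
    have "?P \<delta> l" using l' unfolding same[OF l'] .
    then obtain A N where A: "0 \<le> A" "\<And>z. norm (l z) \<le> A * (1 + norm z) ^ N * exp (2 * pi * (1 + 2 * \<delta>) * norm z)"
      by blast
    obtain C where C: "0 < C" "\<And>x. 0 \<le> x \<Longrightarrow> (1 + x) ^ N \<le> C * exp (\<epsilon> / 2 * x)"
      using polynomial_le_exponential[of "\<epsilon> / 2" N] \<epsilon> by auto
    have "norm (l z) \<le> (A * C + 1) * exp ((2 * pi + \<epsilon>) * norm z)" for z
    proof -
      have "norm (l z) \<le> A * (C * exp (\<epsilon> / 2 * norm z)) * exp (2 * pi * (1 + 2 * \<delta>) * norm z)"
        using A C(2)[of "norm z"] by (intro order_trans[OF A(2)] mult_right_mono mult_left_mono) auto
      also have "\<dots> = A * C * exp (\<epsilon> / 2 * norm z + 2 * pi * (1 + 2 * \<delta>) * norm z)"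
        by (simp only: exp_add mult.assoc)
      also have "\<epsilon> / 2 * norm z + 2 * pi * (1 + 2 * \<delta>) * norm z = (2 * pi + \<epsilon>) * norm z"
        by (simp add: \<delta>_def field_simps)
      also have "A * C * exp ((2 * pi + \<epsilon>) * norm z) \<le> (A * C + 1) * exp ((2 * pi + \<epsilon>) * norm z)"
        by (intro mult_right_mono) auto
      finally show ?thesis .
    qed
    moreover have "0 < A * C + 1" using A C by (simp add: add_nonneg_pos)
    ultimately show "\<exists>C>0. \<forall>z. norm (l z) \<le> C * exp ((2 * pi + \<epsilon>) * norm z)" by blast
  qed
  then show ?thesis using that l by blast
qed

section \<open>Minorants that interpolate at the half-integers\<close>

lemma exponential_type_diff:
  assumes "exponential_type \<tau> F" "exponential_type \<tau> H"
  shows "exponential_type \<tau> (\<lambda>z. F z - H z)"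
  unfolding exponential_type_def
proof (intro allI impI)
  fix \<epsilon> :: real assume "0 < \<epsilon>"
  then obtain A B where A: "A > 0" "\<And>z. norm (F z) \<le> A * exp ((\<tau> + \<epsilon>) * norm z)"
    and B: "B > 0" "\<And>z. norm (H z) \<le> B * exp ((\<tau> + \<epsilon>) * norm z)"
    using assms unfolding exponential_type_def by meson
  have "norm (F z - H z) \<le> (A + B) * exp ((\<tau> + \<epsilon>) * norm z)" for z
    using A(2)[of z] B(2)[of z] norm_triangle_ineq4[of "F z" "H z"] by (simp add: distrib_right)
  then show "\<exists>C>0. \<forall>z. norm (F z - H z) \<le> C * exp ((\<tau> + \<epsilon>) * norm z)"
    using A(1) B(1) by (intro exI[of _ "A + B"]) auto
qed

lemma exponential_type_cos_squared: "exponential_type (2 * pi) (\<lambda>z. (cos (of_real pi * z))\<^sup>2)"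
  unfolding exponential_type_def
proof (intro allI impI exI conjI)
  fix \<epsilon> :: real and z :: complex assume e: "0 < \<epsilon>"
  have "norm (cos w) \<le> exp (norm w)" for w :: complex
  proof -
    have "norm (exp (\<i> * w) + exp (- (\<i> * w))) \<le> exp (norm w) + exp (norm w)"
      by (intro order_trans[OF norm_triangle_ineq] add_mono) (use abs_Im_le_cmod[of w] in auto)
    then show ?thesis unfolding cos_exp_eq norm_divide by simp
  qed
  from this[of "of_real pi * z"] have "norm (cos (of_real pi * z)) ^ 2 \<le> exp (pi * norm z) ^ 2"
    by (intro power_mono) (auto simp: norm_mult)
  also have "\<dots> = exp (2 * pi * norm z)" by (simp flip: exp_of_nat_mult)
  also have "\<dots> \<le> exp ((2 * pi + \<epsilon>) * norm z)" using e by (simp add: mult_right_mono)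
  finally show "norm ((cos (of_real pi * z))\<^sup>2) \<le> 1 * exp ((2 * pi + \<epsilon>) * norm z)" by (simp add: norm_power)
qed simp

text \<open>
If the distance were infinite, every minorant would be extremal. Subtracting \<open>cos\<^sup>2(\<pi>z)\<close>, which is of type
\<open>2\<pi>\<close> and vanishes at the half-integers, would then give a second extremal minorant that interpolates.
\<close>
lemma unique_interpolating_extremal_imp_finite_distance:
  assumes L: "extremal_minorant f L" "interpolates_at_half_integers f L"
    and unique: "\<And>F. extremal_minorant f F \<Longrightarrow> interpolates_at_half_integers f F \<Longrightarrow> F = L"
  shows "L1_distance L f < \<infinity>"
proof (rule ccontr)
  assume "\<not> L1_distance L f < \<infinity>"
  then have inf: "L1_distance F f = \<infinity>" if "minorant_on UNIV f F" for F
    using L(1) that unfolding extremal_minorant_on_def by (metis infinity_ennreal_def neq_top_trans top.not_eq_extremum)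
  define H where "H = (\<lambda>z. L z - (cos (of_real pi * z))\<^sup>2)"
  have m: "minorant_on UNIV f L" using L(1) by (simp add: extremal_minorant_on_def)
  have cosx: "(cos (of_real pi * of_real x))\<^sup>2 = complex_of_real ((cos (pi * x))\<^sup>2)" for x
    by (simp add: cos_of_real[symmetric])
  have mH: "minorant_on UNIV f H"
    unfolding minorant_on_def
  proof (intro conjI allI ballI)
    show "H holomorphic_on UNIV" unfolding H_def using m by (auto simp: minorant_on_def intro!: holomorphic_intros)
    show "exponential_type (2 * pi) H"
      unfolding H_def using m exponential_type_cos_squared by (intro exponential_type_diff) (auto simp: minorant_on_def)
    fix x :: real
    show "H (of_real x) \<in> \<real>" unfolding H_def cosx using m by (intro Reals_diff) (auto simp: minorant_on_def)
    have "Re (L (of_real x)) \<le> f x" using m by (auto simp: minorant_on_def)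
    then show "Re (H (of_real x)) \<le> f x"
      unfolding H_def cosx minus_complex.sel Re_complex_of_real using zero_le_power2[of "cos (pi * x)"] by linarith
  qed
  have "extremal_minorant f H"
    unfolding extremal_minorant_on_def using mH inf by (auto simp: inf[OF mH])
  moreover have "interpolates_at_half_integers f H"
    unfolding interpolates_at_half_integers_def
  proof
    fix n :: int
    have "cos (pi * (of_int n + 1/2)) = 0" using cos_zero_iff_int[of "pi * (of_int n + 1/2)"]
      by (auto simp: algebra_simps intro!: exI[of _ "2 * n + 1"])
    then show "H (of_real (of_int n + 1/2)) = of_real (f (of_int n + 1/2))"
      using L(2) unfolding H_def cosx interpolates_at_half_integers_def by simp
  qed
  ultimately have "H = L" by (rule unique)
  then have "H 0 = L 0" by simp
  then show False by (simp add: H_def)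
qed

text \<open>
The difference has a local minimum at the point of contact.
\<close>
lemma contact_derivative_eq:
  fixes f h :: "real \<Rightarrow> real"
  assumes le: "\<forall>\<^sub>F y in nhds x. h y \<le> f y" and eq: "h x = f x"
    and f: "(f has_real_derivative f') (at x)" and h: "(h has_real_derivative h') (at x)"
  shows "h' = f'"
proof -
  obtain d where d: "0 < d" "\<And>y. dist y x < d \<Longrightarrow> h y \<le> f y"
    using le unfolding eventually_nhds_metric by blast
  have "((\<lambda>y. f y - h y) has_real_derivative f' - h') (at x)" using f h by (rule DERIV_diff)
  then have "f' - h' = 0"
    by (rule DERIV_local_min[OF _ d(1)]) (use d(2) eq in \<open>auto simp: dist_real_def abs_minus_commute\<close>)
  then show ?thesis by simp
qed

lemma Re_restriction_has_derivative:
  assumes "F holomorphic_on UNIV"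
  shows "((\<lambda>y. Re (F (of_real y))) has_real_derivative Re (deriv F (of_real x))) (at x)"
proof -
  have "((\<lambda>y. F (of_real y)) has_vector_derivative deriv F (of_real x)) (at x)"
    by (rule real_restriction_has_derivative[OF assms])
  then have "((\<lambda>y. Re (F (of_real y))) has_derivative (\<lambda>h. Re (h *\<^sub>R deriv F (of_real x)))) (at x)"
    unfolding has_vector_derivative_def by (rule has_derivative_Re)
  then show ?thesis
    unfolding has_field_derivative_def by (rule has_derivative_eq_rhs) (auto simp: fun_eq_iff)
qed

lemma real_deriv:
  assumes hol: "F holomorphic_on UNIV" and real: "\<And>x::real. F (of_real x) \<in> \<real>"
  shows "deriv F (of_real x) \<in> \<real>"
proof -
  have "((\<lambda>y. F (of_real y)) has_vector_derivative deriv F (of_real x)) (at x)"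
    by (rule real_restriction_has_derivative[OF hol])
  then have "((\<lambda>y. Im (F (of_real y))) has_derivative (\<lambda>h. Im (h *\<^sub>R deriv F (of_real x)))) (at x)"
    unfolding has_vector_derivative_def by (rule has_derivative_Im)
  moreover have "(\<lambda>y. Im (F (complex_of_real y))) = (\<lambda>y. 0)" using real by (auto simp: complex_is_Real_iff)
  ultimately have "((\<lambda>y::real. 0::real) has_derivative (\<lambda>h. Im (h *\<^sub>R deriv F (of_real x)))) (at x)" by simp
  then have "(\<lambda>h. Im (h *\<^sub>R deriv F (of_real x))) = (\<lambda>h. 0)"
    using has_derivative_unique has_derivative_const by blast
  then have "Im (1 *\<^sub>R deriv F (of_real x)) = 0" by (rule fun_cong)
  then show ?thesis by (simp add: complex_is_Real_iff)
qed

lemma half_integer_nonzero: "real_of_int n + 1/2 \<noteq> 0"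
proof
  assume "real_of_int n + 1/2 = 0"
  then have "of_int (2 * n) = (- 1::real)" by simp
  then have "2 * n = - 1" by (metis of_int_eq_iff of_int_minus of_int_1)
  then show False by presburger
qed

text \<open>
The enumeration \<open>0, -1, 1, -2, 2, ...\<close> of the integers grows linearly; the factor \<open>1/3\<close> is convenient and
not sharp.
\<close>
lemma int_decode_abs: "(real n + 1) / 3 \<le> max 1 \<bar>real_of_int (int_decode n)\<bar>"
proof (cases "even n")
  case True
  then obtain k where "n = 2 * k" by (auto elim: evenE)
  then show ?thesis by (simp add: int_decode_def sum_decode_def max_def)
next
  case False
  then obtain k where "n = 2 * k + 1" by (auto elim: oddE)
  then show ?thesis by (simp add: int_decode_def sum_decode_def max_def)
qed

text \<open>
The decay of \<open>f\<close> supplies the summable bounds of \<open>fejer_poisson\<close> at the sample points \<open>1/2 + m\<close>, whose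
cells are the intervals \<open>[m, m + 1)\<close>.
\<close>
lemma powr_decay_pieces:
  assumes "0 < \<epsilon>" and bd: "\<And>x. norm (f x) \<le> C * (1 + \<bar>x\<bar>) powr (- 1 - \<epsilon>)" and C: "0 < C"
  defines "\<beta> \<equiv> (\<lambda>m::int. C * max 1 \<bar>real_of_int m\<bar> powr (- 1 - \<epsilon>))"
  shows "u \<in> unit_cell \<Longrightarrow> norm (f (1/2 + (of_int m + u))) \<le> \<beta> m"
    and "summable (\<lambda>n. \<beta> (int_decode n))"
proof -
  assume u: "u \<in> unit_cell"
  have "max 1 \<bar>real_of_int m\<bar> \<le> 1 + \<bar>1/2 + (of_int m + u)\<bar>"
  proof (cases "0 \<le> m")
    case True
    then have "0 \<le> real_of_int m" by simp
    then show ?thesis using u by auto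
  next
    case False
    then have "real_of_int m \<le> real_of_int (- 1)" unfolding of_int_le_iff by simp
    then show ?thesis using u by auto
  qed
  then have "(1 + \<bar>1/2 + (of_int m + u)\<bar>) powr (- 1 - \<epsilon>) \<le> max 1 \<bar>real_of_int m\<bar> powr (- 1 - \<epsilon>)"
    using assms(1) by (intro powr_mono2') auto
  then show "norm (f (1/2 + (of_int m + u))) \<le> \<beta> m"
    unfolding \<beta>_def using C by (intro order_trans[OF bd] mult_left_mono) auto
next
  have "summable (\<lambda>n. real n powr (- 1 - \<epsilon>))" using assms(1) by (simp add: summable_real_powr_iff)
  then have "summable (\<lambda>n. real (Suc n) powr (- 1 - \<epsilon>))" by (subst summable_Suc_iff)
  then have s: "summable (\<lambda>n. C * (1/3) powr (- 1 - \<epsilon>) * real (Suc n) powr (- 1 - \<epsilon>))" by (rule summable_mult)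
  show "summable (\<lambda>n. \<beta> (int_decode n))"
  proof (rule summable_comparison_test[OF _ s], intro exI allI impI)
    fix n
    have "max 1 \<bar>real_of_int (int_decode n)\<bar> powr (- 1 - \<epsilon>) \<le> ((1/3) * real (Suc n)) powr (- 1 - \<epsilon>)"
      using int_decode_abs[of n] assms(1) by (intro powr_mono2') auto
    also have "\<dots> = (1/3) powr (- 1 - \<epsilon>) * real (Suc n) powr (- 1 - \<epsilon>)"
      by (rule powr_mult) 
    finally show "norm (\<beta> (int_decode n)) \<le> C * (1/3) powr (- 1 - \<epsilon>) * real (Suc n) powr (- 1 - \<epsilon>)"
      unfolding \<beta>_def using C by (simp add: abs_mult mult.assoc)
  qed
qed

text \<open>
One member \<open>G\<close> of a minorant family with its extremal minorant \<open>L\<close>. Extremality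
enters through the finite distance, see \<open>unique_interpolating_extremal_imp_finite_distance\<close>.
\<close>
locale interpolated_minorant =
  fixes G :: "real \<Rightarrow> real" and L :: "complex \<Rightarrow> complex" and C \<epsilon> :: real
  assumes cont: "continuous_on UNIV G"
    and diff: "G differentiable_on (- {0})"
    and C: "0 < C" and \<epsilon>: "0 < \<epsilon>"
    and decay: "\<And>x. \<bar>G x\<bar> \<le> C * (1 + \<bar>x\<bar>) powr (- 1 - \<epsilon>)"
    and nonneg: "\<And>t. fourier (\<lambda>x. of_real (G x)) t \<in> \<real>\<^sub>\<ge>\<^sub>0"
    and radial: "\<And>t u. \<bar>t\<bar> \<le> \<bar>u\<bar> \<Longrightarrow> Re (fourier (\<lambda>x. of_real (G x)) u) \<le> Re (fourier (\<lambda>x. of_real (G x)) t)"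
    and minorant: "minorant_on UNIV G L"
    and interp: "interpolates_at_half_integers G L"
    and finite_distance: "L1_distance L G < \<infinity>"
begin

definition K :: "real \<Rightarrow> real" where "K x = G x - Re (L (of_real x))"

lemma K_nonneg: "0 \<le> K x" using minorant by (simp add: minorant_on_def K_def)

lemma L_real: "L (of_real x) = of_real (G x - K x)"
  using minorant by (auto simp: minorant_on_def K_def complex_is_Real_iff complex_eq_iff)

lemma L_entire: "L holomorphic_on UNIV" using minorant by (simp add: minorant_on_def)

lemma K_continuous: "continuous_on UNIV K"
proof -
  have "continuous_on UNIV (\<lambda>x::real. L (of_real x))"
    by (rule continuous_on_real_restriction[OF L_entire])
  then show ?thesis unfolding K_def[abs_def] by (intro continuous_intros cont)
qed

lemma K_measurable [measurable]: "K \<in> borel_measurable borel"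
  by (rule borel_measurable_continuous_onI[OF K_continuous])

lemma K_integrable: "integrable lborel K"
proof (rule integrableI_bounded)
  have "norm (K x) = \<bar>Re (L (of_real x)) - G x\<bar>" for x by (simp add: K_def abs_minus_commute)
  then show "(\<integral>\<^sup>+x. ennreal (norm (K x)) \<partial>lborel) < \<infinity>"
    using finite_distance by (simp add: L1_distance_def)
qed simp

lemma G_integrable: "integrable lborel (\<lambda>x. complex_of_real (G x))"
proof (rule unit_interval_decomposition(1))
  show "(\<lambda>x. complex_of_real (G x)) \<in> borel_measurable borel"
    using borel_measurable_continuous_onI[OF cont] by measurable
  show "norm (complex_of_real (G (1/2 + (of_int m + u)))) \<le> C * max 1 \<bar>real_of_int m\<bar> powr (- 1 - \<epsilon>)"
    if "u \<in> unit_cell" for m u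
    using powr_decay_pieces(1)[OF \<epsilon> _ C that, of "\<lambda>x. complex_of_real (G x)" m] decay by simp
  show "summable (\<lambda>n. C * max 1 \<bar>real_of_int (int_decode n)\<bar> powr (- 1 - \<epsilon>))"
    using powr_decay_pieces(2)[OF \<epsilon> _ C, of "\<lambda>x. complex_of_real (G x)"] decay by simp
qed

sublocale bandlimited L
proof
  show "exponential_type (2 * pi) L" using minorant by (simp add: minorant_on_def)
  have "integrable lborel (\<lambda>x. complex_of_real (G x) - complex_of_real (K x))"
    using K_integrable by (intro Bochner_Integration.integrable_diff G_integrable integrable_of_real)
  then show "integrable lborel (\<lambda>x. L (of_real x))" by (simp add: L_real)
qed (rule L_entire)

abbreviation G_hat :: "real \<Rightarrow> complex" where "G_hat \<equiv> fourier (\<lambda>x. of_real (G x))"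
abbreviation K_hat :: "real \<Rightarrow> complex" where "K_hat \<equiv> fourier (\<lambda>x. of_real (K x))"

lemma fourier_K: "K_hat t = G_hat t - spectrum t"
proof -
  have "G_hat t - spectrum t = (\<integral>x. of_real (G x) * e2pi (- (x * t)) - L (of_real x) * e2pi (- (x * t)) \<partial>lborel)"
    unfolding spectrum_def fourier_e2pi
    using integrable_mult_e2pi[OF G_integrable, of "-t" 0] integrable_mult_e2pi[OF int, of "-t" 0]
    by (intro Bochner_Integration.integral_diff[symmetric]) (simp_all add: mult.commute[of t])
  also have "\<dots> = K_hat t"
    unfolding fourier_e2pi by (intro Bochner_Integration.integral_cong refl) (simp add: L_real algebra_simps)
  finally show ?thesis by simp
qed

lemma fourier_K_outside: "1 \<le> \<bar>t\<bar> \<Longrightarrow> K_hat t = G_hat t"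
  by (simp add: fourier_K spectrum_eq_0)

definition fejer_integral :: "nat \<Rightarrow> real" where
  "fejer_integral N = (\<integral>y. K y * fejer_kernel N (y - 1/2) \<partial>lborel)"

lemma fejer_integral_eq:
  "of_real (fejer_integral N) = fejer_mean N (\<lambda>n. K_hat (of_int n) * e2pi (of_int n * (1/2)))"
proof -
  have "integrable lborel (\<lambda>x. complex_of_real (K x))" using K_integrable by (rule integrable_of_real)
  from fejer_mean_fourier[OF this, of N "1/2"] show ?thesis
    unfolding fejer_integral_def by (simp add: integral_complex_of_real[symmetric])
qed

lemma fejer_integral_nonneg: "0 \<le> fejer_integral N"
  unfolding fejer_integral_def by (intro integral_nonneg_AE AE_I2 mult_nonneg_nonneg K_nonneg fejer_kernel_nonneg)

text \<open>
The Fejer mean at \<open>1/2\<close> has coefficients \<open>(-1)\<^sup>n a\<^bsub>\<bar>n\<bar>\<^esub>\<close>, where \<open>a\<^sub>0\<close> is the integral of \<open>K\<close> and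
\<open>a\<^sub>n\<close> for \<open>n \<ge> 1\<close> is the transform of \<open>G\<close>, non-negative and non-increasing. The bound is independent
of \<open>N\<close> and integrable over the parameter, as dominated convergence requires.
\<close>
lemma fejer_integral_le: "fejer_integral N \<le> (\<integral>x. K x \<partial>lborel)"
proof (cases "N = 0")
  case True
  have "0 \<le> (\<integral>x. K x \<partial>lborel)" by (intro integral_nonneg_AE AE_I2 K_nonneg)
  then show ?thesis using True by (simp add: fejer_integral_def fejer_kernel_def)
next
  case False
  define a where "a = (\<lambda>n::nat. if n = 0 then (\<integral>x. K x \<partial>lborel) else Re (G_hat (real n)))"
  have "Re (fejer_mean N (\<lambda>n. K_hat (of_int n) * e2pi (of_int n * (1/2)))) \<le> a 0"
  proof (rule fejer_mean_alternating_le)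
    show "0 \<le> a n" for n
      using nonneg[of "real n"] by (auto simp: a_def complex_nonneg_Reals_iff intro!: integral_nonneg_AE AE_I2 K_nonneg)
    show "a (Suc n) \<le> a n" if "1 \<le> n" for n
      using that radial[of "real n" "real (Suc n)"] by (simp add: a_def)
    show "K_hat (of_int n) * e2pi (of_int n * (1/2)) = of_real ((- 1) ^ nat \<bar>n\<bar> * a (nat \<bar>n\<bar>))" for n
    proof -
      have pow: "e2pi (real k * (1/2)) = (- 1) ^ k" for k
      proof (induction k)
        case (Suc k)
        have "real (Suc k) * (1/2) = real k * (1/2) + 1/2" by (simp add: field_simps)
        then show ?case by (simp only: e2pi_add Suc e2pi_half power_Suc2)
      qed simp
      have ph: "e2pi (of_int n * (1/2)) = (- 1) ^ nat \<bar>n\<bar>"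
      proof (cases "0 \<le> n")
        case True
        then show ?thesis using pow[of "nat n"] by simp
      next
        case False
        then have "e2pi (of_int n * (1/2)) = cnj (e2pi (real (nat \<bar>n\<bar>) * (1/2)))" by (simp flip: e2pi_minus)
        then show ?thesis unfolding pow by simp
      qed
      have "K_hat (of_int n) = of_real (a (nat \<bar>n\<bar>))"
      proof (cases "n = 0")
        case True
        then show ?thesis by (simp add: a_def fourier_e2pi integral_complex_of_real)
      next
        case False
        then have "1 \<le> \<bar>n\<bar>" by linarith
        then have n1: "1 \<le> \<bar>real_of_int n\<bar>" by (metis of_int_1_le_iff of_int_abs)
        have "Re (G_hat (of_int n)) = Re (G_hat \<bar>of_int n\<bar>)"
          by (intro order_antisym radial) auto
        moreover have "Im (G_hat (of_int n)) = 0"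
          using nonneg[of "of_int n"] by (simp add: complex_nonneg_Reals_iff)
        ultimately show ?thesis
          unfolding fourier_K_outside[OF n1] using False by (simp add: a_def complex_eq_iff)
      qed
      then show ?thesis unfolding ph by simp
    qed
  qed (use False in simp)
  then show ?thesis unfolding fejer_integral_eq[symmetric] by (simp add: a_def)
qed

text \<open>
The means for \<open>G\<close> converge to \<open>\<Sum> G(n + 1/2)\<close> by Poisson summation. The means for \<open>L\<close> are
all equal to \<open>\<integral> L\<close>, which is \<open>\<Sum> L(n + 1/2)\<close> by \<open>sample_mean_limit\<close>; and \<open>L\<close> interpolates \<open>G\<close>.
\<close>
lemma fejer_integral_tendsto_0: "fejer_integral \<longlonglongrightarrow> 0"
proof -
  define S where "S = (\<Sum>n. complex_of_real (G (1/2 + of_int (int_decode n))))"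
  have pieces: "norm (complex_of_real (G (1/2 + (of_int m + u)))) \<le> C * max 1 \<bar>real_of_int m\<bar> powr (- 1 - \<epsilon>)"
    if "u \<in> unit_cell" for m u
    using powr_decay_pieces(1)[OF \<epsilon> _ C that, of "\<lambda>x. complex_of_real (G x)" m] decay by simp
  have sum: "summable (\<lambda>n. C * max 1 \<bar>real_of_int (int_decode n)\<bar> powr (- 1 - \<epsilon>))"
    using powr_decay_pieces(2)[OF \<epsilon> _ C, of "\<lambda>x. complex_of_real (G x)"] decay by simp
  have "(\<lambda>N. fejer_mean N (\<lambda>n. G_hat (of_int n) * e2pi (of_int n * (1/2)))) \<longlonglongrightarrow> S"
    unfolding S_def by (rule fejer_poisson(2)[OF _ pieces sum]) (auto intro!: continuous_intros cont)
  moreover have "fejer_mean N (\<lambda>n. spectrum (of_int n) * e2pi (of_int n * (1/2))) = (\<integral>x. L (of_real x) \<partial>lborel)" if "0 < N" for N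
  proof -
    have "spectrum (of_int n) * e2pi (of_int n * (1/2)) = (if n = 0 then (\<integral>x. L (of_real x) \<partial>lborel) else 0)" for n
    proof (cases "n = 0")
      case True then show ?thesis by (simp add: spectrum_def fourier_e2pi)
    next
      case False
      then have "1 \<le> \<bar>n\<bar>" by linarith
      then have "1 \<le> \<bar>real_of_int n\<bar>" by (metis of_int_1_le_iff of_int_abs)
      then show ?thesis using False by (simp add: spectrum_eq_0)
    qed
    then show ?thesis using that by (simp add: fejer_mean_def)
  qed
  then have "(\<lambda>N. fejer_mean N (\<lambda>n. spectrum (of_int n) * e2pi (of_int n * (1/2)))) \<longlonglongrightarrow> (\<integral>x. L (of_real x) \<partial>lborel)"
    by (intro tendsto_eventually) (auto intro!: eventually_sequentiallyI[of 1])
  moreover have "(\<integral>x. L (of_real x) \<partial>lborel) = S"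
  proof (rule LIMSEQ_unique)
    have "fejer_mean N (\<lambda>n. L (of_real (1/2 - of_int n))) = fejer_mean N (\<lambda>n. complex_of_real (G (1/2 + of_int n)))" for N
    proof -
      have "fejer_mean N (\<lambda>n. L (of_real (1/2 - of_int n))) = fejer_mean N (\<lambda>n. L (of_real (of_int n + 1/2)))"
        unfolding fejer_mean_def by (subst sum.swap) (simp add: algebra_simps)
      also have "\<dots> = fejer_mean N (\<lambda>n. complex_of_real (G (1/2 + of_int n)))"
        by (rule fejer_mean_cong) (use interp in \<open>simp add: interpolates_at_half_integers_def add.commute\<close>)
      finally show ?thesis .
    qed
    then show "(\<lambda>N. fejer_mean N (\<lambda>n. complex_of_real (G (1/2 + of_int n)))) \<longlonglongrightarrow> (\<integral>x. L (of_real x) \<partial>lborel)"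
      using sample_mean_limit by simp
    show "(\<lambda>N. fejer_mean N (\<lambda>n. complex_of_real (G (1/2 + of_int n)))) \<longlonglongrightarrow> S"
      unfolding S_def
    proof (rule fejer_mean_summable)
      show "summable (\<lambda>n. norm (complex_of_real (G (1/2 + of_int (int_decode n)))))"
        by (rule summable_comparison_test[OF _ sum]) (use pieces[of 0] in auto)
    qed
  qed
  ultimately have "(\<lambda>N. fejer_mean N (\<lambda>n. G_hat (of_int n) * e2pi (of_int n * (1/2)))
      - fejer_mean N (\<lambda>n. spectrum (of_int n) * e2pi (of_int n * (1/2)))) \<longlonglongrightarrow> S - S"
    by (intro tendsto_diff) simp_all
  moreover have "fejer_mean N (\<lambda>n. G_hat (of_int n) * e2pi (of_int n * (1/2)))
      - fejer_mean N (\<lambda>n. spectrum (of_int n) * e2pi (of_int n * (1/2))) = of_real (fejer_integral N)" for N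
    unfolding fejer_integral_eq fourier_K fejer_mean_def
    by (simp add: sum_subtractf left_diff_distrib diff_divide_distrib)
  ultimately have "(\<lambda>N. complex_of_real (fejer_integral N)) \<longlonglongrightarrow> of_real 0" by simp
  then show ?thesis by (simp only: tendsto_of_real_iff)
qed

text \<open>
\<open>L\<close> touches \<open>G\<close> from below at the half-integers, so it has the same slope there. The slope is written as a
limit of difference quotients of \<open>G\<close>, which depend measurably on a parameter.
\<close>
lemma slope_interpolation:
  "(\<lambda>k. (G (1/2 - of_int n + 1 / real (Suc k)) - G (1/2 - of_int n)) / (1 / real (Suc k)))
    \<longlonglongrightarrow> Re (deriv L (of_real (1/2 - of_int n)))"
proof -
  define x :: real where "x = 1/2 - of_int n"
  have x_eq: "x = of_int (- n) + 1/2" by (simp add: x_def)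
  have x0: "x \<noteq> 0" unfolding x_eq by (rule half_integer_nonzero)
  have "G differentiable (at x)"
    using diff x0 differentiable_on_eq_differentiable_at[of "- {0::real}" G] by (simp add: open_Compl)
  then obtain G' where G': "(G has_real_derivative G') (at x)" by (metis real_differentiable_def)
  have "Re (deriv L (of_real x)) = G'"
  proof (rule contact_derivative_eq[OF _ _ G' Re_restriction_has_derivative[OF L_entire]])
    show "\<forall>\<^sub>F y in nhds x. Re (L (of_real y)) \<le> G y"
      using minorant by (intro always_eventually) (simp add: minorant_on_def)
    show "Re (L (of_real x)) = G x"
      using interp x_eq unfolding interpolates_at_half_integers_def by (metis Re_complex_of_real)
  qed
  moreover have "(\<lambda>k. (G (x + 1 / real (Suc k)) - G x) / (1 / real (Suc k))) \<longlonglongrightarrow> G'"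
  proof -
    have "((\<lambda>h. (G (x + h) - G x) / h) \<longlongrightarrow> G') (at 0)" using G' by (simp add: DERIV_def)
    moreover have "filterlim (\<lambda>k. 1 / real (Suc k)) (at 0) sequentially"
      by (rule filterlim_atI[OF LIMSEQ_Suc[OF lim_1_over_n]]) (rule always_eventually, simp)
    ultimately show ?thesis by (rule filterlim_compose)
  qed
  ultimately show ?thesis unfolding x_def[symmetric] by simp
qed

end

section \<open>Dependence on the parameter and averages\<close>

text \<open>
\<open>f s x\<close> is the limit of its values at rational approximations of \<open>x\<close> from below, and each of these is a
countable patchwork of measurable functions.
\<close>
lemma caratheodory_measurable:
  fixes f :: "'a \<Rightarrow> real \<Rightarrow> 'b :: metric_space"
  assumes meas: "\<And>x. (\<lambda>s. f s x) \<in> borel_measurable M"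
    and cont: "\<And>s. s \<in> space M \<Longrightarrow> continuous_on UNIV (f s)"
  shows "(\<lambda>(s, x). f s x) \<in> borel_measurable (M \<Otimes>\<^sub>M borel)"
proof (rule borel_measurable_LIMSEQ_metric)
  fix n
  show "(\<lambda>z. f (fst z) (of_int \<lfloor>real (Suc n) * snd z\<rfloor> / real (Suc n))) \<in> borel_measurable (M \<Otimes>\<^sub>M borel)"
  proof (rule measurable_compose_countable[where f="\<lambda>i z. f (fst z) (of_int i / real (Suc n))" and g="\<lambda>z. \<lfloor>real (Suc n) * snd z\<rfloor>"])
    show "(\<lambda>z. f (fst z) (of_int i / real (Suc n))) \<in> borel_measurable (M \<Otimes>\<^sub>M borel)" for i :: int
      by (rule measurable_compose[OF measurable_fst meas])
    show "(\<lambda>z. \<lfloor>real (Suc n) * snd z\<rfloor>) \<in> M \<Otimes>\<^sub>M borel \<rightarrow>\<^sub>M count_space UNIV" by measurable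
  qed
next
  fix z assume "z \<in> space (M \<Otimes>\<^sub>M (borel :: real measure))"
  then have s: "fst z \<in> space M" by (auto simp: space_pair_measure)
  define x where "x = snd z"
  have "(\<lambda>n. of_int \<lfloor>real (Suc n) * x\<rfloor> / real (Suc n)) \<longlonglongrightarrow> x"
  proof (rule tendsto_sandwich)
    show "\<forall>\<^sub>F n in sequentially. x - 1 / real (Suc n) \<le> of_int \<lfloor>real (Suc n) * x\<rfloor> / real (Suc n)"
    proof (intro always_eventually allI)
      fix n
      have "real (Suc n) * x - 1 \<le> of_int \<lfloor>real (Suc n) * x\<rfloor>" by linarith
      then have "(real (Suc n) * x - 1) / real (Suc n) \<le> of_int \<lfloor>real (Suc n) * x\<rfloor> / real (Suc n)"
        by (rule divide_right_mono) simp
      then show "x - 1 / real (Suc n) \<le> of_int \<lfloor>real (Suc n) * x\<rfloor> / real (Suc n)"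
        by (simp add: diff_divide_distrib)
    qed
    show "\<forall>\<^sub>F n in sequentially. of_int \<lfloor>real (Suc n) * x\<rfloor> / real (Suc n) \<le> x"
    proof (intro always_eventually allI)
      fix n
      have "of_int \<lfloor>real (Suc n) * x\<rfloor> / real (Suc n) \<le> (real (Suc n) * x) / real (Suc n)"
        by (rule divide_right_mono) auto
      then show "of_int \<lfloor>real (Suc n) * x\<rfloor> / real (Suc n) \<le> x" by simp
    qed
    have "(\<lambda>n. x - 1 / real (Suc n)) \<longlonglongrightarrow> x - 0" by (intro tendsto_intros LIMSEQ_Suc[OF lim_1_over_n])
    then show "(\<lambda>n. x - 1 / real (Suc n)) \<longlonglongrightarrow> x" by simp
  qed simp
  moreover have "isCont (f (fst z)) x" using cont[OF s] by (simp add: continuous_on_eq_continuous_at)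
  ultimately have "(\<lambda>n. f (fst z) (of_int \<lfloor>real (Suc n) * x\<rfloor> / real (Suc n))) \<longlonglongrightarrow> f (fst z) x"
    by (rule isCont_tendsto_compose[rotated])
  then show "(\<lambda>n. f (fst z) (of_int \<lfloor>real (Suc n) * snd z\<rfloor> / real (Suc n))) \<longlonglongrightarrow> (case z of (s, x) \<Rightarrow> f s x)"
    by (simp add: x_def case_prod_beta)
qed

lemma measurable_pair_lborel:
  "f \<in> borel_measurable (M \<Otimes>\<^sub>M borel) \<longleftrightarrow> f \<in> borel_measurable (M \<Otimes>\<^sub>M (lborel :: real measure))"
  by (rule measurable_cong_sets[THEN arg_cong[where f="\<lambda>S. f \<in> S"]])
     (auto intro!: sets_pair_measure_cong)

text \<open>
\<open>recover_twisted\<close> exhibits the spectrum of \<open>L\<^sub>s\<close> as a pointwise limit of finite combinations of values and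
slopes of \<open>G\<^sub>s\<close> at the half-integers, and \<open>L\<^sub>s\<close> is an integral of its spectrum.
\<close>
lemma minorant_measurable:
  assumes fam: "\<And>s. s \<in> space M \<Longrightarrow> interpolated_minorant (G s) (L s) (C s) (\<epsilon> s)"
    and meas [measurable]: "\<And>x. (\<lambda>s. G s x) \<in> borel_measurable M"
  shows "(\<lambda>s. L s (of_real x)) \<in> borel_measurable M"
proof -
  have bl: "bandlimited (L s)" if "s \<in> space M" for s
  proof -
    interpret interpolated_minorant "G s" "L s" "C s" "\<epsilon> s" by (rule fam[OF that])
    show ?thesis by unfold_locales
  qed
  have mv [measurable]: "(\<lambda>s. L s (of_real (1/2 - of_int n))) \<in> borel_measurable M" for n
  proof (subst measurable_cong)
    fix s assume "s \<in> space M"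
    then interpret interpolated_minorant "G s" "L s" "C s" "\<epsilon> s" by (rule fam)
    have "1/2 - real_of_int n = of_int (- n) + 1/2" by simp
    then show "L s (of_real (1/2 - of_int n)) = of_real (G s (1/2 - of_int n))"
      using interp unfolding interpolates_at_half_integers_def by metis
  qed measurable
  have md [measurable]: "(\<lambda>s. deriv (L s) (of_real (1/2 - of_int n))) \<in> borel_measurable M" for n
  proof (rule borel_measurable_LIMSEQ_metric)
    show "(\<lambda>s. complex_of_real ((G s (1/2 - of_int n + 1 / real (Suc k)) - G s (1/2 - of_int n)) / (1 / real (Suc k)))) \<in> borel_measurable M" for k
      by measurable
    fix s assume "s \<in> space M"
    then interpret interpolated_minorant "G s" "L s" "C s" "\<epsilon> s" by (rule fam)
    have "deriv (L s) (of_real (1/2 - of_int n)) \<in> \<real>"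
      by (rule real_deriv[OF L_entire]) (use minorant in \<open>simp add: minorant_on_def\<close>)
    then have "of_real (Re (deriv (L s) (of_real (1/2 - of_int n)))) = deriv (L s) (of_real (1/2 - of_int n))" by (rule of_real_Re)
    then show "(\<lambda>k. complex_of_real ((G s (1/2 - of_int n + 1 / real (Suc k)) - G s (1/2 - of_int n)) / (1 / real (Suc k))))
       \<longlonglongrightarrow> deriv (L s) (of_real (1/2 - of_int n))"
      using tendsto_of_real[OF slope_interpolation[of n], where 'a=complex] by simp
  qed
  define V where "V = (\<lambda>N x s. fejer_mean N (\<lambda>n. L s (of_real (1/2 - of_int n)) * e2pi (of_int n * x)))"
  define W where "W = (\<lambda>N x s. fejer_mean N (\<lambda>n. deriv (L s) (of_real (1/2 - of_int n)) / (2 * of_real pi * \<i>) * e2pi (of_int n * x)))"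
  have V [measurable]: "V N x \<in> borel_measurable M" for N x
    unfolding V_def fejer_mean_def by measurable
  have W [measurable]: "W N x \<in> borel_measurable M" for N x
    unfolding W_def fejer_mean_def by measurable
  define T where "T = (\<lambda>s. bandlimited.twisted (L s))"
  have T_meas: "(\<lambda>s. T s t) \<in> borel_measurable M" for t
  proof -
    consider "1 \<le> \<bar>t\<bar>" | "0 \<le> t" "t < 1" | "t < 0" "-1 < t" by linarith
    then show ?thesis
    proof cases
      case 1
      have "(\<lambda>s. T s t) \<in> borel_measurable M \<longleftrightarrow> (\<lambda>s. 0::complex) \<in> borel_measurable M"
        by (rule measurable_cong) (use 1 bandlimited.twisted_eq_0[OF bl] in \<open>simp add: T_def\<close>)
      then show ?thesis by simp
    next
      case 2
      show ?thesis
      proof (rule borel_measurable_LIMSEQ_metric)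
        show "(\<lambda>s. W N t s - of_real (t - 1) * V N t s) \<in> borel_measurable M" for N by measurable
        show "(\<lambda>N. W N t s - of_real (t - 1) * V N t s) \<longlonglongrightarrow> T s t" if "s \<in> space M" for s
          unfolding W_def V_def T_def by (rule bandlimited.recover_twisted(1)[OF bl[OF that] 2])
      qed
    next
      case 3
      \<comment> \<open>The value at \<open>t\<close> is the second unknown of the linear system at the point \<open>t + 1\<close>.\<close>
      then have 4: "0 \<le> t + 1" "t + 1 < 1" by auto
      show ?thesis
      proof (rule borel_measurable_LIMSEQ_metric)
        show "(\<lambda>s. of_real (t + 1) * V N (t + 1) s - W N (t + 1) s) \<in> borel_measurable M" for N by measurable
        show "(\<lambda>N. of_real (t + 1) * V N (t + 1) s - W N (t + 1) s) \<longlonglongrightarrow> T s t" if "s \<in> space M" for s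
          using bandlimited.recover_twisted(2)[OF bl[OF that] 4] unfolding W_def V_def T_def by simp
      qed
    qed
  qed
  have "(\<lambda>(s, t). T s t) \<in> borel_measurable (M \<Otimes>\<^sub>M lborel)"
    unfolding measurable_pair_lborel[symmetric]
    by (rule caratheodory_measurable[OF T_meas]) (use bandlimited.twisted_continuous[OF bl] in \<open>simp add: T_def\<close>)
  then have "(\<lambda>(s, t). T s t * e2pi (- (t / 2)) * e2pi (x * t)) \<in> borel_measurable (M \<Otimes>\<^sub>M lborel)"
    by measurable
  then have "(\<lambda>s. \<integral>t. T s t * e2pi (- (t / 2)) * e2pi (x * t) \<partial>lborel) \<in> borel_measurable M"
    by (rule lborel.borel_measurable_lebesgue_integral)
  moreover have "L s (of_real x) = (\<integral>t. T s t * e2pi (- (t / 2)) * e2pi (x * t) \<partial>lborel)" if "s \<in> space M" for s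
  proof -
    have "T s t * e2pi (- (t / 2)) = bandlimited.spectrum (L s) t" for t
    proof -
      have "e2pi (t / 2) * e2pi (- (t / 2)) = 1" by (simp flip: e2pi_add)
      then show ?thesis by (simp add: T_def bandlimited.twisted_def[OF bl[OF that]] mult_ac)
    qed
    then show ?thesis
      unfolding bandlimited.inversion[OF bl[OF that]] fourier_e2pi by (simp add: mult.commute)
  qed
  ultimately show ?thesis by (subst measurable_cong)
qed

text \<open>
Fubini for an average of non-negative functions of mass at most \<open>1\<close>. The average is a Bochner integral,
which may be a default value on a null set of \<open>x\<close> only.
\<close>
lemma mixture:
  fixes \<kappa> :: "'a \<Rightarrow> real \<Rightarrow> real"
  assumes fin: "finite_measure \<mu>"
    and meas: "(\<lambda>(s, x). \<kappa> s x) \<in> borel_measurable (\<mu> \<Otimes>\<^sub>M lborel)"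
    and nn: "\<And>s x. s \<in> space \<mu> \<Longrightarrow> 0 \<le> \<kappa> s x"
    and mass: "\<And>s. s \<in> space \<mu> \<Longrightarrow> (\<integral>\<^sup>+x. ennreal (\<kappa> s x) \<partial>lborel) \<le> 1"
  defines "k \<equiv> (\<lambda>x. \<integral>s. \<kappa> s x \<partial>\<mu>)"
  shows "integrable lborel k" and "\<And>x. 0 \<le> k x"
    and "(\<integral>\<^sup>+x. ennreal (k x) \<partial>lborel) = (\<integral>\<^sup>+s. (\<integral>\<^sup>+x. ennreal (\<kappa> s x) \<partial>lborel) \<partial>\<mu>)"
    and "\<And>h B. h \<in> borel_measurable borel \<Longrightarrow> (\<And>x. norm (h x) \<le> B) \<Longrightarrow>
      (\<integral>x. complex_of_real (k x) * h x \<partial>lborel) = (\<integral>s. (\<integral>x. complex_of_real (\<kappa> s x) * h x \<partial>lborel) \<partial>\<mu>)"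
proof -
  interpret finite_measure \<mu> by (rule fin)
  interpret P: pair_sigma_finite \<mu> "lborel :: real measure" by unfold_locales
  have m [measurable]: "case_prod \<kappa> \<in> borel_measurable (\<mu> \<Otimes>\<^sub>M lborel)" using meas by simp
  have ae_nn: "0 \<le> case_prod \<kappa> z" if "z \<in> space (\<mu> \<Otimes>\<^sub>M lborel)" for z
    using that nn by (auto simp: space_pair_measure)
  have int: "integrable (\<mu> \<Otimes>\<^sub>M lborel) (case_prod \<kappa>)"
  proof (rule integrableI_bounded[OF m])
    have "(\<integral>\<^sup>+z. ennreal (norm (case_prod \<kappa> z)) \<partial>(\<mu> \<Otimes>\<^sub>M lborel)) = (\<integral>\<^sup>+z. ennreal (case_prod \<kappa> z) \<partial>(\<mu> \<Otimes>\<^sub>M lborel))"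
      using ae_nn by (intro nn_integral_cong) simp
    also have "\<dots> = (\<integral>\<^sup>+s. \<integral>\<^sup>+x. ennreal (\<kappa> s x) \<partial>lborel \<partial>\<mu>)"
      by (subst lborel.nn_integral_fst[symmetric]) simp_all
    also have "\<dots> \<le> (\<integral>\<^sup>+s. 1 \<partial>\<mu>)" by (intro nn_integral_mono mass)
    also have "\<dots> < \<infinity>" by (simp add: emeasure_eq_measure)
    finally show "(\<integral>\<^sup>+z. ennreal (norm (case_prod \<kappa> z)) \<partial>(\<mu> \<Otimes>\<^sub>M lborel)) < \<infinity>" .
  qed
  show "integrable lborel k" unfolding k_def by (rule P.integrable_snd[OF int])
  show "0 \<le> k x" for x unfolding k_def by (rule integral_nonneg_AE) (use nn in auto)
  have "AE x in lborel. integrable \<mu> (\<lambda>s. \<kappa> s x)" by (rule P.AE_integrable_snd[OF int])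
  then have "AE x in lborel. ennreal (k x) = (\<integral>\<^sup>+s. ennreal (\<kappa> s x) \<partial>\<mu>)"
    by eventually_elim (simp add: k_def nn nn_integral_eq_integral)
  then have "(\<integral>\<^sup>+x. ennreal (k x) \<partial>lborel) = (\<integral>\<^sup>+x. \<integral>\<^sup>+s. ennreal (\<kappa> s x) \<partial>\<mu> \<partial>lborel)"
    by (rule nn_integral_cong_AE)
  also have "\<dots> = (\<integral>\<^sup>+s. (\<integral>\<^sup>+x. ennreal (\<kappa> s x) \<partial>lborel) \<partial>\<mu>)"
    by (rule P.Fubini') simp
  finally show "(\<integral>\<^sup>+x. ennreal (k x) \<partial>lborel) = (\<integral>\<^sup>+s. (\<integral>\<^sup>+x. ennreal (\<kappa> s x) \<partial>lborel) \<partial>\<mu>)" .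
  show "(\<integral>x. complex_of_real (k x) * h x \<partial>lborel) = (\<integral>s. (\<integral>x. complex_of_real (\<kappa> s x) * h x \<partial>lborel) \<partial>\<mu>)"
    if h [measurable]: "h \<in> borel_measurable borel" and B: "\<And>x. norm (h x) \<le> B" for h B
  proof -
    have ih: "integrable (\<mu> \<Otimes>\<^sub>M lborel) (\<lambda>z. complex_of_real (case_prod \<kappa> z) * h (snd z))"
      by (rule integrable_mult_bounded[where B=B]) (use int B in \<open>auto intro: integrable_of_real\<close>)
    have "(\<integral>x. complex_of_real (k x) * h x \<partial>lborel) = (\<integral>x. (\<integral>s. complex_of_real (\<kappa> s x) * h x \<partial>\<mu>) \<partial>lborel)"
      unfolding k_def by (simp add: integral_complex_of_real)
    also have "\<dots> = (\<integral>s. (\<integral>x. complex_of_real (\<kappa> s x) * h x \<partial>lborel) \<partial>\<mu>)"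
      by (rule P.Fubini_integral) (use ih in \<open>simp add: split_beta'\<close>)
    finally show ?thesis .
  qed
qed

lemma schwartz_integrable:
  assumes "schwartz \<phi>"
  shows "integrable lborel \<phi>"
proof -
  have cont: "continuous_on UNIV \<phi>"
  proof -
    have "\<phi> differentiable (at x)" for x
      using assms unfolding schwartz_def nth_derivative_def by (metis funpow_0)
    then show ?thesis by (simp add: continuous_at_imp_continuous_on differentiable_imp_continuous_within)
  qed
  have "bounded (range (\<lambda>x. complex_of_real (x ^ m) * \<phi> x))" for m
    using assms unfolding schwartz_def nth_derivative_def by (metis (no_types, lifting) ext funpow_0)
  then obtain B where B: "\<And>m x. norm (complex_of_real (x ^ m) * \<phi> x) \<le> B m"
    unfolding bounded_iff by (metis rangeI)
  define C where "C = 2 * (\<bar>B 0\<bar> + \<bar>B 2\<bar>) + 1"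
  have C: "0 < C" by (simp add: C_def)
  have bd: "norm (\<phi> x) \<le> C * (1 + \<bar>x\<bar>) powr (- 1 - 1)" for x
  proof -
    have "(1 + \<bar>x\<bar>)\<^sup>2 \<le> 2 * (1 + x\<^sup>2)"
      using zero_le_power2[of "1 - \<bar>x\<bar>"] by (simp add: power2_eq_square algebra_simps)
    then have "(1 + \<bar>x\<bar>)\<^sup>2 * norm (\<phi> x) \<le> 2 * (1 + x\<^sup>2) * norm (\<phi> x)" by (rule mult_right_mono) simp
    also have "\<dots> = 2 * norm (\<phi> x) + 2 * (x\<^sup>2 * norm (\<phi> x))" by (simp only: algebra_simps mult_1)
    also have "\<dots> \<le> C"
    proof -
      have "norm (\<phi> x) \<le> B 0" using B[where m=0 and x=x] by simp
      moreover have "x\<^sup>2 * norm (\<phi> x) \<le> B 2" using B[where m=2 and x=x] by (simp add: norm_mult norm_power)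
      ultimately have "2 * norm (\<phi> x) + 2 * (x\<^sup>2 * norm (\<phi> x)) \<le> 2 * B 0 + 2 * B 2"
        by (intro add_mono mult_left_mono) auto
      also have "\<dots> \<le> C" unfolding C_def using abs_ge_self[of "B 0"] abs_ge_self[of "B 2"] by argo
      finally show ?thesis .
    qed
    finally have "(1 + \<bar>x\<bar>)\<^sup>2 * norm (\<phi> x) \<le> C" .
    moreover have "(1 + \<bar>x\<bar>) powr (- 1 - 1) = 1 / (1 + \<bar>x\<bar>)\<^sup>2"
    proof -
      have "0 < 1 + \<bar>x\<bar>" by linarith
      then have "(1 + \<bar>x\<bar>) powr 2 = (1 + \<bar>x\<bar>)\<^sup>2" by simp
      then show ?thesis using powr_minus_divide[of "1 + \<bar>x\<bar>" 2] by simp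
    qed
    moreover have "0 < (1 + \<bar>x\<bar>)\<^sup>2" by (intro zero_less_power) linarith
    ultimately show ?thesis by (simp only: pos_le_divide_eq times_divide_eq_right mult_1_right mult.commute)
  qed
  show ?thesis
    by (rule unit_interval_decomposition(1)[OF borel_measurable_continuous_onI[OF cont] powr_decay_pieces(1)[OF zero_less_one bd C] powr_decay_pieces(2)[OF zero_less_one bd C]])
qed

section \<open>Optimality\<close>

text \<open>
The competitor \<open>F\<close> may have any finite distance to \<open>g\<close>; then \<open>D = F - l\<close> is integrable, and its integral
is the difference of the two distances, which is at most any of the non-positive samples of \<open>D\<close> at
half-integers. Since \<open>0\<close> is not a half-integer, the inequality on the complement of \<open>{0}\<close> suffices.
\<close>
lemma interpolating_minorant_optimal:
  fixes g :: "real \<Rightarrow> real"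
  assumes l: "minorant_on (- {0}) g l" and interp: "interpolates_at_half_integers g l"
    and diff: "g differentiable_on (- {0})" and g_meas [measurable]: "g \<in> borel_measurable borel"
    and l_fin: "L1_distance l g < \<infinity>"
    and F: "minorant_on (- {0}) g F" and F_fin: "L1_distance F g < \<infinity>"
  shows "L1_distance l g \<le> L1_distance F g" and "L1_distance F g \<le> L1_distance l g \<Longrightarrow> F = l"
proof -
  have ent: "l holomorphic_on UNIV" "F holomorphic_on UNIV" using l F by (auto simp: minorant_on_def)
  have real: "l (of_real x) \<in> \<real>" "F (of_real x) \<in> \<real>" for x using l F by (auto simp: minorant_on_def)
  define h where "h = (\<lambda>H x. g x - Re (H (complex_of_real x)))"
  have hH: "integrable lborel (h H)" "L1_distance H g = ennreal (\<integral>x. h H x \<partial>lborel)"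
    if H: "minorant_on (- {0}) g H" "L1_distance H g < \<infinity>" for H
  proof -
    have "continuous_on UNIV (\<lambda>x::real. H (of_real x))"
      by (rule continuous_on_real_restriction) (use H in \<open>simp add: minorant_on_def\<close>)
    from borel_measurable_continuous_onI[OF this]
    have [measurable]: "h H \<in> borel_measurable borel" unfolding h_def by measurable
    have n: "\<bar>h H x\<bar> = \<bar>Re (H (of_real x)) - g x\<bar>" for x by (simp add: h_def abs_minus_commute)
    show i: "integrable lborel (h H)"
      by (rule integrableI_bounded) (use H(2) in \<open>simp_all add: L1_distance_def n\<close>)
    have "L1_distance H g = (\<integral>\<^sup>+x. ennreal (h H x) \<partial>lborel)"
      unfolding L1_distance_def
      by (rule nn_integral_cong_AE, use AE_lborel_singleton[of "0::real"] in eventually_elim)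
         (use H(1) in \<open>auto simp: h_def minorant_on_def\<close>)
    also have "\<dots> = ennreal (\<integral>x. h H x \<partial>lborel)"
      by (rule nn_integral_eq_integral[OF i], use AE_lborel_singleton[of "0::real"] in eventually_elim)
         (use H(1) in \<open>auto simp: h_def minorant_on_def\<close>)
    finally show "L1_distance H g = ennreal (\<integral>x. h H x \<partial>lborel)" .
  qed
  define D where "D = (\<lambda>z. F z - l z)"
  have D_real: "D (of_real x) = of_real (h l x - h F x)" for x
    using real[of x] by (auto simp: D_def h_def complex_eq_iff complex_is_Real_iff)
  have intD: "integrable lborel (\<lambda>x. D (of_real x))"
    unfolding D_real by (intro integrable_of_real Bochner_Integration.integrable_diff hH l F l_fin F_fin)
  interpret D: bandlimited D
  proof
    show "D holomorphic_on UNIV" unfolding D_def by (intro holomorphic_intros ent)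
    show "exponential_type (2 * pi) D"
      unfolding D_def using l F by (intro exponential_type_diff) (auto simp: minorant_on_def)
  qed (rule intD)
  have l_half: "Re (l (of_real (of_int n + 1/2))) = g (of_int n + 1/2)" for n
    using interp unfolding interpolates_at_half_integers_def by (metis Re_complex_of_real)
  have F_half: "Re (F (of_real (of_int n + 1/2))) \<le> g (of_int n + 1/2)" for n
  proof -
    have "real_of_int n + 1/2 \<in> - {0}" using half_integer_nonzero[of n] by blast
    then show ?thesis using F unfolding minorant_on_def by blast
  qed
  have D_half: "Re (D (of_real (of_int n + 1/2))) \<le> 0" for n
    using l_half[of n] F_half[of n] by (simp add: D_def)
  have "(\<integral>x. D (of_real x) \<partial>lborel) = of_real ((\<integral>x. h l x \<partial>lborel) - (\<integral>x. h F x \<partial>lborel))"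
    unfolding D_real integral_complex_of_real
    by (simp add: Bochner_Integration.integral_diff[OF hH(1)[OF l l_fin] hH(1)[OF F F_fin]])
  then have le: "(\<integral>x. h l x \<partial>lborel) - (\<integral>x. h F x \<partial>lborel) \<le> Re (D (of_real (of_int m + 1/2)))" for m
    using D.integral_le_sample[OF D_half, of m] by simp
  have "(\<integral>x. h l x \<partial>lborel) \<le> (\<integral>x. h F x \<partial>lborel)" using le[of 0] D_half[of 0] by linarith
  then show "L1_distance l g \<le> L1_distance F g"
    unfolding hH(2)[OF l l_fin] hH(2)[OF F F_fin] by (rule ennreal_leI)
  assume opt: "L1_distance F g \<le> L1_distance l g"
  have "0 \<le> (\<integral>x. h l x \<partial>lborel)"
    by (rule integral_nonneg_AE, use AE_lborel_singleton[of "0::real"] in eventually_elim)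
       (use l in \<open>auto simp: h_def minorant_on_def\<close>)
  then have "(\<integral>x. h F x \<partial>lborel) \<le> (\<integral>x. h l x \<partial>lborel)"
    using opt unfolding hH(2)[OF l l_fin] hH(2)[OF F F_fin] by (simp add: ennreal_le_iff)
  then have D0: "Re (D (of_real (of_int m + 1/2))) = 0" for m
    using le[of m] D_half[of m] by linarith
  have "D = (\<lambda>_. 0)"
  proof (rule D.eq_0_if_double_zeros)
    fix n :: int
    define x where "x = real_of_int n + 1/2"
    have x0: "x \<noteq> 0" unfolding x_def by (rule half_integer_nonzero)
    have DR: "D (of_real y) \<in> \<real>" for y by (simp add: D_real)
    show "D (of_real (of_int n + 1/2)) = 0"
      using D0[of n] DR[of "of_int n + 1/2"] by (simp add: complex_eq_iff complex_is_Real_iff)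
    have "g differentiable (at x)"
      using diff x0 differentiable_on_eq_differentiable_at[of "- {0::real}" g] by (simp add: open_Compl)
    then obtain g' where g': "(g has_real_derivative g') (at x)" by (metis real_differentiable_def)
    have near: "\<forall>\<^sub>F y in nhds x. y \<noteq> 0" using x0 by (intro t1_space_nhds) 
    have "Re (deriv l (of_real x)) = g'"
    proof (rule contact_derivative_eq[OF _ _ g' Re_restriction_has_derivative[OF ent(1)]])
      show "\<forall>\<^sub>F y in nhds x. Re (l (of_real y)) \<le> g y"
        using near by eventually_elim (use l in \<open>simp add: minorant_on_def\<close>)
      show "Re (l (of_real x)) = g x" unfolding x_def by (rule l_half)
    qed
    moreover have "Re (deriv F (of_real x)) = g'"
    proof (rule contact_derivative_eq[OF _ _ g' Re_restriction_has_derivative[OF ent(2)]])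
      show "\<forall>\<^sub>F y in nhds x. Re (F (of_real y)) \<le> g y"
        using near by eventually_elim (use F in \<open>simp add: minorant_on_def\<close>)
      show "Re (F (of_real x)) = g x"
        using D0[of n] l_half[of n] unfolding D_def x_def minus_complex.sel by linarith
    qed
    moreover have "deriv D (of_real x) = deriv F (of_real x) - deriv l (of_real x)"
      unfolding D_def using holomorphic_on_imp_differentiable_at[OF _ open_UNIV UNIV_I] ent by (intro deriv_diff) auto
    ultimately have "Re (deriv D (of_real x)) = 0" by simp
    moreover have "deriv D (of_real x) \<in> \<real>" by (rule real_deriv[OF D.entire DR])
    ultimately show "deriv D (of_real (of_int n + 1/2)) = 0"
      unfolding x_def by (simp add: complex_eq_iff complex_is_Real_iff)
  qed
  then show "F = l" by (auto simp: D_def fun_eq_iff)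
qed

theorem theorem14:
  fixes I :: "real set"
    and G :: "real \<Rightarrow> real \<Rightarrow> real"
    and L :: "real \<Rightarrow> complex \<Rightarrow> complex"
    and \<nu> :: "real measure"
    and g :: "real \<Rightarrow> real"
  assumes "is_interval I"
    and "minorant_family I G"
    and "\<And>s. s \<in> I \<Longrightarrow>
           extremal_minorant (G s) (L s) \<and> interpolates_at_half_integers (G s) (L s)"
    and "sets \<nu> = sets (restrict_space borel I)"
    and "\<And>x. (\<lambda>s. G s x) \<in> borel_measurable \<nu>"
    and "(\<integral>\<^sup>+s. (\<integral>\<^sup>+x. ennreal (G s x - Re (L s (of_real x))) \<partial>lborel) \<partial>\<nu>) < \<infinity>"
    and "defines_tempered_distribution g"
    and "continuous_on (- {0}) g"
    and "g differentiable_on (- {0})"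
    and "\<And>\<phi>. schwartz \<phi> \<Longrightarrow> support \<phi> \<subseteq> - {-1..1} \<Longrightarrow>
           fourier_distribution (distribution_of g) \<phi> =
             (\<integral>t. (\<integral>s. Ghat G s t \<partial>\<nu>) * \<phi> t \<partial>lborel)"
  shows "\<exists>l.
     (extremal_minorant_on (- {0}) g l \<and> (\<forall>F. extremal_minorant_on (- {0}) g F \<longrightarrow> F = l)) \<and>
     (Liminf (at 0) (\<lambda>x. ereal (g x)) \<le> ereal (g 0) \<longrightarrow>
        extremal_minorant g l \<and> (\<forall>F. extremal_minorant g F \<longrightarrow> F = l)) \<and>
     interpolates_at_half_integers g l \<and>
     (\<integral>\<^sup>+x. ennreal (g x - Re (l (of_real x))) \<partial>lborel) =
       (\<integral>\<^sup>+s. (\<integral>\<^sup>+x. ennreal (G s x - Re (L s (of_real x))) \<partial>lborel) \<partial>\<nu>)"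
proof -
  have space_\<nu>: "space \<nu> = I"
    using sets_eq_imp_space_eq[OF assms(4)] by (simp add: space_restrict_space)
  have "\<exists>C \<epsilon>. interpolated_minorant (G s) (L s) C \<epsilon>" if s: "s \<in> I" for s
  proof -
    have fam: "continuous_on UNIV (G s) \<and> G s differentiable_on (- {0}) \<and>
       (\<exists>C>0. \<exists>\<epsilon>>0. (\<forall>x. \<bar>G s x\<bar> \<le> C * (1 + \<bar>x\<bar>) powr (- 1 - \<epsilon>)) \<and>
          (\<forall>t. norm (Ghat G s t) \<le> C * (1 + \<bar>t\<bar>) powr (- 1 - \<epsilon>))) \<and>
       (\<forall>t. Ghat G s t \<in> \<real>\<^sub>\<ge>\<^sub>0) \<and> (\<forall>t u. \<bar>t\<bar> \<le> \<bar>u\<bar> \<longrightarrow> Re (Ghat G s u) \<le> Re (Ghat G s t)) \<and>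
       (\<exists>!F. extremal_minorant (G s) F \<and> interpolates_at_half_integers (G s) F)"
      using assms(2) s unfolding minorant_family_def by blast
    then obtain C \<epsilon> where C: "0 < C" "0 < \<epsilon>" "\<And>x. \<bar>G s x\<bar> \<le> C * (1 + \<bar>x\<bar>) powr (- 1 - \<epsilon>)" by blast
    have "L1_distance (L s) (G s) < \<infinity>"
      by (rule unique_interpolating_extremal_imp_finite_distance) (use assms(3)[OF s] fam in blast)+
    then have "interpolated_minorant (G s) (L s) C \<epsilon>"
      using fam C assms(3)[OF s] by unfold_locales (auto simp: extremal_minorant_on_def)
    then show ?thesis by blast
  qed
  then obtain C \<epsilon> where im: "\<And>s. s \<in> I \<Longrightarrow> interpolated_minorant (G s) (L s) (C s) (\<epsilon> s)" by metis

  define K where "K = (\<lambda>s x. G s x - Re (L s (of_real x)))"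
  define p where "p = (\<lambda>s. \<integral>x. K s x \<partial>lborel)"
  define FK where "FK = (\<lambda>s N. \<integral>y. K s y * fejer_kernel N (y - 1/2) \<partial>lborel)"
  have K: "(\<forall>x. 0 \<le> K s x) \<and> integrable lborel (K s) \<and> continuous_on UNIV (K s)
      \<and> (\<forall>t. 1 \<le> \<bar>t\<bar> \<longrightarrow> fourier (\<lambda>x. of_real (K s x)) t = Ghat G s t)
      \<and> (\<forall>N. 0 \<le> FK s N \<and> FK s N \<le> p s) \<and> FK s \<longlonglongrightarrow> 0" if s: "s \<in> I" for s
  proof -
    interpret M: interpolated_minorant "G s" "L s" "C s" "\<epsilon> s" by (rule im[OF s])
    have eq: "K s = M.K" by (auto simp: K_def M.K_def)
    have FK_eq: "FK s = M.fejer_integral" by (auto simp: FK_def M.fejer_integral_def eq)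
    show ?thesis
      unfolding FK_eq p_def eq
      using M.K_nonneg M.K_integrable M.K_continuous M.fourier_K_outside M.fejer_integral_nonneg
        M.fejer_integral_le M.fejer_integral_tendsto_0 by blast
  qed
  have K_nn: "0 \<le> K s x" and K_int: "integrable lborel (K s)" and K_cont: "continuous_on UNIV (K s)"
    and K_out: "1 \<le> \<bar>t\<bar> \<Longrightarrow> fourier (\<lambda>x. of_real (K s x)) t = Ghat G s t"
    and FK_bd: "0 \<le> FK s N" "FK s N \<le> p s" and FK_lim: "FK s \<longlonglongrightarrow> 0" if "s \<in> I" for s x t N
    using K[OF that] by blast+
  have p_nn: "0 \<le> p s" if "s \<in> I" for s
    unfolding p_def by (intro integral_nonneg_AE AE_I2 K_nn that)
  \<comment> \<open>These parameters are invisible to \<open>\<mu>\<close> below.\<close>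
  have p_0: "K s x = 0" if s: "s \<in> I" and "p s = 0" for s x
  proof -
    have "AE x in lborel. K s x = 0"
      using integral_nonneg_eq_0_iff_AE[OF K_int[OF s]] K_nn[OF s] \<open>p s = 0\<close> by (simp add: p_def)
    then have "AE x in lborel. x \<in> UNIV \<longrightarrow> K s x \<in> {0}" by simp
    from continuous_AE_closed[OF open_UNIV K_cont[OF s] closed_singleton this, of x] show ?thesis by simp
  qed
  have nnK: "(\<integral>\<^sup>+x. ennreal (K s x) \<partial>lborel) = ennreal (p s)" if "s \<in> I" for s
    unfolding p_def by (rule nn_integral_eq_integral[OF K_int[OF that]]) (use K_nn[OF that] in auto)
  have L_meas: "(\<lambda>s. L s (of_real x)) \<in> borel_measurable \<nu>" for x
    by (rule minorant_measurable[of \<nu> G L C \<epsilon>]) (use im space_\<nu> assms(5) in auto)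
  have "(\<lambda>s. K s x) \<in> borel_measurable \<nu>" for x
    unfolding K_def using assms(5)[of x] L_meas[of x] by measurable
  then have "(\<lambda>(s, x). K s x) \<in> borel_measurable (\<nu> \<Otimes>\<^sub>M borel)"
    by (rule caratheodory_measurable) (use K_cont space_\<nu> in auto)
  then have K_meas [measurable]: "(\<lambda>(s, x). K s x) \<in> borel_measurable (\<nu> \<Otimes>\<^sub>M lborel)"
    by (simp only: measurable_pair_lborel)
  have p_meas [measurable]: "p \<in> borel_measurable \<nu>"
    unfolding p_def by (rule lborel.borel_measurable_lebesgue_integral[OF K_meas])
  define R where "R = (\<integral>\<^sup>+s. (\<integral>\<^sup>+x. ennreal (G s x - Re (L s (of_real x))) \<partial>lborel) \<partial>\<nu>)"
  have R_eq: "R = (\<integral>\<^sup>+s. ennreal (p s) \<partial>\<nu>)"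
    unfolding R_def by (rule nn_integral_cong) (use nnK space_\<nu> in \<open>simp add: K_def\<close>)
  have R_fin: "R < \<infinity>" using assms(6) by (simp add: R_def)

  \<comment> \<open>The weight makes the parameter measure finite, and \<open>\<kappa>\<close> compensates for it. Division by zero gives
    \<open>\<kappa> s = 0\<close>, the right value when \<open>p s = 0\<close>.\<close>
  define \<mu> where "\<mu> = density \<nu> (\<lambda>s. ennreal (p s))"
  define \<kappa> where "\<kappa> = (\<lambda>s x. K s x / p s)"
  have space_\<mu>: "space \<mu> = I" by (simp add: \<mu>_def space_\<nu>)
  have sets_\<mu>: "sets \<mu> = sets \<nu>" by (simp add: \<mu>_def)
  have fin: "finite_measure \<mu>"
  proof (rule finite_measureI)
    have "emeasure \<mu> (space \<mu>) = (\<integral>\<^sup>+s. ennreal (p s) * indicator (space \<nu>) s \<partial>\<nu>)"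
      unfolding \<mu>_def by (subst emeasure_density) auto
    also have "\<dots> = R" unfolding R_eq by (intro nn_integral_cong) simp
    finally show "emeasure \<mu> (space \<mu>) \<noteq> \<infinity>" using R_fin by simp
  qed
  have \<kappa>_meas_\<nu> [measurable]: "(\<lambda>(s, x). \<kappa> s x) \<in> borel_measurable (\<nu> \<Otimes>\<^sub>M lborel)"
    unfolding \<kappa>_def by measurable
  have \<kappa>_meas: "(\<lambda>(s, x). \<kappa> s x) \<in> borel_measurable (\<mu> \<Otimes>\<^sub>M lborel)"
    using \<kappa>_meas_\<nu> measurable_cong_sets[OF sets_pair_measure_cong[OF sets_\<mu> refl] refl] by blast
  have \<kappa>_nn: "0 \<le> \<kappa> s x" if "s \<in> space \<mu>" for s x
    using K_nn p_nn that by (simp add: \<kappa>_def space_\<mu>)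
  have \<kappa>_mass: "(\<integral>\<^sup>+x. ennreal (\<kappa> s x) \<partial>lborel) = (if p s = 0 then 0 else 1)" if s: "s \<in> I" for s
  proof (cases "p s = 0")
    case True
    then show ?thesis by (simp add: \<kappa>_def)
  next
    case False
    then have ps: "0 < p s" using p_nn[OF s] by simp
    have "integrable lborel (\<kappa> s)" unfolding \<kappa>_def using K_int[OF s] by simp
    then have "(\<integral>\<^sup>+x. ennreal (\<kappa> s x) \<partial>lborel) = ennreal (\<integral>x. \<kappa> s x \<partial>lborel)"
      by (rule nn_integral_eq_integral) (use \<kappa>_nn s space_\<mu> in auto)
    also have "(\<integral>x. \<kappa> s x \<partial>lborel) = 1" unfolding \<kappa>_def using ps by (simp add: p_def)
    finally show ?thesis using ps by simp
  qed
  define k where "k = (\<lambda>x. \<integral>s. \<kappa> s x \<partial>\<mu>)"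
  have mass_le: "(\<integral>\<^sup>+x. ennreal (\<kappa> s x) \<partial>lborel) \<le> 1" if "s \<in> space \<mu>" for s
    using \<kappa>_mass that by (simp add: space_\<mu>)
  note mix = mixture[OF fin \<kappa>_meas \<kappa>_nn mass_le]
  have k_int: "integrable lborel k" unfolding k_def by (rule mix(1))
  have k_nn: "0 \<le> k x" for x unfolding k_def by (rule mix(2))
  have [measurable]: "k \<in> borel_measurable borel" using k_int by auto
  have k_mass: "(\<integral>\<^sup>+x. ennreal (k x) \<partial>lborel) = R"
  proof -
    have "(\<integral>\<^sup>+x. ennreal (k x) \<partial>lborel) = (\<integral>\<^sup>+s. (\<integral>\<^sup>+x. ennreal (\<kappa> s x) \<partial>lborel) \<partial>\<mu>)"
      unfolding k_def by (rule mix(3))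
    also have "\<dots> = (\<integral>\<^sup>+s. ennreal (p s) * (\<integral>\<^sup>+x. ennreal (\<kappa> s x) \<partial>lborel) \<partial>\<nu>)"
      unfolding \<mu>_def by (rule nn_integral_density) measurable
    also have "\<dots> = R"
      unfolding R_eq by (rule nn_integral_cong) (use \<kappa>_mass space_\<nu> in auto)
    finally show ?thesis .
  qed
  have fourier_k: "fourier (\<lambda>x. of_real (k x)) t = (\<integral>s. Ghat G s t \<partial>\<nu>)" if t: "1 \<le> \<bar>t\<bar>" for t
  proof -
    have "fourier (\<lambda>x. of_real (k x)) t = (\<integral>s. (\<integral>x. of_real (\<kappa> s x) * e2pi (- (x * t)) \<partial>lborel) \<partial>\<mu>)"
      unfolding fourier_e2pi k_def by (rule mix(4)[where B=1]) auto
    also have "\<dots> = (\<integral>s. p s *\<^sub>R (\<integral>x. of_real (\<kappa> s x) * e2pi (- (x * t)) \<partial>lborel) \<partial>\<nu>)"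
      unfolding \<mu>_def
    proof (rule integral_density)
      have "(\<lambda>(s, x). complex_of_real (\<kappa> s x) * e2pi (- (x * t))) \<in> borel_measurable (\<nu> \<Otimes>\<^sub>M lborel)" by measurable
      then show "(\<lambda>s. \<integral>x. of_real (\<kappa> s x) * e2pi (- (x * t)) \<partial>lborel) \<in> borel_measurable \<nu>"
        by (rule lborel.borel_measurable_lebesgue_integral)
    qed (use p_nn space_\<nu> in auto)
    also have "\<dots> = (\<integral>s. Ghat G s t \<partial>\<nu>)"
    proof (rule Bochner_Integration.integral_cong[OF refl])
      fix s assume "s \<in> space \<nu>"
      then have s: "s \<in> I" by (simp add: space_\<nu>)
      have "p s *\<^sub>R (\<integral>x. of_real (\<kappa> s x) * e2pi (- (x * t)) \<partial>lborel) = (\<integral>x. of_real (K s x) * e2pi (- (x * t)) \<partial>lborel)"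
      proof (cases "p s = 0")
        case True
        then show ?thesis using p_0[OF s] by simp
      next
        case False
        then show ?thesis
          unfolding integral_scaleR_right[symmetric] by (simp add: \<kappa>_def scaleR_conv_of_real)
      qed
      then show "p s *\<^sub>R (\<integral>x. of_real (\<kappa> s x) * e2pi (- (x * t)) \<partial>lborel) = Ghat G s t"
        using K_out[OF s t] by (simp add: fourier_e2pi)
    qed
    finally show ?thesis .
  qed
  \<comment> \<open>Only the values of the transforms at \<open>\<bar>t\<bar> \<ge> 1\<close> matter, because the test function vanishes elsewhere.\<close>
  have spec: "distribution_of g (fourier \<phi>) = (\<integral>x. of_real (k x) * fourier \<phi> x \<partial>lborel)"
    if \<phi>: "schwartz \<phi>" "support \<phi> \<subseteq> - {-1..1}" for \<phi>
  proof -
    have "distribution_of g (fourier \<phi>) = (\<integral>t. (\<integral>s. Ghat G s t \<partial>\<nu>) * \<phi> t \<partial>lborel)"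
      using assms(10)[OF \<phi>] unfolding fourier_distribution_def .
    also have "(\<integral>t. (\<integral>s. Ghat G s t \<partial>\<nu>) * \<phi> t \<partial>lborel) = (\<integral>t. fourier (\<lambda>x. of_real (k x)) t * \<phi> t \<partial>lborel)"
    proof (rule Bochner_Integration.integral_cong[OF refl])
      fix t
      show "(\<integral>s. Ghat G s t \<partial>\<nu>) * \<phi> t = fourier (\<lambda>x. of_real (k x)) t * \<phi> t"
      proof (cases "\<phi> t = 0")
        case False
        then have "t \<in> {t. \<phi> t \<noteq> 0}" by simp
        then have "t \<in> support \<phi>" unfolding support_def by (rule subsetD[OF closure_subset])
        then have "t \<in> - {-1..1}" by (rule subsetD[OF \<phi>(2)])
        then have "1 \<le> \<bar>t\<bar>" by auto
        then show ?thesis by (simp add: fourier_k)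
      qed simp
    qed
    also have "\<dots> = (\<integral>x. of_real (k x) * fourier \<phi> x \<partial>lborel)"
      by (rule fourier_swap[OF integrable_of_real[OF k_int] schwartz_integrable[OF \<phi>(1)]])
    finally show ?thesis .
  qed
  obtain l where l: "l holomorphic_on UNIV" "exponential_type (2 * pi) l"
    and l_ae: "AE x in lborel. l (of_real x) = of_real (g x - k x)"
    using paley_wiener_schwartz[OF assms(7) k_int spec] by metis

  have l_cont: "continuous_on UNIV (\<lambda>x::real. l (of_real x))"
    by (rule continuous_on_real_restriction[OF l(1)])
  have l_real: "l (of_real x) \<in> \<real>" for x
  proof -
    have "AE x in lborel. x \<in> UNIV \<longrightarrow> l (of_real x) \<in> \<real>" using l_ae by eventually_elim simp
    from continuous_AE_closed[OF open_UNIV l_cont closed_complex_Reals this] show ?thesis by simp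
  qed
  have g_meas [measurable]: "g \<in> borel_measurable borel"
    by (rule borel_measurable_continuous_countable_exceptions[of "{0}"]) (use assms(8) in auto)
  define h where "h = (\<lambda>x. g x - Re (l (of_real x)))"
  have [measurable]: "h \<in> borel_measurable borel"
    unfolding h_def using borel_measurable_continuous_onI[OF l_cont] by measurable
  have h_k: "AE x in lborel. h x = k x" using l_ae by eventually_elim (simp add: h_def)
  have h_cont: "continuous_on (- {0}) h"
    unfolding h_def by (intro continuous_intros assms(8) continuous_on_subset[OF l_cont]) auto
  have h_nn: "0 \<le> h x" if "x \<noteq> 0" for x
  proof -
    have "AE x in lborel. x \<in> - {0} \<longrightarrow> h x \<in> {0..}" using h_k by eventually_elim (simp add: k_nn)
    from continuous_AE_closed[OF _ h_cont closed_atLeast this, of x] that show ?thesis by auto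
  qed
  have h_ae_nn: "AE x in lborel. 0 \<le> h x" using h_k by eventually_elim (simp add: k_nn)
  have h_int: "integrable lborel h"
    using k_int by (subst integrable_cong_AE[of _ _ k]) (use h_k in auto)
  have h_mass: "(\<integral>\<^sup>+x. ennreal (h x) \<partial>lborel) = R"
    unfolding k_mass[symmetric] by (rule nn_integral_cong_AE) (use h_k in eventually_elim, simp)
  have l_min: "minorant_on (- {0}) g l"
    unfolding minorant_on_def using l l_real h_nn by (auto simp: h_def)

  have fejer_0: "(\<lambda>N. \<integral>y. h y * fejer_kernel N (y - 1/2) \<partial>lborel) \<longlonglongrightarrow> 0"
  proof -
    have inner: "(\<integral>y. complex_of_real (\<kappa> s y) * of_real (fejer_kernel N (y - 1/2)) \<partial>lborel) = of_real (FK s N / p s)" for s N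
    proof -
      have "(\<integral>y. complex_of_real (\<kappa> s y) * of_real (fejer_kernel N (y - 1/2)) \<partial>lborel)
          = (\<integral>y. complex_of_real (K s y * fejer_kernel N (y - 1/2) / p s) \<partial>lborel)"
        by (simp add: \<kappa>_def)
      also have "\<dots> = of_real (FK s N / p s)" unfolding integral_complex_of_real by (simp add: FK_def)
      finally show ?thesis .
    qed
    have FK_meas: "(\<lambda>s. complex_of_real (FK s N / p s)) \<in> borel_measurable \<mu>" for N
    proof -
      have "(\<lambda>(s, y). complex_of_real (\<kappa> s y) * of_real (fejer_kernel N (y - 1/2))) \<in> borel_measurable (\<nu> \<Otimes>\<^sub>M lborel)"
        by measurable
      then have "(\<lambda>s. complex_of_real (FK s N / p s)) \<in> borel_measurable \<nu>"
        unfolding inner[symmetric] by (rule lborel.borel_measurable_lebesgue_integral)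
      then show ?thesis using measurable_cong_sets[OF sets_\<mu> refl] by blast
    qed
    have eq: "complex_of_real (\<integral>y. h y * fejer_kernel N (y - 1/2) \<partial>lborel) = (\<integral>s. complex_of_real (FK s N / p s) \<partial>\<mu>)" for N
    proof -
      have "(\<integral>y. h y * fejer_kernel N (y - 1/2) \<partial>lborel) = (\<integral>y. k y * fejer_kernel N (y - 1/2) \<partial>lborel)"
        by (rule integral_cong_AE) (measurable, use h_k in eventually_elim, simp)
      then have "complex_of_real (\<integral>y. h y * fejer_kernel N (y - 1/2) \<partial>lborel)
          = (\<integral>y. complex_of_real (k y) * of_real (fejer_kernel N (y - 1/2)) \<partial>lborel)"
        by (simp flip: integral_complex_of_real)
      also have "\<dots> = (\<integral>s. (\<integral>y. complex_of_real (\<kappa> s y) * of_real (fejer_kernel N (y - 1/2)) \<partial>lborel) \<partial>\<mu>)"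
        unfolding k_def by (rule mix(4)[where B="real N"]) (auto simp: fejer_kernel_nonneg fejer_kernel_le)
      finally show ?thesis unfolding inner .
    qed
    have "(\<lambda>N. \<integral>s. complex_of_real (FK s N / p s) \<partial>\<mu>) \<longlonglongrightarrow> (\<integral>s. 0 \<partial>\<mu>)"
    proof (rule integral_dominated_convergence[where w="\<lambda>_. 1"])
      show "integrable \<mu> (\<lambda>_. 1::real)" using fin by (simp add: finite_measure.integrable_const)
      show "AE s in \<mu>. (\<lambda>N. complex_of_real (FK s N / p s)) \<longlonglongrightarrow> 0"
      proof (rule AE_I2)
        fix s assume "s \<in> space \<mu>"
        then have "(\<lambda>N. FK s N / p s) \<longlonglongrightarrow> 0 / p s" unfolding divide_inverse
          by (intro tendsto_mult_right FK_lim) (simp add: space_\<mu>)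
        then show "(\<lambda>N. complex_of_real (FK s N / p s)) \<longlonglongrightarrow> 0"
          using tendsto_of_real_iff[where 'a=complex, of "\<lambda>N. FK s N / p s" 0] by simp
      qed
      show "AE s in \<mu>. norm (complex_of_real (FK s N / p s)) \<le> 1" for N
      proof (rule AE_I2)
        fix s assume "s \<in> space \<mu>"
        then have "s \<in> I" by (simp add: space_\<mu>)
        then have "\<bar>FK s N / p s\<bar> \<le> 1"
          using FK_bd[of s N] p_nn[of s] by (auto simp: divide_le_eq_1 le_less)
        then show "norm (complex_of_real (FK s N / p s)) \<le> 1" by (simp only: norm_of_real)
      qed
    qed (use FK_meas in auto)
    then have "(\<lambda>N. complex_of_real (\<integral>y. h y * fejer_kernel N (y - 1/2) \<partial>lborel)) \<longlonglongrightarrow> of_real 0"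
      unfolding eq by simp
    then show ?thesis by (simp only: tendsto_of_real_iff)
  qed
  have h_half_le: "h (1/2 + of_int m) \<le> 0" for m
  proof (rule fejer_lower_bound[OF h_int h_ae_nn _ fejer_0])
    show "isCont h (1/2 + of_int m)"
      using h_cont half_integer_nonzero[of m] by (simp add: continuous_on_eq_continuous_at open_Compl add.commute)
  qed
  have interp: "interpolates_at_half_integers g l"
    unfolding interpolates_at_half_integers_def
  proof
    fix n :: int
    define x where "x = real_of_int n + 1/2"
    have "x \<noteq> 0" unfolding x_def by (rule half_integer_nonzero)
    then have "h x = 0" using h_nn[of x] h_half_le[of n] by (simp add: x_def add.commute)
    then have "Re (l (of_real x)) = g x" by (simp add: h_def)
    then have "l (of_real x) = of_real (g x)" using l_real[of x] by (metis of_real_Re)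
    then show "l (of_real (of_int n + 1/2)) = of_real (g (of_int n + 1/2))" unfolding x_def .
  qed
  have l_dist: "L1_distance l g = R"
    unfolding L1_distance_def h_mass[symmetric]
    by (rule nn_integral_cong_AE) (use h_ae_nn in eventually_elim, simp add: h_def)
  have l_fin: "L1_distance l g < \<infinity>" using l_dist R_fin by simp
  note opt = interpolating_minorant_optimal[OF l_min interp assms(9) g_meas l_fin]
  have ext: "extremal_minorant_on (- {0}) g l"
    unfolding extremal_minorant_on_def
  proof (intro conjI allI impI l_min)
    fix H assume H: "minorant_on (- {0}) g H"
    show "L1_distance l g \<le> L1_distance H g"
    proof (cases "L1_distance H g < \<infinity>")
      case True then show ?thesis by (rule opt(1)[OF H])
    next
      case False
      then have "L1_distance H g = top" by (metis infinity_ennreal_def top.not_eq_extremum)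
      then show ?thesis by simp
    qed
  qed
  have uniq: "F = l" if F: "minorant_on (- {0}) g F" "L1_distance F g \<le> L1_distance l g" for F
    by (rule opt(2)[OF F(1) le_less_trans[OF F(2) l_fin] F(2)])
  have sub: "minorant_on (- {0}) g F" if "minorant_on UNIV g F" for F
    using that by (auto simp: minorant_on_def)
  \<comment> \<open>At the origin \<open>l\<close> is bounded by the lower limit of \<open>g\<close>, as \<open>l\<close> is continuous.\<close>
  have at_0: "minorant_on UNIV g l" if "Liminf (at 0) (\<lambda>x. ereal (g x)) \<le> ereal (g 0)"
  proof -
    have "((\<lambda>x. ereal (Re (l (of_real x)))) \<longlongrightarrow> ereal (Re (l (of_real 0)))) (at 0)"
    proof -
      have "isCont (\<lambda>x. Re (l (of_real x))) 0"
        using continuous_on_Re[OF l_cont] by (simp add: continuous_on_eq_continuous_at)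
      then show ?thesis unfolding isCont_def by (intro tendsto_ereal)
    qed
    then have "ereal (Re (l (of_real 0))) = Liminf (at 0) (\<lambda>x. ereal (Re (l (of_real x))))"
      by (intro lim_imp_Liminf[symmetric]) auto
    also have "\<dots> \<le> Liminf (at 0) (\<lambda>x. ereal (g x))"
      by (rule Liminf_mono) (use h_nn in \<open>auto simp: eventually_at_filter h_def intro!: always_eventually\<close>)
    also have "\<dots> \<le> ereal (g 0)" by (rule that)
    finally have "Re (l (of_real 0)) \<le> g 0" by simp
    then show ?thesis using l_min unfolding minorant_on_def by (metis Compl_iff singletonD)
  qed
  show ?thesis
  proof (intro exI[of _ l] conjI allI impI)
    show "extremal_minorant_on (- {0}) g l" by (rule ext)
    show "F = l" if "extremal_minorant_on (- {0}) g F" for F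
      using that l_min by (intro uniq) (auto simp: extremal_minorant_on_def)
    assume *: "Liminf (at 0) (\<lambda>x. ereal (g x)) \<le> ereal (g 0)"
    show "extremal_minorant g l"
      using at_0[OF *] ext sub by (auto simp: extremal_minorant_on_def)
    show "F = l" if "extremal_minorant g F" for F
      using that at_0[OF *] sub by (intro uniq) (auto simp: extremal_minorant_on_def)
  next
    show "interpolates_at_half_integers g l" by (rule interp)
    show "(\<integral>\<^sup>+x. ennreal (g x - Re (l (of_real x))) \<partial>lborel) =
       (\<integral>\<^sup>+s. (\<integral>\<^sup>+x. ennreal (G s x - Re (L s (of_real x))) \<partial>lborel) \<partial>\<nu>)"
      using h_mass by (simp add: h_def R_def)
  qed
qed

end
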